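(* Let $F$ be a once-punctured torus equipped with a point of the ($\mathcal N=1$) decorated super Teichmüller space $S\tilde T(F)$, with values in a finite-dimensional real Grassmann algebra $\mathbb{R}_{S[N]}$. Let $\mathcal{S}(F)$ denote the set of free homotopy classes of (essential, non-peripheral) simple closed curves on $F$. Then \[ \frac{1}{2}=\sum_{\gamma\in\mathcal{S}(F)}\left(\frac{1}{e^{\ell_\gamma}+1}+\frac{W_\gamma}{4}\,\frac{\sinh\frac{\ell_\gamma}{2}}{\cosh^2\frac{\ell_\gamma}{2}}\right), \] where $\ell_\gamma$ is the super length of $\gamma$ and $W_\gamma:=W_c$ for the unique ideal arc $c$ disjoint from $\gamma$; the series converges in the norm of $\mathbb{R}_{S[N]}$.
   Context: Grassmann algebra: $\mathbb{R}_{S[N]}$ is the real Grassmann algebra generated by anticommuting $\beta_{[1]},\dots,\beta_{[N]}$; every $x$ is uniquely $x=\sum_\lambda x_\lambda\beta_{[\lambda]}$ over increasing multi-indices $\lambda$ (with $\beta_{[\emptyset]}=1$), $x_\lambda\in\mathbb{R}$. The body $\epsilon(x)$ is the coefficient of $1$, and $\|x\|=\sum_\lambda|x_\lambda|$. Even elements are those involving only even-degree monomials, odd elements only odd-degree ones. Square roots, logarithms, $\cosh$, etc. of even elements with positive body are defined by Taylor expansion about the body. Setting: $S\tilde T(F)$ is the decorated $\mathrm{OSp}(1|2)$ super Teichmüller space of Penner–Zeitlin. A point of it assigns, for each ideal triangulation of $F$ (three pairwise disjoint, non-isotopic ideal arcs from the puncture to itself, cutting $F$ into two ideal triangles), an even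 $\lambda$-length with positive body to each arc (depending only on the arc), an odd $\mu$-invariant to each of the two triangles, and a spin structure which orients each arc. For an ideal arc $e$, let $\theta_1,\theta_2$ be the $\mu$-invariants of the two triangles adjacent to $e$ lying counter-clockwise and clockwise of $e$ respectively, relative to the spin orientation of $e$; set $W_e=\theta_1\theta_2$ (this depends only on $e$). If a triangulation has arcs with $\lambda$-lengths $a,b,c$ (letters denoting both arcs and $\lambda$-lengths), the super semi-perimeter is $h=\frac{a}{bc}+\frac{b}{ac}+\frac{c}{ab}+\frac{W_a}{a}+\frac{W_b}{b}+\frac{W_c}{c}$, which does not depend on the triangulation. For an ideal arc $c$, put $r_c=\tfrac12\big(ch-W_c+\sqrt{(ch-W_c)^2-4}\big)$. For $\gamma\in\mathcal S(F)$ with disjoint ideal arc $c$, the super length $\ell_\gamma$ is the length of the simple closed super geodesic in the class $\gamma$, which satisfies $e^{\ell_\gamma/2}=r_c$ (equivalently $ch-W_c=2\cosh(\ell_\gamma/2)$). *)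

theory Defs
  imports "HOL-Analysis.Analysis"
begin

text \<open>An element x is represented by its coefficient function: x L is the coefficient
of the monomial beta_[L] (the generators with indices in L multiplied in increasing
order), L a finite subset of the generator index set {1..N}.  beta_[{}] = 1.\<close>

type_synonym grass = "nat set \<Rightarrow> real"

definition gr_carrier :: "nat \<Rightarrow> grass \<Rightarrow> bool" where
  "gr_carrier N x \<longleftrightarrow> (\<forall>L. x L \<noteq> 0 \<longrightarrow> L \<subseteq> {1..N})"

definition gconst :: "real \<Rightarrow> grass" where
  "gconst r = (\<lambda>L. if L = {} then r else 0)"

definition gbody :: "grass \<Rightarrow> real" where
  "gbody x = x {}"

definition gadd :: "grass \<Rightarrow> grass \<Rightarrow> grass" where
  "gadd x y = (\<lambda>L. x L + y L)"

definition gsub :: "grass \<Rightarrow> grass \<Rightarrow> grass" where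
  "gsub x y = (\<lambda>L. x L - y L)"

definition gscale :: "real \<Rightarrow> grass \<Rightarrow> grass" where
  "gscale r x = (\<lambda>L. r * x L)"

text \<open>Sign of beta_[A] beta_[B] = sign * beta_[A \<union> B] for disjoint A, B.\<close>
definition gsgn :: "nat set \<Rightarrow> nat set \<Rightarrow> real" where
  "gsgn A B = (-1) ^ card {(i, j). i \<in> A \<and> j \<in> B \<and> j < i}"

definition gmul :: "grass \<Rightarrow> grass \<Rightarrow> grass" where
  "gmul x y = (\<lambda>L. if finite L then (\<Sum>A\<in>Pow L. gsgn A (L - A) * x A * y (L - A)) else 0)"

fun gpow :: "grass \<Rightarrow> nat \<Rightarrow> grass" where
  "gpow x 0 = gconst 1"
| "gpow x (Suc n) = gmul x (gpow x n)"

definition gnorm :: "nat \<Rightarrow> grass \<Rightarrow> real" where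
  "gnorm N x = (\<Sum>L\<in>Pow {1..N}. \<bar>x L\<bar>)"

definition gsum :: "'i set \<Rightarrow> ('i \<Rightarrow> grass) \<Rightarrow> grass" where
  "gsum G t = (\<lambda>L. \<Sum>g\<in>G. t g L)"

definition even_el :: "nat \<Rightarrow> grass \<Rightarrow> bool" where
  "even_el N x \<longleftrightarrow> gr_carrier N x \<and> (\<forall>L. x L \<noteq> 0 \<longrightarrow> even (card L))"

definition odd_el :: "nat \<Rightarrow> grass \<Rightarrow> bool" where
  "odd_el N x \<longleftrightarrow> gr_carrier N x \<and> (\<forall>L. x L \<noteq> 0 \<longrightarrow> odd (card L))"

text \<open>Functional calculus by Taylor expansion about the body:
  f(x) = sum_k f^(k)(body x)/k! * (x - body x)^k ; the nilpotent part n = x - body x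
  satisfies n^(N+1) = 0, so the sum can be truncated at k = N.\<close>
definition gfun :: "nat \<Rightarrow> (real \<Rightarrow> real) \<Rightarrow> grass \<Rightarrow> grass" where
  "gfun N f x = (\<lambda>L. \<Sum>k\<le>N. ((deriv ^^ k) f (gbody x) / fact k) *
                    gpow (gsub x (gconst (gbody x))) k L)"

definition gsqrt :: "nat \<Rightarrow> grass \<Rightarrow> grass" where "gsqrt N = gfun N sqrt"
definition glog :: "nat \<Rightarrow> grass \<Rightarrow> grass" where "glog N = gfun N ln"
definition gexp :: "nat \<Rightarrow> grass \<Rightarrow> grass" where "gexp N = gfun N exp"
definition gsinh :: "nat \<Rightarrow> grass \<Rightarrow> grass" where "gsinh N = gfun N sinh"
definition gcosh :: "nat \<Rightarrow> grass \<Rightarrow> grass" where "gcosh N = gfun N cosh"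
definition ginv :: "nat \<Rightarrow> grass \<Rightarrow> grass" where "ginv N = gfun N inverse"

definition gsums_to :: "nat \<Rightarrow> ('i \<Rightarrow> grass) \<Rightarrow> 'i set \<Rightarrow> grass \<Rightarrow> bool" where
  "gsums_to N t S s \<longleftrightarrow>
     (\<forall>\<epsilon>>0. \<exists>F. finite F \<and> F \<subseteq> S \<and>
        (\<forall>G. finite G \<and> F \<subseteq> G \<and> G \<subseteq> S \<longrightarrow> gnorm N (gsub (gsum G t) s) < \<epsilon>))"

text \<open>Isotopy classes of ideal arcs on F (and likewise free homotopy classes of essential
non-peripheral simple closed curves) correspond to slopes p/q in Q \<union> {\<infinity>}, represented
by a primitive integer vector (p,q) normalised up to sign.\<close>
definition slopes :: "(int \<times> int) set" where
  "slopes = {(p, q). coprime p q \<and> (0 < q \<or> (q = 0 \<and> p = 1))}"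

definition ideal_arcs :: "(int \<times> int) set" where "ideal_arcs = slopes"

definition scc :: "(int \<times> int) set" where "scc = slopes"

definition det2 :: "int \<times> int \<Rightarrow> int \<times> int \<Rightarrow> int" where
  "det2 a b = fst a * snd b - snd a * fst b"

text \<open>The unique ideal arc disjoint from the simple closed curve gamma has the same slope.\<close>
definition disjoint_arc :: "int \<times> int \<Rightarrow> int \<times> int" where
  "disjoint_arc \<gamma> = \<gamma>"

text \<open>Ideal triangulations: three arcs with pairwise intersection number |det| = 1.\<close>
definition is_triang :: "int \<times> int \<Rightarrow> int \<times> int \<Rightarrow> int \<times> int \<Rightarrow> bool" where
  "is_triang a b c \<longleftrightarrow> a \<in> ideal_arcs \<and> b \<in> ideal_arcs \<and> c \<in> ideal_arcs \<and>
     \<bar>det2 a b\<bar> = 1 \<and> \<bar>det2 b c\<bar> = 1 \<and> \<bar>det2 a c\<bar> = 1"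

text \<open>A point is recorded by its lambda-lengths lam e and the invariants W e = theta_1 theta_2 of
the ideal arcs.  For the torus both triangles of any triangulation are adjacent to every arc, so
W e = +- theta sigma where theta, sigma are the mu-invariants of the two triangles (theta sigma is
preserved under super Ptolemy flips), the sign being dictated by the spin orientation of e.
Under the flip of c into d in the quadrilateral with sides a,b,a,b the super Ptolemy relation of
Penner--Zeitlin reads c d = a^2 + b^2 + a b W_c, and W_d = W_c.\<close>
definition sTeich :: "nat \<Rightarrow> (int \<times> int \<Rightarrow> grass) \<Rightarrow> (int \<times> int \<Rightarrow> grass) \<Rightarrow> bool" where
  "sTeich N lam W \<longleftrightarrow>
     (\<forall>e\<in>ideal_arcs. even_el N (lam e) \<and> gbody (lam e) > 0) \<and>
     (\<exists>\<theta> \<sigma>. odd_el N \<theta> \<and> odd_el N \<sigma> \<and>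
        (\<forall>e\<in>ideal_arcs. W e = gmul \<theta> \<sigma> \<or> W e = gscale (-1) (gmul \<theta> \<sigma>))) \<and>
     (\<forall>a b c d. is_triang a b c \<and> is_triang a b d \<and> c \<noteq> d \<longrightarrow>
        gmul (lam c) (lam d) =
          gadd (gadd (gmul (lam a) (lam a)) (gmul (lam b) (lam b)))
               (gmul (gmul (lam a) (lam b)) (W c))
        \<and> W d = W c)"

text \<open>Super semi-perimeter h, computed in the triangulation with slopes 1/0, 0/1, 1/1
(it is independent of the triangulation).\<close>
definition super_h :: "nat \<Rightarrow> (int \<times> int \<Rightarrow> grass) \<Rightarrow> (int \<times> int \<Rightarrow> grass) \<Rightarrow> grass" where
  "super_h N lam W =
    (let a = lam (1, 0); b = lam (0, 1); c = lam (1, 1);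
         Wa = W (1, 0); Wb = W (0, 1); Wc = W (1, 1)
     in gadd (gadd (gadd (gmul a (ginv N (gmul b c))) (gmul b (ginv N (gmul a c))))
                   (gmul c (ginv N (gmul a b))))
             (gadd (gadd (gmul Wa (ginv N a)) (gmul Wb (ginv N b))) (gmul Wc (ginv N c))))"

definition r_arc :: "nat \<Rightarrow> (int \<times> int \<Rightarrow> grass) \<Rightarrow> (int \<times> int \<Rightarrow> grass) \<Rightarrow> int \<times> int \<Rightarrow> grass" where
  "r_arc N lam W c =
    (let X = gsub (gmul (lam c) (super_h N lam W)) (W c)
     in gscale (1/2) (gadd X (gsqrt N (gsub (gmul X X) (gconst 4)))))"

definition super_length :: "nat \<Rightarrow> (int \<times> int \<Rightarrow> grass) \<Rightarrow> (int \<times> int \<Rightarrow> grass) \<Rightarrow> int \<times> int \<Rightarrow> grass" where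
  "super_length N lam W \<gamma> = gscale 2 (glog N (r_arc N lam W (disjoint_arc \<gamma>)))"

definition W_curve :: "(int \<times> int \<Rightarrow> grass) \<Rightarrow> int \<times> int \<Rightarrow> grass" where
  "W_curve W \<gamma> = W (disjoint_arc \<gamma>)"

definition mcshane_term :: "nat \<Rightarrow> (int \<times> int \<Rightarrow> grass) \<Rightarrow> (int \<times> int \<Rightarrow> grass) \<Rightarrow> int \<times> int \<Rightarrow> grass" where
  "mcshane_term N lam W \<gamma> =
    (let l = super_length N lam W \<gamma>
     in gadd (ginv N (gadd (gexp N l) (gconst 1)))
             (gmul (gscale (1/4) (W_curve W \<gamma>))
                   (gmul (gsinh N (gscale (1/2) l))
                         (ginv N (gpow (gcosh N (gscale (1/2) l)) 2)))))"

end

theory Submission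
  imports Defs "HOL-Computational_Algebra.Formal_Power_Series"
begin

text \<open>Put X = \<lambda> h and Y = X - W, all in the commutative ring of even Grassmann elements, where products
  of W-invariants vanish. The semi-perimeter h does not change under flips, so at an edge (s, t) of the
  Farey tree X satisfies X (s + t) + X (s - t) = X s X t - W s X t - W t X s. Following Bowditch, the
  summand of a slope s is (rho s + W s / 2) / X s, where rho s = exp (- length / 2) is the root of
  r^2 - Y s r + 1 with small body, and the quantity
  X (s - t) / (X s X t) - rho s / X s - rho t / X t splits additively, up to twice the summand of s + t,
  over the two child edges. It remains to see that what is left over at infinity vanishes. The bodies
  form an ordinary Markov tree and grow exponentially with the height |p| + |q| of the slope p/q, while the
  normalised coefficients of X relative to its body solve a perturbed additive recursion and
  grow only polynomially. Hence everything decays exponentially in the height, coefficientwise.\<close>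

section \<open>The algebra of even Grassmann elements\<close>

text \<open>The delicate point is the decay of the edge quantity. Along a branch that keeps s and
  lets t run off to infinity, X (s - t) / (X s X t) and rho s / X s do not tend to 0 separately.
  Only their difference does, because X (s - t) / X t and rho s solve the same quadratic up to an
  error with a factor 1 / X t, while the other root stays away from both. This requires the body of
  X (s - t) / (X s X t) to stay below 1/2. Near the top of the tree it need not, so the estimates
  are made on subtrees whose root edge satisfies the bound, and an induction over edges assembles
  the whole tree from finitely many of them. Since W has body zero, each coefficient of X obeys the
  linearised recursion of the bodies, with an inhomogeneity built from W and from coefficients of X
  at smaller index sets; hence an induction over index sets. Analytic functions are treated as power
  series in the nilpotent part, so that identities between them become identities of formal power
  series.\<close>

lemma gsgn_Un_left:
  assumes "finite A" "finite B" "finite C" "A \<inter> B = {}"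
  shows "gsgn (A \<union> B) C = gsgn A C * gsgn B C"
proof -
  have eq: "{(i, j). i \<in> A \<union> B \<and> j \<in> C \<and> j < i} =
      {(i, j). i \<in> A \<and> j \<in> C \<and> j < i} \<union> {(i, j). i \<in> B \<and> j \<in> C \<and> j < i}" by auto
  have fin: "finite {(i, j). i \<in> X \<and> j \<in> C \<and> j < i}" if "finite X" for X
    by (rule finite_subset[of _ "X \<times> C"]) (use that assms in auto)
  have "card {(i, j). i \<in> A \<union> B \<and> j \<in> C \<and> j < i} =
      card {(i, j). i \<in> A \<and> j \<in> C \<and> j < i} + card {(i, j). i \<in> B \<and> j \<in> C \<and> j < i}"
    unfolding eq by (rule card_Un_disjoint) (use fin assms in auto)
  then show ?thesis by (simp add: gsgn_def power_add)
qed

lemma gsgn_Un_right: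
  assumes "finite A" "finite B" "finite C" "B \<inter> C = {}"
  shows "gsgn A (B \<union> C) = gsgn A B * gsgn A C"
proof -
  have eq: "{(i, j). i \<in> A \<and> j \<in> B \<union> C \<and> j < i} =
      {(i, j). i \<in> A \<and> j \<in> B \<and> j < i} \<union> {(i, j). i \<in> A \<and> j \<in> C \<and> j < i}" by auto
  have fin: "finite {(i, j). i \<in> A \<and> j \<in> X \<and> j < i}" if "finite X" for X
    by (rule finite_subset[of _ "A \<times> X"]) (use that assms in auto)
  have "card {(i, j). i \<in> A \<and> j \<in> B \<union> C \<and> j < i} =
      card {(i, j). i \<in> A \<and> j \<in> B \<and> j < i} + card {(i, j). i \<in> A \<and> j \<in> C \<and> j < i}"
    unfolding eq by (rule card_Un_disjoint) (use fin assms in auto)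
  then show ?thesis by (simp add: gsgn_def power_add)
qed

text \<open>Every pair in A \<times> B is an inversion for exactly one of the two orders, so the two
  inversion counts add up to \<open>card A * card B\<close>.\<close>

lemma gsgn_swap:
  assumes "finite A" "finite B" "A \<inter> B = {}"
  shows "gsgn B A = (-1) ^ (card A * card B) * gsgn A B"
proof -
  let ?P = "{(i, j). i \<in> A \<and> j \<in> B \<and> j < i}" and ?Q = "{(i, j). i \<in> B \<and> j \<in> A \<and> j < i}"
  have "A \<times> B = ?P \<union> prod.swap ` ?Q"
    using assms(3) by (force simp: image_iff)
  moreover have "?P \<inter> prod.swap ` ?Q = {}" by auto
  moreover have "finite ?P" by (rule finite_subset[of _ "A \<times> B"]) (use assms in auto)
  moreover have "finite ?Q" by (rule finite_subset[of _ "B \<times> A"]) (use assms in auto)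
  ultimately have "card (A \<times> B) = card ?P + card (prod.swap ` ?Q)"
    by (simp add: card_Un_disjoint)
  also have "card (prod.swap ` ?Q) = card ?Q" by (rule card_image) (auto intro: inj_onI)
  finally have c: "card A * card B = card ?P + card ?Q" by (simp add: card_cartesian_product)
  show ?thesis unfolding gsgn_def c by (simp add: power_add flip: power_mult_distrib)
qed

lemma gsgn_empty [simp]: "gsgn {} B = 1" "gsgn A {} = 1"
  by (simp_all add: gsgn_def)

lemma abs_gsgn [simp]: "\<bar>gsgn A B\<bar> = 1"
  by (simp add: gsgn_def power_abs)

text \<open>Both sides are sums over ordered partitions of L into three blocks. The signs agree
  because \<open>gsgn\<close> is multiplicative under disjoint unions in either argument.\<close>

lemma gmul_assoc: "gmul (gmul x y) z = gmul x (gmul y z)"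
proof (rule ext)
  fix L
  show "gmul (gmul x y) z L = gmul x (gmul y z) L"
  proof (cases "finite L")
    case True
    have fs: "finite A" if "A \<subseteq> L" for A using that True finite_subset by blast
    have "gmul (gmul x y) z L = (\<Sum>A\<in>Pow L. \<Sum>B\<in>Pow A.
        gsgn A (L - A) * (gsgn B (A - B) * x B * y (A - B)) * z (L - A))"
      using True fs by (auto simp: gmul_def sum_distrib_left sum_distrib_right intro!: sum.cong)
    also have "\<dots> = (\<Sum>(A, B)\<in>Sigma (Pow L) Pow.
        gsgn A (L - A) * (gsgn B (A - B) * x B * y (A - B)) * z (L - A))"
      by (rule sum.Sigma) (use True fs in auto)
    also have "\<dots> = (\<Sum>(B, C)\<in>Sigma (Pow L) (\<lambda>B. Pow (L - B)).
        gsgn B (L - B) * x B * (gsgn C (L - B - C) * y C * z (L - B - C)))"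
    proof (rule sum.reindex_bij_witness[where i = "\<lambda>(B, C). (B \<union> C, B)" and j = "\<lambda>(A, B). (B, A - B)"])
      fix p assume "p \<in> Sigma (Pow L) Pow"
      then obtain A B where p: "p = (A, B)" and AB: "A \<subseteq> L" "B \<subseteq> A" by auto
      have e1: "L - B - (A - B) = L - A" using AB by auto
      have "gsgn (B \<union> (A - B)) (L - A) = gsgn B (L - A) * gsgn (A - B) (L - A)"
        by (rule gsgn_Un_left) (use AB fs True finite_subset in auto)
      moreover have "gsgn B ((A - B) \<union> (L - A)) = gsgn B (A - B) * gsgn B (L - A)"
        by (rule gsgn_Un_right) (use AB fs True finite_subset in auto)
      moreover have "B \<union> (A - B) = A" "(A - B) \<union> (L - A) = L - B" using AB by auto
      ultimately show "(case case p of (A, B) \<Rightarrow> (B, A - B) of (B, C) \<Rightarrow>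
          gsgn B (L - B) * x B * (gsgn C (L - B - C) * y C * z (L - B - C))) =
        (case p of (A, B) \<Rightarrow> gsgn A (L - A) * (gsgn B (A - B) * x B * y (A - B)) * z (L - A))"
        unfolding p by (simp add: e1)
      show "(case case p of (A, B) \<Rightarrow> (B, A - B) of (B, C) \<Rightarrow> (B \<union> C, B)) = p"
        "(case p of (A, B) \<Rightarrow> (B, A - B)) \<in> Sigma (Pow L) (\<lambda>B. Pow (L - B))"
        unfolding p using AB by auto
    next
      fix p assume "p \<in> Sigma (Pow L) (\<lambda>B. Pow (L - B))"
      then obtain B C where p: "p = (B, C)" and BC: "B \<subseteq> L" "C \<subseteq> L - B" by auto
      have "(B \<union> C) - B = C" "B \<union> C \<subseteq> L" using BC by blast+
      then show "(case case p of (B, C) \<Rightarrow> (B \<union> C, B) of (A, B) \<Rightarrow> (B, A - B)) = p"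
        "(case p of (B, C) \<Rightarrow> (B \<union> C, B)) \<in> Sigma (Pow L) Pow"
        unfolding p by simp_all
    qed
    also have "\<dots> = (\<Sum>B\<in>Pow L. \<Sum>C\<in>Pow (L - B).
        gsgn B (L - B) * x B * (gsgn C (L - B - C) * y C * z (L - B - C)))"
      by (rule sum.Sigma[symmetric]) (use True fs in auto)
    also have "\<dots> = gmul x (gmul y z) L"
      using True fs by (auto simp: gmul_def sum_distrib_left sum_distrib_right intro!: sum.cong)
    finally show ?thesis .
  qed (simp add: gmul_def)
qed

text \<open>Serves twice: c = 1 gives commutativity of even elements, c = -1 anticommutativity of
  odd ones.\<close>

lemma gmul_swap:
  assumes "\<And>A B. finite A \<Longrightarrow> finite B \<Longrightarrow> x A \<noteq> 0 \<Longrightarrow> y B \<noteq> 0 \<Longrightarrow> (-1) ^ (card A * card B) = (c :: real)"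
  shows "gmul y x = gscale c (gmul x y)"
proof (rule ext)
  fix L
  show "gmul y x L = gscale c (gmul x y) L"
  proof (cases "finite L")
    case True
    have "(\<Sum>A\<in>Pow L. gsgn A (L - A) * y A * x (L - A)) =
        (\<Sum>A\<in>Pow L. gsgn (L - A) A * y (L - A) * x A)"
      by (rule sum.reindex_bij_witness[where i = "\<lambda>A. L - A" and j = "\<lambda>A. L - A"])
         (auto simp: double_diff)
    also have "\<dots> = (\<Sum>A\<in>Pow L. c * (gsgn A (L - A) * x A * y (L - A)))"
    proof (rule sum.cong[OF refl])
      fix A assume "A \<in> Pow L"
      then have f: "finite A" "finite (L - A)" using True finite_subset by auto
      show "gsgn (L - A) A * y (L - A) * x A = c * (gsgn A (L - A) * x A * y (L - A))"
        using gsgn_swap[OF f] assms[OF f] by (cases "x A = 0 \<or> y (L - A) = 0") auto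
    qed
    finally show ?thesis using True by (simp add: gmul_def gscale_def sum_distrib_left)
  qed (simp add: gmul_def gscale_def)
qed

lemma gmul_gadd_left: "gmul (gadd x y) z = gadd (gmul x z) (gmul y z)"
  by (rule ext) (simp add: gmul_def gadd_def algebra_simps sum.distrib)

lemma gmul_gscale: "gmul (gscale a x) y = gscale a (gmul x y)" "gmul x (gscale a y) = gscale a (gmul x y)"
  by (rule ext; simp add: gmul_def gscale_def sum_distrib_left mult_ac)+

lemma gmul_gconst_left:
  assumes "\<And>L. infinite L \<Longrightarrow> x L = 0"
  shows "gmul (gconst c) x = gscale c x"
proof (rule ext)
  fix L
  show "gmul (gconst c) x L = gscale c x L"
  proof (cases "finite L")
    case True
    have "(\<Sum>A\<in>Pow L. gsgn A (L - A) * gconst c A * x (L - A)) =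
        (\<Sum>A\<in>{{}}. gsgn A (L - A) * gconst c A * x (L - A))"
      by (rule sum.mono_neutral_right) (use True in \<open>auto simp: gconst_def\<close>)
    then show ?thesis using True by (simp add: gmul_def gscale_def gconst_def)
  qed (simp add: gmul_def gscale_def assms)
qed

lemma gmul_nonzeroE:
  assumes "gmul x y L \<noteq> 0"
  obtains A where "finite L" "A \<subseteq> L" "x A \<noteq> 0" "y (L - A) \<noteq> 0"
proof -
  have f: "finite L" using assms by (auto simp: gmul_def split: if_splits)
  then have "(\<Sum>A\<in>Pow L. gsgn A (L - A) * x A * y (L - A)) \<noteq> 0" using assms by (simp add: gmul_def)
  then obtain A where "A \<in> Pow L" "gsgn A (L - A) * x A * y (L - A) \<noteq> 0"
    by (rule sum.not_neutral_contains_not_neutral)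
  then show thesis using f by (intro that[of A]) auto
qed

lemma gmul_even:
  assumes "\<And>L. x L \<noteq> 0 \<Longrightarrow> even (card L)" "\<And>L. y L \<noteq> 0 \<Longrightarrow> even (card L)" "gmul x y L \<noteq> 0"
  shows "finite L \<and> even (card L)"
proof -
  obtain A where f: "finite L" and A: "A \<subseteq> L" "x A \<noteq> 0" "y (L - A) \<noteq> 0"
    using gmul_nonzeroE[OF assms(3)] .
  then have "even (card A)" "even (card (L - A))" using assms by auto
  moreover have "card L = card A + card (L - A)"
    using A f by (metis card_Diff_subset card_mono finite_subset le_add_diff_inverse)
  ultimately show ?thesis using f by simp
qed

text \<open>The odd invariants enter only through the products W, so even elements suffice and form
  a commutative ring in which ordinary algebraic simplification is available. Finiteness of L is
  required because \<open>gmul\<close> vanishes on infinite sets, so that 1 would not be neutral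
  otherwise. No N is built in; it returns later as a support condition.\<close>

typedef evg = "{x :: grass. \<forall>L. x L \<noteq> 0 \<longrightarrow> finite L \<and> even (card L)}"
  morphisms coef Evg
  by (rule exI[of _ "gconst 0"]) (auto simp: gconst_def)

setup_lifting type_definition_evg

lemma coef_infinite [simp]: "infinite L \<Longrightarrow> coef x L = 0"
  using coef[of x] by auto

lemma coef_odd: "odd (card L) \<Longrightarrow> coef x L = 0"
  using coef[of x] by auto

lemma evg_eqI: "(\<And>L. finite L \<Longrightarrow> coef x L = coef y L) \<Longrightarrow> x = y"
  by (metis coef_infinite coef_inject ext)

instantiation evg :: comm_ring_1
begin
lift_definition zero_evg :: evg is "gconst 0" by (auto simp: gconst_def)
lift_definition one_evg :: evg is "gconst 1" by (auto simp: gconst_def split: if_splits)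
lift_definition plus_evg :: "evg \<Rightarrow> evg \<Rightarrow> evg" is gadd
  by (auto simp: gadd_def) (metis add.left_neutral)+
lift_definition minus_evg :: "evg \<Rightarrow> evg \<Rightarrow> evg" is gsub
  by (auto simp: gsub_def) (metis diff_zero)+
lift_definition uminus_evg :: "evg \<Rightarrow> evg" is "gscale (-1)" by (auto simp: gscale_def)
lift_definition times_evg :: "evg \<Rightarrow> evg \<Rightarrow> evg" is gmul
  using gmul_even by blast
instance
proof
  fix a b c :: evg
  show "a * b * c = a * (b * c)" by transfer (rule gmul_assoc)
  show "a * b = b * a"
  proof transfer
    fix a b :: grass
    assume a: "\<forall>L. a L \<noteq> 0 \<longrightarrow> finite L \<and> even (card L)" "\<forall>L. b L \<noteq> 0 \<longrightarrow> finite L \<and> even (card L)"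
    have "gmul a b = gscale 1 (gmul b a)" by (rule gmul_swap) (use a in auto)
    then show "gmul a b = gmul b a" by (simp add: gscale_def)
  qed
  show "(a + b) * c = a * c + b * c" by transfer (rule gmul_gadd_left)
  show "1 * a = a"
  proof transfer
    fix a :: grass assume a: "\<forall>L. a L \<noteq> 0 \<longrightarrow> finite L \<and> even (card L)"
    have "gmul (gconst 1) a = gscale 1 a" by (rule gmul_gconst_left) (use a in auto)
    then show "gmul (gconst 1) a = a" by (simp add: gscale_def)
  qed
  show "(0::evg) \<noteq> 1" by transfer (auto simp: gconst_def fun_eq_iff)
qed (transfer; auto simp: gadd_def gsub_def gscale_def gconst_def fun_eq_iff)+
end

instantiation evg :: real_algebra_1
begin
lift_definition scaleR_evg :: "real \<Rightarrow> evg \<Rightarrow> evg" is gscale by (auto simp: gscale_def)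
instance
proof
  fix a b :: real and x y :: evg
  show "a *\<^sub>R (x + y) = a *\<^sub>R x + a *\<^sub>R y" "(a + b) *\<^sub>R x = a *\<^sub>R x + b *\<^sub>R x"
    "a *\<^sub>R b *\<^sub>R x = (a * b) *\<^sub>R x" "1 *\<^sub>R x = x"
    by (transfer; simp add: gadd_def gscale_def algebra_simps)+
  show "a *\<^sub>R x * y = a *\<^sub>R (x * y)" "x * a *\<^sub>R y = a *\<^sub>R (x * y)"
    by (transfer; rule gmul_gscale)+
qed
end

lemma coef_simps [simp]:
  "coef (x + y) L = coef x L + coef y L"
  "coef (x - y) L = coef x L - coef y L"
  "coef (- x) L = - coef x L"
  "coef (a *\<^sub>R x) L = a * coef x L"
  "coef 0 L = 0"
  by (transfer; simp add: gadd_def gsub_def gscale_def gconst_def)+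

lemma coef_mult:
  "coef (x * y) L = (if finite L then (\<Sum>A\<in>Pow L. gsgn A (L - A) * coef x A * coef y (L - A)) else 0)"
  by transfer (simp add: gmul_def)

lemma coef_of_real: "coef (of_real c) L = (if L = {} then c else 0)"
  unfolding of_real_def by transfer (simp add: gscale_def gconst_def)

lemma coef_one: "coef 1 L = (if L = {} then 1 else 0)"
  by transfer (simp add: gconst_def)

lemma coef_sum: "coef (sum f A) L = (\<Sum>i\<in>A. coef (f i) L)"
  by (induction A rule: infinite_finite_induct) auto

section \<open>Nilpotent elements and the evaluation of power series at them\<close>

definition body :: "evg \<Rightarrow> real" where "body x = coef x {}"

lemma body_simps [simp]:
  "body (x + y) = body x + body y" "body (x - y) = body x - body y" "body (- x) = - body x"
  "body (a *\<^sub>R x) = a * body x" "body 0 = 0" "body 1 = 1" "body (x * y) = body x * body y"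
  "body (of_real c) = c" "body (sum f A) = (\<Sum>i\<in>A. body (f i))"
  by (simp_all add: body_def coef_mult coef_of_real coef_one coef_sum)

text \<open>A monomial in a product of k factors without constant term is indexed by a union of k
  disjoint nonempty sets, hence by at least k elements.\<close>

lemma coef_power_eq_0:
  assumes "body x = 0" "card L < k"
  shows "coef (x ^ k) L = 0"
  using assms(2)
proof (induction k arbitrary: L)
  case (Suc k)
  show ?case
  proof (cases "finite L")
    case True
    have "gsgn A (L - A) * coef x A * coef (x ^ k) (L - A) = 0" if "A \<subseteq> L" for A
    proof (cases "A = {}")
      case True
      then show ?thesis using assms(1) by (simp add: body_def)
    next
      case False
      then have "L - A \<subset> L" using that by auto
      then have "card (L - A) < card L" using \<open>finite L\<close> by (rule psubset_card_mono[rotated])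
      then show ?thesis using Suc by simp
    qed
    then show ?thesis by (auto simp: coef_mult intro!: sum.neutral)
  qed simp
qed simp

text \<open>Cutting the series at \<open>card L\<close> makes every coefficient a finite sum without
  reference to N. If x has body zero, nothing is lost by \<open>coef_power_eq_0\<close>.\<close>

definition fps_eval :: "evg \<Rightarrow> real fps \<Rightarrow> evg" where
  "fps_eval x F = Evg (\<lambda>L. if finite L then (\<Sum>k\<le>card L. fps_nth F k * coef (x ^ k) L) else 0)"

lemma coef_fps_eval: "finite L \<Longrightarrow> coef (fps_eval x F) L = (\<Sum>k\<le>card L. fps_nth F k * coef (x ^ k) L)"
proof -
  have "odd (card L) \<Longrightarrow> (\<Sum>k\<le>card L. fps_nth F k * coef (x ^ k) L) = 0" for L
    by (simp add: coef_odd)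
  then show "finite L \<Longrightarrow> ?thesis"
    unfolding fps_eval_def by (subst Evg_inverse) auto
qed

lemma coef_fps_eval_bound:
  assumes "body x = 0" "finite L" "card L \<le> n"
  shows "coef (fps_eval x F) L = (\<Sum>k\<le>n. fps_nth F k * coef (x ^ k) L)"
proof -
  have "(\<Sum>k\<le>n. fps_nth F k * coef (x ^ k) L) = (\<Sum>k\<le>card L. fps_nth F k * coef (x ^ k) L)"
    by (rule sum.mono_neutral_right) (use assms coef_power_eq_0 in auto)
  then show ?thesis using assms by (simp add: coef_fps_eval)
qed

lemma body_fps_eval [simp]: "body (fps_eval x F) = fps_nth F 0"
  by (simp add: body_def coef_fps_eval coef_one)

lemma fps_eval_add: "fps_eval x (F + G) = fps_eval x F + fps_eval x G"
  by (rule evg_eqI) (simp add: coef_fps_eval algebra_simps sum.distrib)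

lemma fps_eval_1: "fps_eval x 1 = 1"
  by (rule evg_eqI) (simp add: coef_fps_eval if_distrib[of "\<lambda>c. c * _"] cong: if_cong)

lemma fps_eval_X:
  assumes "body x = 0" shows "fps_eval x fps_X = x"
proof (rule evg_eqI)
  fix L :: "nat set" assume "finite L"
  then show "coef (fps_eval x fps_X) L = coef x L"
    using assms by (subst coef_fps_eval_bound[where n = "Suc (card L)"])
      (auto simp: body_def fps_X_def if_distrib[of "\<lambda>c. c * _"] simp del: sum.atMost_Suc cong: if_cong)
qed

lemma evg_power_scaleR: "(c *\<^sub>R x :: evg) ^ n = c ^ n *\<^sub>R x ^ n"
  by (induction n) auto

lemma fps_eval_scaleR: "fps_eval (c *\<^sub>R x) F = fps_eval x (Abs_fps (\<lambda>k. c ^ k * fps_nth F k))"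
  by (rule evg_eqI) (simp add: coef_fps_eval evg_power_scaleR mult_ac)

lemma fps_eval_as_sum:
  assumes "body x = 0" "finite L" "card L \<le> n"
  shows "coef (fps_eval x F) L = coef (\<Sum>k\<le>n. fps_nth F k *\<^sub>R x ^ k) L"
  using assms by (simp add: coef_fps_eval_bound coef_sum)

text \<open>Only coefficients at subsets of L enter, so a truncation that is valid on all subsets of
  L may be substituted inside a product.\<close>

lemma coef_mult_cong:
  assumes "\<And>A. A \<subseteq> L \<Longrightarrow> coef x A = coef x' A" "\<And>A. A \<subseteq> L \<Longrightarrow> coef y A = coef y' A"
  shows "coef (x * y) L = coef (x' * y') L"
  using assms by (auto simp: coef_mult intro!: sum.cong)

lemma fps_eval_mult:
  assumes x: "body x = 0"
  shows "fps_eval x (F * G) = fps_eval x F * fps_eval x G"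
proof (rule evg_eqI)
  fix L :: "nat set" assume L: "finite L"
  define n where "n = card L"
  have high: "coef (x ^ k) L = 0" if "n < k" for k
    using that coef_power_eq_0[OF x] n_def by simp
  have sub: "finite A \<and> card A \<le> n" if "A \<subseteq> L" for A
    using that L finite_subset card_mono n_def by metis
  have "coef (fps_eval x F * fps_eval x G) L =
      coef ((\<Sum>k\<le>n. fps_nth F k *\<^sub>R x ^ k) * (\<Sum>k\<le>n. fps_nth G k *\<^sub>R x ^ k)) L"
    by (rule coef_mult_cong) (use fps_eval_as_sum[OF x] sub in auto)
  also have "\<dots> = (\<Sum>(i, j)\<in>{..n} \<times> {..n}. fps_nth F i * fps_nth G j * coef (x ^ (i + j)) L)"
    by (simp add: sum_product coef_sum power_add sum.cartesian_product case_prod_unfold mult_ac)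
  also have "\<dots> = (\<Sum>(i, j)\<in>{(i, j). i + j \<le> n}. fps_nth F i * fps_nth G j * coef (x ^ (i + j)) L)"
    by (rule sum.mono_neutral_right) (auto, meson high not_le)
  also have "\<dots> = (\<Sum>k\<le>n. \<Sum>i\<le>k. fps_nth F i * fps_nth G (k - i) * coef (x ^ (i + (k - i))) L)"
    by (rule sum.triangle_reindex_eq)
  also have "\<dots> = coef (fps_eval x (F * G)) L"
    using L by (simp add: coef_fps_eval n_def fps_mult_nth atLeast0AtMost sum_distrib_right)
  finally show "coef (fps_eval x (F * G)) L = coef (fps_eval x F * fps_eval x G) L" by simp
qed

lemma fps_eval_power: "body x = 0 \<Longrightarrow> fps_eval x (F ^ k) = fps_eval x F ^ k"
  by (induction k) (auto simp: fps_eval_1 fps_eval_mult)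

lemma fps_eval_compose:
  assumes x: "body x = 0" and G: "fps_nth G 0 = 0"
  shows "fps_eval x (F oo G) = fps_eval (fps_eval x G) F"
proof (rule evg_eqI)
  fix L :: "nat set" assume L: "finite L"
  \<comment> \<open>Since \<open>G ^ k\<close> starts in degree k, the composition sum over k \<le>
    n may be extended to k \<le> \<open>card L\<close>, a range independent of n, and the two sums
    can be exchanged.\<close>
  have z: "fps_nth (G ^ k) n = 0" if "n < k" for n k
    using startsby_zero_power_prefix[OF G] that by blast
  have "coef (fps_eval x (F oo G)) L =
      (\<Sum>n\<le>card L. \<Sum>k\<le>card L. fps_nth F k * fps_nth (G ^ k) n * coef (x ^ n) L)"
  proof -
    have "fps_nth (F oo G) n = (\<Sum>k\<le>card L. fps_nth F k * fps_nth (G ^ k) n)" if "n \<le> card L" for n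
      unfolding fps_compose_nth by (rule sum.mono_neutral_left) (use that z in auto)
    then show ?thesis using L by (simp add: coef_fps_eval sum_distrib_right)
  qed
  also have "\<dots> = (\<Sum>k\<le>card L. \<Sum>n\<le>card L. fps_nth F k * fps_nth (G ^ k) n * coef (x ^ n) L)"
    by (rule sum.swap)
  also have "\<dots> = coef (fps_eval (fps_eval x G) F) L"
    using L x by (simp add: coef_fps_eval fps_eval_power[symmetric] sum_distrib_left mult_ac)
  finally show "coef (fps_eval x (F oo G)) L = coef (fps_eval (fps_eval x G) F) L" .
qed

section \<open>Taylor calculus\<close>

definition nilpart :: "evg \<Rightarrow> evg" where "nilpart x = x - of_real (body x)"

lemma body_nilpart [simp]: "body (nilpart x) = 0"
  by (simp add: nilpart_def)

lemma body_plus_nilpart: "of_real (body x) + nilpart x = x"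
  by (simp add: nilpart_def)

definition efun :: "(real \<Rightarrow> real) \<Rightarrow> evg \<Rightarrow> evg" where
  "efun f x = fps_eval (nilpart x) (Abs_fps (\<lambda>k. (deriv ^^ k) f (body x) / fact k))"

lemma body_efun [simp]: "body (efun f x) = f (body x)"
  by (simp add: efun_def)

text \<open>All iterated derivatives are guessed at once. The set S is open because
  \<open>deriv\<close> looks at a neighbourhood; the formulas for \<open>ln\<close>,
  \<open>sqrt\<close> and \<open>inverse\<close> hold on part of the line only.\<close>

lemma higher_deriv_eq:
  assumes "open S" "\<And>x. x \<in> S \<Longrightarrow> f x = g 0 x"
    and "\<And>k x. x \<in> S \<Longrightarrow> (g k has_real_derivative g (Suc k) x) (at x)" "x \<in> S"
  shows "(deriv ^^ k) f x = g k x"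
  using assms(4)
proof (induction k arbitrary: x)
  case (Suc k)
  have "eventually (\<lambda>y. y \<in> S) (nhds x)" using assms(1) Suc.prems by (rule eventually_nhds_in_open)
  then have "eventually (\<lambda>y. (deriv ^^ k) f y = g k y) (nhds x)"
    by eventually_elim (rule Suc.IH)
  then have "deriv ((deriv ^^ k) f) x = deriv (g k) x" by (rule deriv_cong_ev) simp
  also have "\<dots> = g (Suc k) x" using assms(3)[OF Suc.prems] by (rule DERIV_imp_deriv)
  finally show ?case by simp
qed (simp add: assms(2))

text \<open>The Taylor series of inverse, logarithm and square root about b are rescalings by 1/b
  of the standard power series about 1.\<close>

lemma efun_rescale:
  assumes "\<And>k. (deriv ^^ k) f (body x) / fact k = c * (1 / body x) ^ k * fps_nth F k"
  shows "efun f x = c *\<^sub>R fps_eval ((1 / body x) *\<^sub>R nilpart x) F"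
  by (rule evg_eqI) (simp add: efun_def assms coef_fps_eval fps_eval_scaleR sum_distrib_left mult_ac)

instantiation evg :: inverse
begin
definition inverse_evg :: "evg \<Rightarrow> evg" where "inverse_evg = efun inverse"
definition divide_evg :: "evg \<Rightarrow> evg \<Rightarrow> evg" where "divide_evg x y = x * inverse y"
instance ..
end

lemma DERIV_inverse_power:
  assumes "(x :: real) \<noteq> 0"
  shows "((\<lambda>x. c * inverse x ^ Suc n) has_real_derivative - c * real (Suc n) * inverse x ^ Suc (Suc n)) (at x)"
  using DERIV_cmult[OF DERIV_power_Suc[OF DERIV_inverse[OF assms], of n], of c]
  by (simp add: algebra_simps)

lemma higher_deriv_inverse:
  assumes "x \<noteq> 0"
  shows "(deriv ^^ k) inverse x = (-1) ^ k * fact k * inverse (x :: real) ^ Suc k"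
proof (rule higher_deriv_eq[where S = "- {0}" and g = "\<lambda>k x. (-1) ^ k * fact k * inverse x ^ Suc k"])
  fix k and x :: real assume "x \<in> - {0}"
  then show "((\<lambda>x. (-1) ^ k * fact k * inverse x ^ Suc k) has_real_derivative
      (-1) ^ Suc k * fact (Suc k) * inverse x ^ Suc (Suc k)) (at x)"
    using DERIV_inverse_power[of x "(-1) ^ k * fact k" k] by (simp add: algebra_simps)
qed (use assms in auto)

lemma evg_split:
  assumes "body x \<noteq> 0"
  shows "x = body x *\<^sub>R fps_eval ((1 / body x) *\<^sub>R nilpart x) (1 + fps_X)"
proof -
  have "body x *\<^sub>R fps_eval ((1 / body x) *\<^sub>R nilpart x) (1 + fps_X) = of_real (body x) + nilpart x"
    using assms by (simp add: fps_eval_add fps_eval_1 fps_eval_X scaleR_add_right of_real_def)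
  then show ?thesis by (simp add: body_plus_nilpart)
qed

lemma evg_inverse_eq:
  assumes "body x \<noteq> 0"
  shows "inverse x = (1 / body x) *\<^sub>R fps_eval ((1 / body x) *\<^sub>R nilpart x) (inverse (1 + fps_X))"
  unfolding inverse_evg_def using assms
  by (intro efun_rescale)
     (simp add: higher_deriv_inverse fps_inverse_fps_X_plus1 inverse_eq_divide del: funpow.simps)

lemma evg_right_inverse:
  fixes x :: evg assumes "body x \<noteq> 0" shows "x * inverse x = 1"
proof -
  let ?n = "(1 / body x) *\<^sub>R nilpart x"
  have "x * inverse x = fps_eval ?n (1 + fps_X) * fps_eval ?n (inverse (1 + fps_X))"
    unfolding evg_inverse_eq[OF assms] using assms by (subst (1) evg_split[OF assms]) simp
  also have "\<dots> = fps_eval ?n ((1 + fps_X) * inverse (1 + fps_X))" by (rule fps_eval_mult[symmetric]) simp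
  also have "(1 + fps_X) * inverse (1 + fps_X) = (1 :: real fps)"
    by (subst mult.commute, rule inverse_mult_eq_1) simp
  finally show ?thesis by (simp add: fps_eval_1)
qed

lemma body_inverse [simp]: "body (inverse x) = inverse (body x)"
  by (simp add: inverse_evg_def)

lemma higher_deriv_sqrt:
  assumes "x > 0"
  shows "(deriv ^^ k) sqrt x = (\<Prod>i<k. 1/2 - real i) * x powr (1/2 - real k)"
proof (rule higher_deriv_eq[where S = "{0<..}" and
      g = "\<lambda>k x. (\<Prod>i<k. 1/2 - real i) * x powr (1/2 - real k)"])
  fix k and x :: real assume "x \<in> {0<..}"
  then show "((\<lambda>x. (\<Prod>i<k. 1/2 - real i) * x powr (1/2 - real k)) has_real_derivative
      (\<Prod>i<Suc k. 1/2 - real i) * x powr (1/2 - real (Suc k))) (at x)"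
    using DERIV_cmult[OF has_real_derivative_powr[of x "1/2 - real k"], of "\<Prod>i<k. 1/2 - real i"]
    by (simp add: algebra_simps)
qed (use assms in \<open>auto simp: powr_half_sqrt\<close>)

lemma efun_sqrt_eq:
  assumes "body x > 0"
  shows "efun sqrt x = sqrt (body x) *\<^sub>R fps_eval ((1 / body x) *\<^sub>R nilpart x) (fps_binomial (1/2))"
proof (rule efun_rescale)
  fix k
  have "body x powr (1/2 - real k) = sqrt (body x) * (1 / body x) ^ k"
    using assms by (simp add: powr_diff powr_half_sqrt powr_realpow power_one_over)
  moreover have "(1/2 gchoose k) = (\<Prod>i<k. 1/2 - real i) / fact k"
    by (simp add: gbinomial_prod_rev atLeast0LessThan)
  ultimately show "(deriv ^^ k) sqrt (body x) / fact k =
      sqrt (body x) * (1 / body x) ^ k * fps_nth (fps_binomial (1/2)) k"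
    using higher_deriv_sqrt[OF assms, of k] by (simp del: funpow.simps)
qed

lemma efun_sqrt_square:
  assumes "body x > 0"
  shows "efun sqrt x * efun sqrt x = x"
proof -
  let ?n = "(1 / body x) *\<^sub>R nilpart x"
  have "efun sqrt x * efun sqrt x =
      body x *\<^sub>R (fps_eval ?n (fps_binomial (1/2)) * fps_eval ?n (fps_binomial (1/2)))"
    using assms by (simp add: efun_sqrt_eq)
  also have "\<dots> = body x *\<^sub>R fps_eval ?n (fps_binomial (1/2 + 1/2))"
    by (simp only: fps_binomial_add_mult, subst fps_eval_mult) auto
  also have "\<dots> = x" using evg_split[of x] assms by (simp add: fps_binomial_1)
  finally show ?thesis .
qed

lemma higher_deriv_ln:
  assumes "x > (0 :: real)"
  shows "(deriv ^^ k) ln x = (if k = 0 then ln x else (-1) ^ (k - 1) * fact (k - 1) * inverse x ^ k)"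
proof (rule higher_deriv_eq[where S = "{0<..}" and
      g = "\<lambda>k x. if k = 0 then ln x else (-1) ^ (k - 1) * fact (k - 1) * inverse x ^ k"])
  fix k and x :: real assume x: "x \<in> {0<..}"
  show "((\<lambda>x. if k = 0 then ln x else (-1) ^ (k - 1) * fact (k - 1) * inverse x ^ k) has_real_derivative
      (if Suc k = 0 then ln x else (-1) ^ (Suc k - 1) * fact (Suc k - 1) * inverse x ^ Suc k)) (at x)"
  proof (cases k)
    case 0
    then show ?thesis using DERIV_ln[of x] x by simp
  next
    case (Suc n)
    then show ?thesis
      using DERIV_inverse_power[of x "(-1) ^ n * fact n" n] x by (simp add: algebra_simps)
  qed
qed (use assms in auto)

lemma efun_ln_eq:
  assumes "body x > 0"
  shows "efun ln x = of_real (ln (body x)) + fps_eval ((1 / body x) *\<^sub>R nilpart x) (fps_ln 1)"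
proof (rule evg_eqI)
  fix L :: "nat set" assume L: "finite L"
  have "(deriv ^^ k) ln (body x) / fact k * c =
      (if k = 0 then ln (body x) * c else 0) + fps_nth (fps_ln 1) k * ((1 / body x) ^ k * c)" for k c
  proof (cases k)
    case (Suc n)
    then show ?thesis
      by (simp add: higher_deriv_ln assms fps_ln_nth divide_simps del: funpow.simps of_nat_Suc)
  qed simp
  then show "coef (efun ln x) L = coef (of_real (ln (body x)) + fps_eval ((1 / body x) *\<^sub>R nilpart x) (fps_ln 1)) L"
    using L by (simp add: efun_def coef_fps_eval evg_power_scaleR sum.distrib coef_of_real coef_one)
qed

lemma higher_deriv_exp_sinh_cosh:
  "(deriv ^^ k) exp x = exp (x :: real)"
  "(deriv ^^ k) sinh x = (exp x - (-1) ^ k * exp (- x)) / (2 :: real)"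
  "(deriv ^^ k) cosh x = (exp x + (-1) ^ k * exp (- x)) / (2 :: real)"
proof -
  show "(deriv ^^ k) exp x = exp (x :: real)"
    by (rule higher_deriv_eq[where S = UNIV and g = "\<lambda>k. exp"]) (auto intro!: derivative_eq_intros)
  show "(deriv ^^ k) sinh x = (exp x - (-1) ^ k * exp (- x)) / (2 :: real)"
    by (rule higher_deriv_eq[where S = UNIV and g = "\<lambda>k x. (exp x - (-1) ^ k * exp (- x)) / 2"])
       (auto intro!: derivative_eq_intros simp: sinh_field_def)
  show "(deriv ^^ k) cosh x = (exp x + (-1) ^ k * exp (- x)) / (2 :: real)"
    by (rule higher_deriv_eq[where S = UNIV and g = "\<lambda>k x. (exp x + (-1) ^ k * exp (- x)) / 2"])
       (auto intro!: derivative_eq_intros simp: cosh_field_def)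
qed

lemma efun_exp_eq: "efun exp y = exp (body y) *\<^sub>R fps_eval (nilpart y) (fps_exp 1)"
  by (rule evg_eqI) (simp add: efun_def coef_fps_eval higher_deriv_exp_sinh_cosh sum_distrib_left mult_ac)

lemma efun_sinh_cosh_eq:
  "efun sinh y = (1/2) *\<^sub>R (exp (body y) *\<^sub>R fps_eval (nilpart y) (fps_exp 1) - exp (- body y) *\<^sub>R fps_eval (nilpart y) (fps_exp (-1)))"
  "efun cosh y = (1/2) *\<^sub>R (exp (body y) *\<^sub>R fps_eval (nilpart y) (fps_exp 1) + exp (- body y) *\<^sub>R fps_eval (nilpart y) (fps_exp (-1)))"
  by (rule evg_eqI; simp only: efun_def coef_fps_eval coef_simps higher_deriv_exp_sinh_cosh
      sum_distrib_left sum_subtractf[symmetric] sum.distrib[symmetric]; rule sum.cong;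
      simp add: field_simps)+

lemma evg_inverse_unique:
  fixes x :: evg assumes "x * y = 1" shows "inverse x = y"
proof -
  have "body x * body y = 1" using assms by (metis body_simps(6,7))
  then have "x * inverse x = 1" by (intro evg_right_inverse) auto
  then show ?thesis using assms by (metis mult.commute mult.left_commute mult_1_right)
qed

text \<open>The super length is 2 y with y = ln r, so these three equations remove all
  transcendental functions from the summand. Writing y = ln b + m with m nilpotent reduces them to
  exp(ln(1 + X)) = 1 + X and exp(X) exp(-X) = 1 for formal power series.\<close>

lemma evg_exp_log:
  assumes r: "body r > 0"
  defines "y \<equiv> efun ln r"
  shows "efun exp (2 *\<^sub>R y) = r * r"
    and "efun sinh y = (1/2) *\<^sub>R (r - inverse r)"
    and "efun cosh y = (1/2) *\<^sub>R (r + inverse r)"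
proof -
  define b where "b = body r"
  define n where "n = (1 / b) *\<^sub>R nilpart r"
  define m where "m = fps_eval n (fps_ln 1)"
  have b: "b > 0" using r by (simp add: b_def)
  have [simp]: "body n = 0" "body m = 0" by (simp_all add: n_def m_def)
  have y: "y = of_real (ln b) + m"
    using efun_ln_eq[OF r] by (simp add: y_def m_def n_def b_def)
  have yb: "body y = ln b" and ny: "nilpart y = m" by (simp_all add: y nilpart_def)
  have "fps_eval m (fps_exp 1) = fps_eval n (fps_exp 1 oo fps_ln 1)"
    unfolding m_def by (rule fps_eval_compose[symmetric]) auto
  also have "fps_exp 1 oo fps_ln 1 = (1 + fps_X :: real fps)"
  proof -
    have "(fps_exp 1 - 1) oo fps_inv (fps_exp 1 - 1 :: real fps) = fps_X"
      by (rule fps_inv_right) auto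
    then show ?thesis
      by (simp add: fps_ln_fps_exp_inv fps_compose_sub_distrib algebra_simps)
  qed
  finally have e1: "fps_eval m (fps_exp 1) = fps_eval n (1 + fps_X)" .
  have br: "b *\<^sub>R fps_eval m (fps_exp 1) = r"
    unfolding e1 n_def b_def using evg_split[of r] r by simp
  have "fps_eval m (fps_exp 1) * fps_eval m (fps_exp (- 1)) = fps_eval m (fps_exp 1 * fps_exp (- 1))"
    by (rule fps_eval_mult[symmetric]) simp
  also have "fps_exp 1 * fps_exp (- 1) = (1 :: real fps)"
    by (simp flip: fps_exp_add_mult)
  finally have m1: "fps_eval m (fps_exp 1) * fps_eval m (fps_exp (- 1)) = 1" by (simp add: fps_eval_1)
  have bi: "(1 / b) *\<^sub>R fps_eval m (fps_exp (- 1)) = inverse r"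
    by (rule evg_inverse_unique[symmetric]) (use b m1 in \<open>simp flip: br\<close>)
  \<comment> \<open>Doubling the argument of the exponential series squares it.\<close>
  have "Abs_fps (\<lambda>k. 2 ^ k * fps_nth (fps_exp 1) k) = (fps_exp 1 * fps_exp 1 :: real fps)"
    by (simp add: fps_eq_iff flip: fps_exp_add_mult)
  then have "fps_eval (2 *\<^sub>R m) (fps_exp 1) = fps_eval m (fps_exp 1 * fps_exp 1)"
    by (simp only: fps_eval_scaleR)
  also have "\<dots> = fps_eval m (fps_exp 1) * fps_eval m (fps_exp 1)" by (rule fps_eval_mult) simp
  finally have "fps_eval (2 *\<^sub>R m) (fps_exp 1) = fps_eval m (fps_exp 1) * fps_eval m (fps_exp 1)" .
  moreover have "nilpart (2 *\<^sub>R y) = 2 *\<^sub>R m" using yb ny by (simp add: nilpart_def y scaleR_add_right of_real_def)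
  moreover have "exp (2 * ln b) = b * b" using b by (simp add: exp_double exp_ln power2_eq_square)
  ultimately show "efun exp (2 *\<^sub>R y) = r * r"
    by (simp add: efun_exp_eq yb flip: br)
  show "efun sinh y = (1/2) *\<^sub>R (r - inverse r)" "efun cosh y = (1/2) *\<^sub>R (r + inverse r)"
    unfolding bi[symmetric] efun_sinh_cosh_eq yb ny
    using b br by (simp_all add: exp_minus inverse_eq_divide)
qed

section \<open>Polynomially bounded families\<close>

definition nrm :: "nat \<Rightarrow> evg \<Rightarrow> real" where
  "nrm N x = (\<Sum>L\<in>Pow {1..N}. \<bar>coef x L\<bar>)"

lemma nrm_nonneg [simp]: "0 \<le> nrm N x"
  by (simp add: nrm_def sum_nonneg)

lemma nrm_0 [simp]: "nrm N 0 = 0"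
  by (simp add: nrm_def)

lemma nrm_scaleR [simp]: "nrm N (c *\<^sub>R x) = \<bar>c\<bar> * nrm N x"
  by (simp add: nrm_def abs_mult sum_distrib_left)

lemma nrm_of_real [simp]: "nrm N (of_real c) = \<bar>c\<bar>"
proof -
  have "nrm N (of_real c) = (\<Sum>L\<in>{{}}. \<bar>coef (of_real c) L\<bar>)"
    unfolding nrm_def by (rule sum.mono_neutral_right) (auto simp: coef_of_real)
  then show ?thesis by (simp add: coef_of_real)
qed

lemma nrm_1 [simp]: "nrm N 1 = 1"
  using nrm_of_real[of N 1] by simp

lemma nrm_add: "nrm N (x + y) \<le> nrm N x + nrm N y"
  unfolding nrm_def coef_simps sum.distrib[symmetric] by (intro sum_mono abs_triangle_ineq)

lemma nrm_minus [simp]: "nrm N (- x) = nrm N x"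
  by (simp add: nrm_def)

lemma nrm_sum: "nrm N (sum F A) \<le> (\<Sum>i\<in>A. nrm N (F i))"
proof (induction A rule: infinite_finite_induct)
  case (insert i A)
  then show ?case using nrm_add[of N "F i" "sum F A"] by simp
qed auto

lemma abs_coef_le_nrm: "L \<subseteq> {1..N} \<Longrightarrow> \<bar>coef x L\<bar> \<le> nrm N x"
  unfolding nrm_def by (rule member_le_sum) auto

text \<open>Signs have absolute value 1, and the pairs (A, L - A) are distinct members of all pairs
  of index sets.\<close>

lemma nrm_mult: "nrm N (x * y) \<le> nrm N x * nrm N y"
proof -
  let ?P = "Pow {1..N}"
  have fin: "finite L" if "L \<in> ?P" for L using that finite_subset by auto
  have "nrm N (x * y) \<le> (\<Sum>L\<in>?P. \<Sum>A\<in>Pow L. \<bar>coef x A\<bar> * \<bar>coef y (L - A)\<bar>)"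
    unfolding nrm_def
  proof (rule sum_mono)
    fix L assume "L \<in> ?P"
    then show "\<bar>coef (x * y) L\<bar> \<le> (\<Sum>A\<in>Pow L. \<bar>coef x A\<bar> * \<bar>coef y (L - A)\<bar>)"
      using fin by (auto simp: coef_mult abs_mult intro!: order_trans[OF sum_abs] sum_mono)
  qed
  also have "\<dots> = (\<Sum>(L, A)\<in>Sigma ?P Pow. \<bar>coef x A\<bar> * \<bar>coef y (L - A)\<bar>)"
    by (rule sum.Sigma) (use fin in auto)
  also have "\<dots> = (\<Sum>(A, B)\<in>(\<lambda>(L, A). (A, L - A)) ` Sigma ?P Pow. \<bar>coef x A\<bar> * \<bar>coef y B\<bar>)"
  proof (subst sum.reindex)
    show "inj_on (\<lambda>(L, A). (A, L - A)) (Sigma ?P Pow)"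
      by (rule inj_on_inverseI[where g = "\<lambda>(A, B). (A \<union> B, A)"]) auto
  qed (auto simp: case_prod_unfold intro!: sum.cong)
  also have "\<dots> \<le> (\<Sum>(A, B)\<in>?P \<times> ?P. \<bar>coef x A\<bar> * \<bar>coef y B\<bar>)"
    by (rule sum_mono2) auto
  also have "\<dots> = nrm N x * nrm N y"
    by (simp add: nrm_def sum_product sum.cartesian_product)
  finally show ?thesis .
qed

lemma nrm_power: "nrm N (x ^ k) \<le> nrm N x ^ k"
proof (induction k)
  case (Suc k)
  then show ?case using nrm_mult[of N x "x ^ k"] mult_left_mono[OF Suc, of "nrm N x"] by simp
qed simp

lemma nrm_nilpart: "nrm N (nilpart x) \<le> nrm N x"
  unfolding nrm_def nilpart_def
  by (intro sum_mono) (auto simp: coef_of_real body_def)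

lemma nrm_fps_eval:
  assumes "body x = 0"
  shows "nrm N (fps_eval x F) \<le> (\<Sum>k\<le>N. \<bar>fps_nth F k\<bar> * nrm N x ^ k)"
proof -
  have "nrm N (fps_eval x F) = nrm N (\<Sum>k\<le>N. fps_nth F k *\<^sub>R x ^ k)"
    unfolding nrm_def
  proof (rule sum.cong[OF refl])
    fix L assume "L \<in> Pow {1..N}"
    then have "finite L" "card L \<le> N"
      using finite_subset card_mono[of "{1..N}" L] by auto
    then show "\<bar>coef (fps_eval x F) L\<bar> = \<bar>coef (\<Sum>k\<le>N. fps_nth F k *\<^sub>R x ^ k) L\<bar>"
      using fps_eval_as_sum[OF assms] by metis
  qed
  also have "\<dots> \<le> (\<Sum>k\<le>N. nrm N (fps_nth F k *\<^sub>R x ^ k))" by (rule nrm_sum)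
  also have "\<dots> \<le> (\<Sum>k\<le>N. \<bar>fps_nth F k\<bar> * nrm N x ^ k)"
    by (intro sum_mono) (simp add: mult_left_mono nrm_power)
  finally show ?thesis .
qed

section \<open>A calculus of polynomial bounds\<close>

locale growth =
  fixes N :: nat and S :: "'i set" and g :: "'i \<Rightarrow> real"
  assumes g1: "\<And>i. i \<in> S \<Longrightarrow> 1 \<le> g i"
begin

text \<open>Degree and constant are left existential: exponential decay will beat any polynomial.
  Closure under ring operations then replaces explicit estimates. The index set is abstract since
  the notion is used both for vertices and for edges of the tree.\<close>

definition tame :: "('i \<Rightarrow> evg) \<Rightarrow> bool" where
  "tame F \<longleftrightarrow> (\<exists>K j. 0 \<le> K \<and> (\<forall>i\<in>S. nrm N (F i) \<le> K * g i ^ j))"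

lemma tameI: "0 \<le> K \<Longrightarrow> (\<And>i. i \<in> S \<Longrightarrow> nrm N (F i) \<le> K * g i ^ j) \<Longrightarrow> tame F"
  unfolding tame_def by blast

lemma tame_bounded: "(\<And>i. i \<in> S \<Longrightarrow> nrm N (F i) \<le> K) \<Longrightarrow> tame F"
  by (rule tameI[of "\<bar>K\<bar>" _ 0]) fastforce+

lemma tame_mono:
  assumes "tame F" "0 \<le> C" "\<And>i. i \<in> S \<Longrightarrow> nrm N (G i) \<le> C * nrm N (F i)"
  shows "tame G"
proof -
  obtain K j where K: "0 \<le> K" "\<And>i. i \<in> S \<Longrightarrow> nrm N (F i) \<le> K * g i ^ j"
    using assms(1) unfolding tame_def by blast
  show ?thesis
  proof (rule tameI[of "C * K" _ j])
    fix i assume i: "i \<in> S"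
    show "nrm N (G i) \<le> C * K * g i ^ j"
      using assms(3)[OF i] mult_left_mono[OF K(2)[OF i] assms(2)] by (simp add: mult.assoc)
  qed (use assms K in simp)
qed

lemma tame_cong: "tame F \<Longrightarrow> (\<And>i. i \<in> S \<Longrightarrow> G i = F i) \<Longrightarrow> tame G"
  by (rule tame_mono[of F 1]) auto

lemma tame_add:
  assumes "tame F" "tame G"
  shows "tame (\<lambda>i. F i + G i)"
proof -
  obtain K j where K: "0 \<le> K" "\<And>i. i \<in> S \<Longrightarrow> nrm N (F i) \<le> K * g i ^ j"
    using assms(1) unfolding tame_def by blast
  obtain M l where M: "0 \<le> M" "\<And>i. i \<in> S \<Longrightarrow> nrm N (G i) \<le> M * g i ^ l"
    using assms(2) unfolding tame_def by blast
  show ?thesis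
  proof (rule tameI[of "K + M" _ "j + l"])
    fix i assume i: "i \<in> S"
    have "g i ^ j \<le> g i ^ (j + l)" "g i ^ l \<le> g i ^ (j + l)"
      by (intro power_increasing g1 i; simp)+
    then have "K * g i ^ j + M * g i ^ l \<le> (K + M) * g i ^ (j + l)"
      using K(1) M(1) by (simp add: distrib_right add_mono mult_left_mono)
    then show "nrm N (F i + G i) \<le> (K + M) * g i ^ (j + l)"
      using nrm_add[of N "F i" "G i"] K(2)[OF i] M(2)[OF i] by linarith
  qed (use K M in simp)
qed

lemma tame_mult:
  assumes "tame F" "tame G"
  shows "tame (\<lambda>i. F i * G i)"
proof -
  obtain K j where K: "0 \<le> K" "\<And>i. i \<in> S \<Longrightarrow> nrm N (F i) \<le> K * g i ^ j"
    using assms(1) unfolding tame_def by blast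
  obtain M l where M: "0 \<le> M" "\<And>i. i \<in> S \<Longrightarrow> nrm N (G i) \<le> M * g i ^ l"
    using assms(2) unfolding tame_def by blast
  show ?thesis
  proof (rule tameI[of "K * M" _ "j + l"])
    fix i assume i: "i \<in> S"
    have "nrm N (F i) * nrm N (G i) \<le> (K * g i ^ j) * (M * g i ^ l)"
      by (intro mult_mono K M i) (use K g1[OF i] in auto)
    then show "nrm N (F i * G i) \<le> K * M * g i ^ (j + l)"
      using nrm_mult[of N "F i" "G i"] by (simp add: power_add mult_ac)
  qed (use K M in simp)
qed

lemma tame_minus: "tame F \<Longrightarrow> tame (\<lambda>i. - F i)"
  by (rule tame_mono[of F 1]) auto

lemma tame_diff: "tame F \<Longrightarrow> tame G \<Longrightarrow> tame (\<lambda>i. F i - G i)"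
  using tame_add[OF _ tame_minus, of F G] by simp

lemma tame_const: "tame (\<lambda>i. c)"
  by (rule tame_bounded) auto

lemma tame_scale:
  assumes "tame F" "\<And>i. i \<in> S \<Longrightarrow> \<bar>c i\<bar> \<le> C"
  shows "tame (\<lambda>i. c i *\<^sub>R F i)"
proof (rule tame_mono[OF assms(1), of "\<bar>C\<bar>"])
  fix i assume "i \<in> S"
  then show "nrm N (c i *\<^sub>R F i) \<le> \<bar>C\<bar> * nrm N (F i)"
    using assms(2) by (fastforce intro: mult_right_mono)
qed simp

lemma tame_nilpart: "tame F \<Longrightarrow> tame (\<lambda>i. nilpart (F i))"
  by (rule tame_mono[of F 1]) (auto simp: nrm_nilpart)

lemma tame_sum: "(\<And>k. k \<in> A \<Longrightarrow> tame (F k)) \<Longrightarrow> tame (\<lambda>i. \<Sum>k\<in>A. F k i)"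
  by (induction A rule: infinite_finite_induct) (auto intro: tame_const tame_add)

text \<open>On index sets inside {1..N} the series is a polynomial of degree at most N in a
  nilpotent argument, so a polynomial bound survives whatever the coefficients of the series
  are.\<close>

lemma tame_fps_eval:
  assumes "tame F" "\<And>i. i \<in> S \<Longrightarrow> body (F i) = 0"
  shows "tame (\<lambda>i. fps_eval (F i) G)"
proof -
  \<comment> \<open>The real upper bound is regarded as a multiple of 1, so that
    \<open>tame_sum\<close> applies to it.\<close>
  have t: "tame (\<lambda>i. \<Sum>k\<le>N. (\<bar>fps_nth G k\<bar> * nrm N (F i) ^ k) *\<^sub>R 1)"
  proof (rule tame_sum)
    fix k
    obtain K j where K: "0 \<le> K" "\<And>i. i \<in> S \<Longrightarrow> nrm N (F i) \<le> K * g i ^ j"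
      using assms(1) unfolding tame_def by blast
    show "tame (\<lambda>i. (\<bar>fps_nth G k\<bar> * nrm N (F i) ^ k) *\<^sub>R 1)"
    proof (rule tameI[of "\<bar>fps_nth G k\<bar> * K ^ k" _ "j * k"])
      fix i assume i: "i \<in> S"
      have "nrm N (F i) ^ k \<le> (K * g i ^ j) ^ k" by (intro power_mono K i) simp
      then show "nrm N ((\<bar>fps_nth G k\<bar> * nrm N (F i) ^ k) *\<^sub>R 1) \<le> \<bar>fps_nth G k\<bar> * K ^ k * g i ^ (j * k)"
        by (simp add: abs_mult power_mult_distrib power_mult mult.assoc mult_left_mono)
    qed (use K in simp)
  qed
  have "nrm N (\<Sum>k\<le>N. (\<bar>fps_nth G k\<bar> * nrm N (F i) ^ k) *\<^sub>R 1) = (\<Sum>k\<le>N. \<bar>fps_nth G k\<bar> * nrm N (F i) ^ k)" for i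
    unfolding scaleR_left.sum[symmetric] by (simp add: sum_nonneg)
  then show ?thesis
    by (intro tame_mono[OF t, of 1]) (use nrm_fps_eval assms(2) in auto)
qed

text \<open>The form in which inverse and square root were expanded; the lower bound c keeps the
  rescaling factor 1 / body bounded.\<close>

lemma tame_rescaled_fps_eval:
  assumes "tame F" "0 < c" "\<And>i. i \<in> S \<Longrightarrow> c \<le> body (F i)"
  shows "tame (\<lambda>i. fps_eval ((1 / body (F i)) *\<^sub>R nilpart (F i)) G)"
proof (rule tame_fps_eval, rule tame_scale[OF tame_nilpart[OF assms(1)], where C = "1 / c"])
  fix i assume "i \<in> S"
  then have "c \<le> body (F i)" by (rule assms(3))
  then show "\<bar>1 / body (F i)\<bar> \<le> 1 / c" using assms(2) by (simp add: frac_le)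
qed auto

lemma tame_inverse:
  assumes "tame F" "0 < c" "\<And>i. i \<in> S \<Longrightarrow> c \<le> body (F i)"
  shows "tame (\<lambda>i. inverse (F i))"
proof (rule tame_cong)
  show "tame (\<lambda>i. (1 / body (F i)) *\<^sub>R fps_eval ((1 / body (F i)) *\<^sub>R nilpart (F i)) (inverse (1 + fps_X)))"
  proof (rule tame_scale[OF tame_rescaled_fps_eval[OF assms], where C = "1 / c"])
    fix i assume "i \<in> S"
    then have "c \<le> body (F i)" by (rule assms(3))
    then show "\<bar>1 / body (F i)\<bar> \<le> 1 / c" using assms(2) by (simp add: frac_le)
  qed
  fix i assume "i \<in> S"
  then have "body (F i) \<noteq> 0" using assms(2,3) by fastforce
  then show "inverse (F i) = (1 / body (F i)) *\<^sub>R fps_eval ((1 / body (F i)) *\<^sub>R nilpart (F i)) (inverse (1 + fps_X))"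
    by (rule evg_inverse_eq)
qed

end

text \<open>Part of the binomial expansion. The factor is n rather than n + 1 because for n = 1 the
  two mixed terms coincide. What matters is that it grows with n and can absorb any fixed multiple
  of the mixed terms.\<close>

lemma pow_superadd:
  fixes a b :: real assumes "1 \<le> a" "1 \<le> b" "1 \<le> n"
  shows "a ^ Suc n + b ^ Suc n + real n * (a * b ^ n + b * a ^ n) \<le> (a + b) ^ Suc n"
  using assms(3)
proof (induction n rule: dec_induct)
  case (step n)
  have "(a + b) * (a ^ Suc n + b ^ Suc n + real n * (a * b ^ n + b * a ^ n)) \<le> (a + b) * (a + b) ^ Suc n"
    using step assms by (intro mult_left_mono) auto
  moreover have "(a + b) * (a ^ Suc n + b ^ Suc n + real n * (a * b ^ n + b * a ^ n)) =
      a ^ Suc (Suc n) + b ^ Suc (Suc n) + real (Suc n) * (a * b ^ Suc n + b * a ^ Suc n)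
      + real n * (a * a * b ^ n + b * b * a ^ n)"
    by (simp add: algebra_simps)
  moreover have "0 \<le> real n * (a * a * b ^ n + b * b * a ^ n)" using assms by simp
  ultimately show ?case by simp
qed (simp add: algebra_simps power2_eq_square)

lemma pow_superadd_weak:
  fixes a b :: real assumes "1 \<le> a" "1 \<le> b" "2 \<le> n"
  shows "a * b ^ n + b * a ^ n \<le> a * (a + b) ^ n"
proof -
  obtain m where n: "n = Suc m" and m: "1 \<le> m" using assms(3) by (cases n) auto
  have "a * (a ^ Suc m + b ^ Suc m + real m * (a * b ^ m + b * a ^ m)) \<le> a * (a + b) ^ Suc m"
    using pow_superadd[OF assms(1,2) m] assms by (intro mult_left_mono) auto
  moreover have "b * a ^ Suc m \<le> a * (real m * (b * a ^ m))"
    using m assms mult_right_mono[of 1 "real m" "a * (b * a ^ m)"] by (simp add: mult_ac)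
  moreover have "0 \<le> a * a ^ Suc m" "0 \<le> a * (real m * (a * b ^ m))" using assms by auto
  ultimately show ?thesis unfolding n by (simp add: algebra_simps)
qed

section \<open>The Farey tree\<close>

text \<open>An edge is a pair of Farey neighbours, and s + t is the new vertex (mediant) below it.
  The root is a parameter because the analytic estimates hold only below suitable edges.\<close>

inductive farey_desc :: "int \<times> int \<Rightarrow> int \<times> int \<Rightarrow> int \<times> int \<Rightarrow> int \<times> int \<Rightarrow> bool" for s0 t0 where
  base: "farey_desc s0 t0 s0 t0"
| left: "farey_desc s0 t0 s t \<Longrightarrow> farey_desc s0 t0 s (s + t)"
| right: "farey_desc s0 t0 s t \<Longrightarrow> farey_desc s0 t0 (s + t) t"

abbreviation farey_edge :: "int \<times> int \<Rightarrow> int \<times> int \<Rightarrow> bool" where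
  "farey_edge \<equiv> farey_desc (1, 0) (0, 1)"

lemma farey_desc_trans: "farey_desc s1 t1 s t \<Longrightarrow> farey_desc s0 t0 s1 t1 \<Longrightarrow> farey_desc s0 t0 s t"
  by (induction rule: farey_desc.induct) (auto intro: farey_desc.intros)

section \<open>Heights and cones of primitive vectors\<close>

definition height :: "int \<times> int \<Rightarrow> real" where
  "height v = real_of_int (fst v + snd v)"

lemma height_add [simp]: "height (s + t) = height s + height t"
  by (simp add: height_def)

lemma farey_edge_coords:
  assumes "farey_edge s t"
  shows "det2 s t = 1" "0 < fst s" "0 \<le> snd s" "0 \<le> fst t" "0 < snd t"
proof -
  have "det2 s t = 1 \<and> 0 < fst s \<and> 0 \<le> snd s \<and> 0 \<le> fst t \<and> 0 < snd t"
    using assms by induction (auto simp: det2_def algebra_simps)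
  then show "det2 s t = 1" "0 < fst s" "0 \<le> snd s" "0 \<le> fst t" "0 < snd t" by auto
qed

lemma farey_edge_height: "farey_edge s t \<Longrightarrow> 1 \<le> height s" "farey_edge s t \<Longrightarrow> 1 \<le> height t"
  using farey_edge_coords[of s t] by (auto simp: height_def)

definition comb :: "int \<times> int \<Rightarrow> int \<times> int \<Rightarrow> int \<times> int \<Rightarrow> int \<times> int" where
  "comb s t mn = (fst mn * fst s + snd mn * fst t, fst mn * snd s + snd mn * snd t)"

definition pospairs :: "(int \<times> int) set" where
  "pospairs = {(m, n). 1 \<le> m \<and> 1 \<le> n \<and> coprime m n}"

text \<open>For det (s, t) = 1 these are the primitive vectors in the open cone spanned by s and t,
  that is, the slopes strictly between them.\<close>

definition farey_cone :: "int \<times> int \<Rightarrow> int \<times> int \<Rightarrow> (int \<times> int) set" where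
  "farey_cone s t = comb s t ` pospairs"

lemma comb_inj: "det2 s t = 1 \<Longrightarrow> inj (comb s t)"
proof (rule injI)
  fix a b assume d: "det2 s t = 1" and e: "comb s t a = comb s t b"
  \<comment> \<open>Cramer's rule recovers the coordinates with respect to the basis s, t.\<close>
  have *: "snd t * fst (comb s t c) - fst t * snd (comb s t c) = fst c * det2 s t"
    "fst s * snd (comb s t c) - snd s * fst (comb s t c) = snd c * det2 s t" for c
    by (simp_all add: comb_def det2_def algebra_simps)
  show "a = b" using *[of a] *[of b] d e by (simp add: prod_eq_iff)
qed

lemma comb_left: "comb s (s + t) (m, n) = comb s t (m + n, n)"
  and comb_right: "comb (s + t) t (m, n) = comb s t (m, m + n)"
  by (simp_all add: comb_def algebra_simps)

text \<open>One step of the subtractive Euclidean algorithm: subtract the smaller entry from the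
  larger until both are 1.\<close>

lemma pospairs_split:
  "pospairs = insert (1, 1) ((\<lambda>(m, n). (m + n, n)) ` pospairs \<union> (\<lambda>(m, n). (m, m + n)) ` pospairs)"
    (is "_ = insert _ (?L \<union> ?R)")
proof
  show "pospairs \<subseteq> insert (1, 1) (?L \<union> ?R)"
  proof
    fix v assume v: "v \<in> pospairs"
    obtain m n where mn: "v = (m, n)" by fastforce
    have c: "1 \<le> m" "1 \<le> n" "coprime m n" using v mn by (auto simp: pospairs_def)
    consider "m = n" | "n < m" | "m < n" by linarith
    then show "v \<in> insert (1, 1) (?L \<union> ?R)"
    proof cases
      case 1
      then show ?thesis using c mn by auto
    next
      case 2
      have "coprime (m - n) n" using c(3) by (simp add: coprime_iff_gcd_eq_1 gcd_diff1)
      then have "(m - n, n) \<in> pospairs" using 2 c by (simp add: pospairs_def)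
      then have "v \<in> ?L" unfolding mn by (rule rev_image_eqI) simp
      then show ?thesis by blast
    next
      case 3
      have "coprime m (n - m)" using c(3) by (metis coprime_commute coprime_iff_gcd_eq_1 gcd_diff1)
      then have "(m, n - m) \<in> pospairs" using 3 c by (simp add: pospairs_def)
      then have "v \<in> ?R" unfolding mn by (rule rev_image_eqI) simp
      then show ?thesis by blast
    qed
  qed
  show "insert (1, 1) (?L \<union> ?R) \<subseteq> pospairs"
    by (auto simp: pospairs_def coprime_iff_gcd_eq_1)
qed

lemma farey_cone_left: "farey_cone s (s + t) = comb s t ` (\<lambda>(m, n). (m + n, n)) ` pospairs"
  and farey_cone_right: "farey_cone (s + t) t = comb s t ` (\<lambda>(m, n). (m, m + n)) ` pospairs"
  unfolding farey_cone_def image_image by (simp_all add: case_prod_unfold flip: comb_left comb_right)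

lemma farey_cone_split: "farey_cone s t = insert (s + t) (farey_cone s (s + t) \<union> farey_cone (s + t) t)"
proof -
  have "comb s t (1, 1) = s + t" by (simp add: comb_def prod_eq_iff)
  moreover have "farey_cone s t = comb s t ` pospairs" by (rule farey_cone_def)
  ultimately show ?thesis
    using arg_cong[OF pospairs_split, of "image (comb s t)"]
    by (simp only: farey_cone_left farey_cone_right image_insert image_Un)
qed

lemma farey_cone_disjoint:
  assumes "det2 s t = 1"
  shows "s + t \<notin> farey_cone s (s + t) \<union> farey_cone (s + t) t" "farey_cone s (s + t) \<inter> farey_cone (s + t) t = {}"
proof -
  have e: "s + t = comb s t (1, 1)" by (simp add: comb_def prod_eq_iff)
  show "s + t \<notin> farey_cone s (s + t) \<union> farey_cone (s + t) t"
    unfolding farey_cone_left farey_cone_right image_Un[symmetric]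
    by (subst e, subst inj_image_mem_iff[OF comb_inj[OF assms]]) (auto simp: pospairs_def)
  show "farey_cone s (s + t) \<inter> farey_cone (s + t) t = {}"
    unfolding farey_cone_left farey_cone_right image_Int[OF comb_inj[OF assms], symmetric]
    by (auto simp: pospairs_def)
qed

text \<open>Running the Euclidean algorithm on the coordinates of c gives the path in the tree that
  ends at c. Bounds known only for new vertices of edges thereby apply to every element of a
  cone.\<close>

lemma farey_cone_farey_desc:
  assumes "c \<in> farey_cone s t"
  shows "\<exists>s' t'. farey_desc s t s' t' \<and> c = s' + t'"
proof -
  have "\<exists>s' t'. farey_desc s t s' t' \<and> comb s t (m, n) = s' + t'" if "(m, n) \<in> pospairs" for m n
    using that
  proof (induction "nat (m + n)" arbitrary: m n s t rule: less_induct)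
    case less
    from less.prems have "(m, n) = (1, 1) \<or> (m, n) \<in> (\<lambda>(m, n). (m + n, n)) ` pospairs
        \<or> (m, n) \<in> (\<lambda>(m, n). (m, m + n)) ` pospairs"
      by (subst (asm) pospairs_split) auto
    then consider "(m, n) = (1, 1)" | m' where "m = m' + n" "(m', n) \<in> pospairs"
      | n' where "n = m + n'" "(m, n') \<in> pospairs" by auto
    then show ?case
    proof cases
      case 1
      then show ?thesis
        by (intro exI[of _ s] exI[of _ t]) (auto simp: comb_def prod_eq_iff intro: farey_desc.base)
    next
      case 2
      then have "1 \<le> m'" "1 \<le> n" by (auto simp: pospairs_def)
      then obtain s' t' where "farey_desc s (s + t) s' t'" "comb s (s + t) (m', n) = s' + t'"
        using less.hyps[of m' n s "s + t"] 2 by auto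
      then show ?thesis using 2 farey_desc_trans farey_desc.left farey_desc.base comb_left by metis
    next
      case 3
      then have "1 \<le> n'" "1 \<le> m" by (auto simp: pospairs_def)
      then obtain s' t' where "farey_desc (s + t) t s' t'" "comb (s + t) t (m, n') = s' + t'"
        using less.hyps[of m n' "s + t" t] 3 by auto
      then show ?thesis using 3 farey_desc_trans farey_desc.right farey_desc.base comb_right by metis
    qed
  qed
  then show ?thesis using assms by (auto simp: farey_cone_def)
qed

lemma farey_cone_height:
  assumes "farey_edge s t" "c \<in> farey_cone s t"
  shows "height (s + t) \<le> height c"
proof -
  obtain m n where c: "c = comb s t (m, n)" and mn: "1 \<le> m" "1 \<le> n"
    using assms(2) by (auto simp: farey_cone_def pospairs_def)
  have "height c = m * height s + n * height t"
    by (simp add: c comb_def height_def algebra_simps)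
  moreover have "1 * height s \<le> m * height s" "1 * height t \<le> n * height t"
    using mn farey_edge_height[OF assms(1)] by (intro mult_right_mono; simp)+
  ultimately show ?thesis by simp
qed

lemma farey_cone_pos:
  assumes "farey_edge s t" shows "farey_cone s t \<subseteq> {1..} \<times> {1..}"
proof
  fix c assume "c \<in> farey_cone s t"
  then obtain m n where c: "c = comb s t (m, n)" and mn: "1 \<le> m" "1 \<le> n"
    by (auto simp: farey_cone_def pospairs_def)
  have "1 * 1 \<le> m * fst s" "0 \<le> n * fst t" "0 \<le> m * snd s" "1 * 1 \<le> n * snd t"
    using mn farey_edge_coords[OF assms] by (intro mult_mono mult_nonneg_nonneg; simp)+
  then show "c \<in> {1..} \<times> {1..}" by (simp add: c comb_def)
qed

section \<open>Summation over the Farey tree\<close>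

lemma exp_height_summable:
  assumes "0 < k"
  shows "(\<lambda>v. exp (- k * height v)) summable_on ({1..} \<times> {1..})"
proof (rule nonneg_bdd_above_summable_on)
  define r where "r = exp (- k)"
  have r: "0 \<le> r" "r < 1" using assms by (simp_all add: r_def)
  have ex: "exp (- k * height v) = r ^ nat (fst v) * r ^ nat (snd v)" if "v \<in> {1..} \<times> {1..}" for v
    using that by (auto simp: r_def height_def algebra_simps simp flip: exp_of_nat_mult exp_add)
  show "bdd_above (sum (\<lambda>v. exp (- k * height v)) ` {F. F \<subseteq> {1..} \<times> {1..} \<and> finite F})"
  proof (rule bdd_aboveI2)
    fix F :: "(int \<times> int) set" assume F: "F \<in> {F. F \<subseteq> {1..} \<times> {1..} \<and> finite F}"
    define M where "M = (\<lambda>v. (nat (fst v), nat (snd v))) ` F"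
    define n where "n = Suc (Max (insert 0 (fst ` M \<union> snd ` M)))"
    have finM: "finite M" using F by (simp add: M_def)
    have sub: "M \<subseteq> {..<n} \<times> {..<n}"
    proof
      fix v assume "v \<in> M"
      then have "fst v \<in> insert 0 (fst ` M \<union> snd ` M)" "snd v \<in> insert 0 (fst ` M \<union> snd ` M)" by auto
      then show "v \<in> {..<n} \<times> {..<n}"
        using finM by (auto simp: n_def mem_Times_iff less_Suc_eq_le intro!: Max_ge)
    qed
    have "inj_on (\<lambda>v. (nat (fst v), nat (snd v))) F"
    proof (rule inj_onI)
      fix v w assume "v \<in> F" "w \<in> F"
      then have "v \<in> {1..} \<times> {1..}" "w \<in> {1..} \<times> {1..}" using F by auto
      then show "(nat (fst v), nat (snd v)) = (nat (fst w), nat (snd w)) \<Longrightarrow> v = w"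
        by (auto simp: prod_eq_iff)
    qed
    then have "(\<Sum>v\<in>F. exp (- k * height v)) = (\<Sum>v\<in>M. r ^ fst v * r ^ snd v)"
      unfolding M_def using F ex by (subst sum.reindex) (auto intro!: sum.cong)
    also have "\<dots> \<le> (\<Sum>v\<in>{..<n} \<times> {..<n}. r ^ fst v * r ^ snd v)"
      using sub r by (intro sum_mono2) auto
    also have "\<dots> = (\<Sum>i<n. r ^ i) * (\<Sum>i<n. r ^ i)"
      by (simp add: sum_product sum.cartesian_product case_prod_unfold)
    also have "\<dots> \<le> (1 / (1 - r)) * (1 / (1 - r))"
    proof (intro mult_mono)
      show "(\<Sum>i<n. r ^ i) \<le> 1 / (1 - r)"
        using r sum_le_suminf[of "\<lambda>i. r ^ i" "{..<n}"] by (simp add: summable_geometric suminf_geometric)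
      then show "(\<Sum>i<n. r ^ i) \<le> 1 / (1 - r)" .
    qed (use r in \<open>auto intro: sum_nonneg\<close>)
    finally show "(\<Sum>v\<in>F. exp (- k * height v)) \<le> (1 / (1 - r)) * (1 / (1 - r))" .
  qed
qed simp

text \<open>The error E of the claimed sum is additive over the two subtrees and bounded by a multiple of
  exp (- k h / 2) at the new vertex. Adding up n levels bounds n E by one convergent sum.\<close>

lemma tree_has_sum:
  fixes D :: "int \<times> int \<Rightarrow> int \<times> int \<Rightarrow> real" and T :: "int \<times> int \<Rightarrow> real"
  assumes edge: "farey_edge s0 t0" and k: "0 < k" and K: "0 \<le> K"
    and split: "\<And>s t. farey_desc s0 t0 s t \<Longrightarrow> D s t = D s (s + t) + D (s + t) t + T (s + t)"
    and D: "\<And>s t. farey_desc s0 t0 s t \<Longrightarrow> \<bar>D s t\<bar> \<le> K * exp (- k * height (s + t))"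
    and T: "\<And>s t. farey_desc s0 t0 s t \<Longrightarrow> \<bar>T (s + t)\<bar> \<le> K * exp (- k * height (s + t))"
  shows "(T has_sum D s0 t0) (farey_cone s0 t0)"
proof -
  \<comment> \<open>The decay rate is halved: one factor \<open>e\<close> records the smallness at
    the top vertex of a cone, the other keeps the sum over the cone finite.\<close>
  define e where "e = (\<lambda>v. exp (- (k / 2) * height v))"
  let ?Q = "{1..} \<times> {1..} :: (int \<times> int) set"
  have fe: "farey_edge s t" if "farey_desc s0 t0 s t" for s t using farey_desc_trans[OF that edge] .
  have eQ: "e summable_on ?Q" unfolding e_def by (rule exp_height_summable) (use k in simp)
  have e0: "0 \<le> e v" for v by (simp add: e_def)
  have esum: "e summable_on farey_cone s t" if "farey_desc s0 t0 s t" for s t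
    using summable_on_subset_banach[OF eQ farey_cone_pos[OF fe[OF that]]] .
  have ee: "exp (- k * height v) = e v * e v" for v
    by (simp add: e_def flip: exp_add)
  have Tb: "\<bar>T c\<bar> \<le> K * (e (s + t) * e c)" if d: "farey_desc s0 t0 s t" and c: "c \<in> farey_cone s t" for s t c
  proof -
    obtain s' t' where "farey_desc s t s' t'" "c = s' + t'" using farey_cone_farey_desc[OF c] by blast
    then have "\<bar>T c\<bar> \<le> K * (e c * e c)" using T[of s' t'] farey_desc_trans d by (simp add: ee[symmetric])
    also have "e c * e c \<le> e (s + t) * e c"
      using farey_cone_height[OF fe[OF d] c] k by (intro mult_right_mono) (auto simp: e_def)
    finally show ?thesis using K by (simp add: mult_left_mono)
  qed
  have Tsum: "(\<lambda>c. norm (T c)) summable_on farey_cone s t" if d: "farey_desc s0 t0 s t" for s t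
  proof (rule summable_on_comparison_test)
    show "(\<lambda>c. K * (e (s + t) * e c)) summable_on farey_cone s t"
      using esum[OF d] by (intro summable_on_cmult_right)
    show "norm (T c) \<le> K * (e (s + t) * e c)" if "c \<in> farey_cone s t" for c
      using Tb[OF d that] by simp
  qed simp
  define S where "S = (\<lambda>s t. infsum T (farey_cone s t))"
  define B where "B = (\<lambda>s t. infsum e (farey_cone s t))"
  have rec: "infsum f (farey_cone s t) = f (s + t) + infsum f (farey_cone s (s + t)) + infsum f (farey_cone (s + t) t)"
    if d: "farey_desc s0 t0 s t" and f: "f summable_on farey_cone s t" for s t and f :: "int \<times> int \<Rightarrow> real"
  proof -
    note dj = farey_cone_disjoint[OF farey_edge_coords(1)[OF fe[OF d]]]
    have sm: "f summable_on A" if "A \<subseteq> farey_cone s t" for A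
      using summable_on_subset_banach[OF f that] .
    have "infsum f (farey_cone s t) = f (s + t) + infsum f (farey_cone s (s + t) \<union> farey_cone (s + t) t)"
      unfolding farey_cone_split[of s t]
      by (rule infsum_insert) (use dj(1) sm farey_cone_split[of s t] in auto)
    also have "infsum f (farey_cone s (s + t) \<union> farey_cone (s + t) t) = infsum f (farey_cone s (s + t)) + infsum f (farey_cone (s + t) t)"
      using dj(2) sm farey_cone_split[of s t] by (intro infsum_Un_disjoint) auto
    finally show ?thesis by simp
  qed
  define M where "M = K + K * infsum e ?Q"
  have Eb: "\<bar>D s t - S s t\<bar> \<le> M * e (s + t)" if d: "farey_desc s0 t0 s t" for s t
  proof -
    have "\<bar>S s t\<bar> \<le> infsum (\<lambda>c. \<bar>T c\<bar>) (farey_cone s t)"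
      using norm_infsum_bound[OF Tsum[OF d]] by (simp add: S_def)
    also have "\<dots> \<le> infsum (\<lambda>c. K * (e (s + t) * e c)) (farey_cone s t)"
      using Tsum[OF d] esum[OF d] Tb[OF d] by (intro infsum_mono summable_on_cmult_right) auto
    also have "\<dots> = K * (e (s + t) * B s t)"
      by (simp add: B_def infsum_cmult_right')
    also have "B s t \<le> infsum e ?Q"
      unfolding B_def using farey_cone_pos[OF fe[OF d]] esum[OF d] eQ e0 by (intro infsum_mono2) auto
    finally have "\<bar>S s t\<bar> \<le> K * (e (s + t) * infsum e ?Q)"
      using K e0 by (simp add: mult_left_mono)
    moreover have "\<bar>D s t\<bar> \<le> K * e (s + t)"
    proof -
      have "e (s + t) * e (s + t) \<le> e (s + t) * 1"
        using k farey_edge_height[OF fe[OF d]] by (intro mult_left_mono) (auto simp: e_def)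
      then show ?thesis using D[OF d] K unfolding ee by (smt (verit) mult_left_mono mult_1_right)
    qed
    ultimately show ?thesis by (simp add: M_def algebra_simps)
  qed
  have M0: "0 \<le> M" unfolding M_def using K e0 by (simp add: infsum_nonneg)
  have B0: "0 \<le> B s t" for s t unfolding B_def using e0 by (simp add: infsum_nonneg)
  \<comment> \<open>Each induction step charges \<open>e (s + t)\<close> once and passes the
    remaining n copies to the two disjoint subcones, so no vertex is charged twice.\<close>
  have key: "real n * \<bar>D s t - S s t\<bar> \<le> M * B s t" if "farey_desc s0 t0 s t" for n s t
    using that
  proof (induction n arbitrary: s t)
    case (Suc n)
    note d = Suc.prems farey_desc.left[OF Suc.prems] farey_desc.right[OF Suc.prems]
    have "S s t = T (s + t) + S s (s + t) + S (s + t) t"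
      unfolding S_def by (rule rec[OF d(1)]) (rule Infinite_Sum.abs_summable_summable[OF Tsum[OF d(1)]])
    then have "D s t - S s t = (D s (s + t) - S s (s + t)) + (D (s + t) t - S (s + t) t)"
      using split[OF d(1)] by simp
    then have "real n * \<bar>D s t - S s t\<bar> \<le>
        real n * (\<bar>D s (s + t) - S s (s + t)\<bar> + \<bar>D (s + t) t - S (s + t) t\<bar>)"
      by (intro mult_left_mono) auto
    also have "\<dots> \<le> M * B s (s + t) + M * B (s + t) t"
      using Suc.IH[OF d(2)] Suc.IH[OF d(3)] by (simp add: distrib_left)
    finally have "real (Suc n) * \<bar>D s t - S s t\<bar> \<le> M * e (s + t) + M * B s (s + t) + M * B (s + t) t"
      using Eb[OF d(1)] by (simp add: distrib_right)
    also have "\<dots> = M * B s t"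
      using rec[OF d(1) esum[OF d(1)]] by (simp add: B_def algebra_simps)
    finally show ?case .
  qed (simp add: M0 B0)
  have "D s0 t0 - S s0 t0 = 0"
  proof (rule ccontr)
    assume "D s0 t0 - S s0 t0 \<noteq> 0"
    then obtain n where "M * B s0 t0 < real n * \<bar>D s0 t0 - S s0 t0\<bar>"
      using reals_Archimedean3[of "\<bar>D s0 t0 - S s0 t0\<bar>"] by auto
    then show False using key[OF farey_desc.base, of n] by simp
  qed
  moreover have "T summable_on farey_cone s0 t0"
    using Tsum[OF farey_desc.base] by (rule Infinite_Sum.abs_summable_summable)
  ultimately show ?thesis using has_sum_infsum[of T "farey_cone s0 t0"] by (simp add: S_def)
qed

section \<open>Markov trees of real numbers\<close>

lemma back_simps: "s - (s + t) = - t" "s + t - t = s" for s t :: "int \<times> int"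
  by simp_all

text \<open>By \<open>sum_rel\<close> and \<open>prod_rel\<close> the values at s + t and s - t are
  the two roots of z^2 - x s x t z + x s^2 + x t^2, as for traces on a once-punctured torus. The
  function lives on vectors, so invariance under sign is an axiom.\<close>

locale markov_tree =
  fixes x :: "int \<times> int \<Rightarrow> real"
  assumes pos: "0 < x s"
    and even: "x (- s) = x s"
    and sum_rel: "farey_edge s t \<Longrightarrow> x (s + t) + x (s - t) = x s * x t"
    and prod_rel: "farey_edge s t \<Longrightarrow> x (s + t) * x (s - t) = x s ^ 2 + x t ^ 2"
begin

lemma vertex_rel:
  assumes "farey_edge s t"
  shows "x s ^ 2 + x t ^ 2 + x (s + t) ^ 2 = x s * x t * x (s + t)"
  using sum_rel[OF assms] prod_rel[OF assms] by algebra

text \<open>The Markov equation gives 2 b c \<le> b^2 + c^2 < a b c, hence a > 2; it is symmetric in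
  its three variables.\<close>

lemma gt_2:
  assumes "farey_edge s t" shows "2 < x s" "2 < x t" "2 < x (s + t)"
proof -
  have *: "2 < a" if "a ^ 2 + b ^ 2 + c ^ 2 = a * b * c" "0 < a" "0 < b" "0 < c" for a b c :: real
  proof -
    have "2 * (b * c) \<le> b ^ 2 + c ^ 2" using sum_squares_bound[of b c] by (simp add: mult.assoc)
    also have "\<dots> < a * (b * c)" using that(1) zero_less_power[OF that(2), of 2] unfolding mult.assoc by linarith
    finally show "2 < a" using that by (simp add: mult_less_cancel_right)
  qed
  note v = vertex_rel[OF assms]
  show "2 < x s" by (rule *[of _ "x t" "x (s + t)"]) (use v pos in auto)
  show "2 < x t" by (rule *[of _ "x s" "x (s + t)"]) (use v pos in \<open>auto simp: mult_ac\<close>)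
  show "2 < x (s + t)" by (rule *[of _ "x s" "x t"]) (use v pos in \<open>auto simp: mult_ac\<close>)
qed

text \<open>Bowditch's edge weight. The weights for s - t and for s + t add up to 1 by
  \<open>sum_rel\<close>, and the weight of an edge is the sum of those of its children.\<close>

definition back_quot :: "int \<times> int \<Rightarrow> int \<times> int \<Rightarrow> real" where
  "back_quot s t = x (s - t) / (x s * x t)"

lemma back_left: "back_quot s (s + t) = x t / (x s * x (s + t))"
  and back_right: "back_quot (s + t) t = x s / (x (s + t) * x t)"
  by (simp_all only: back_quot_def back_simps even)

lemma back_pos: "0 < back_quot s t"
  unfolding back_quot_def using pos by simp

lemma back_split:
  assumes "farey_edge s t"
  shows "back_quot s t = back_quot s (s + t) + back_quot (s + t) t"
proof -
  have "x (s - t) = (x s ^ 2 + x t ^ 2) / x (s + t)"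
    using prod_rel[OF assms] pos[of "s + t"] by (simp add: field_simps)
  then have "back_quot s t = (x s ^ 2 + x t ^ 2) / (x (s + t) * x s * x t)"
    by (simp add: back_quot_def)
  then show ?thesis
    unfolding back_left back_right using pos[of s] pos[of t] pos[of "s + t"]
    by (simp add: field_simps power2_eq_square)
qed

text \<open>Along a branch on which the quotient stays at least one half the values of x are bounded by
  those on the initial edge, so the quotient drops by a fixed amount at every step; such a branch is
  therefore finite.\<close>

lemma edge_induct [consumes 1, case_names good split]:
  assumes edge: "farey_edge s t"
    and good: "\<And>s t. farey_edge s t \<Longrightarrow> back_quot s t < 1/2 \<Longrightarrow> P s t"
    and split: "\<And>s t. farey_edge s t \<Longrightarrow> P s (s + t) \<Longrightarrow> P (s + t) t \<Longrightarrow> P s t"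
  shows "P s t"
proof -
  define M where "M = max (x s) (x t)"
  have M: "0 < M" unfolding M_def using pos by (simp add: less_max_iff_disj)
  \<comment> \<open>The number n counts how many drops of size \<open>1 / M ^ 2\<close> bring the
    quotient down to 1/2.\<close>
  have key: "P s t" if "farey_edge s t" "x s \<le> M" "x t \<le> M" "back_quot s t \<le> 1/2 + real n / M ^ 2" for n s t
    using that
  proof (induction n arbitrary: s t)
    case (0 s t)
    note bs = back_split[OF 0(1)] back_pos[of s "s + t"] back_pos[of "s + t" t]
    \<comment> \<open>Both child quotients are positive with sum at most 1/2, so each is strictly
      below 1/2.\<close>
    have "P s (s + t)" "P (s + t) t"
      by (rule good; use 0 bs in \<open>auto intro: farey_desc.intros\<close>)+
    then show ?case using split 0 by blast
  next
    case (Suc n s t)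
    note bs = back_split[OF Suc(2)] back_pos[of s "s + t"] back_pos[of "s + t" t]
    note g = gt_2[OF Suc(2)]
    let ?z = "x (s + t)"
    \<comment> \<open>Lower bound for the share of the quotient that goes to the sibling
      edge.\<close>
    have drop: "1 / M ^ 2 \<le> b / (?z * a)" if "?z \<le> M" "a \<le> M" "0 < a" "2 < b" for a b
    proof -
      have "?z * a \<le> M * M" using that pos[of "s + t"] M by (intro mult_mono) auto
      moreover have "0 < ?z * a" using that pos by simp
      ultimately show ?thesis using that(4) by (intro frac_le) (auto simp: power2_eq_square)
    qed
    \<comment> \<open>A child quotient of at least 1/2 puts the new value below the one it replaces,
      so the bound M passes to that child.\<close>
    have small: "?z \<le> a" if "1/2 \<le> a / (b * ?z)" "2 < b" "0 < a" for a b
    proof -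
      have "b * ?z \<le> 2 * a" using that pos[of "s + t"] by (simp add: field_simps)
      moreover have "2 * ?z \<le> b * ?z" using that pos[of "s + t"] by simp
      ultimately show ?thesis by linarith
    qed
    have "P s (s + t)"
    proof (cases "back_quot s (s + t) < 1/2")
      case True
      then show ?thesis using good farey_desc.left[OF Suc(2)] by blast
    next
      case False
      then have z: "?z \<le> x t" using small[of "x t" "x s"] g pos[of t] by (simp add: back_left)
      then have "1 / M ^ 2 \<le> back_quot (s + t) t"
        unfolding back_right by (intro drop) (use Suc g pos in auto)
      then show ?thesis
        using Suc z bs by (intro Suc.IH) (auto intro: farey_desc.intros simp: add_divide_distrib)
    qed
    moreover have "P (s + t) t"
    proof (cases "back_quot (s + t) t < 1/2")
      case True
      then show ?thesis using good farey_desc.right[OF Suc(2)] by blast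
    next
      case False
      then have z: "?z \<le> x s" using small[of "x s" "x t"] g pos[of s] by (simp add: back_right mult.commute)
      then have "1 / M ^ 2 \<le> back_quot s (s + t)"
        unfolding back_left by (subst mult.commute, intro drop) (use Suc g pos in auto)
      then show ?thesis
        using Suc z bs by (intro Suc.IH) (auto intro: farey_desc.intros simp: add_divide_distrib)
    qed
    ultimately show ?case using split Suc(2) by blast
  qed
  obtain n where "back_quot s t - 1/2 \<le> real n * (1 / M ^ 2)"
    using reals_Archimedean3[of "1 / M ^ 2"] M by (metis less_imp_le zero_less_divide_1_iff zero_less_power)
  then show ?thesis using edge by (intro key[of s t n]) (auto simp: M_def)
qed

end

section \<open>Uniform growth below a good edge\<close>

locale good_tree = markov_tree +
  fixes s0 t0
  assumes root: "farey_edge s0 t0" and good: "back_quot s0 t0 < 1/2"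
begin

lemma farey_edge: "farey_desc s0 t0 s t \<Longrightarrow> farey_edge s t"
  using farey_desc_trans root by blast

text \<open>Children share the positive quotient of their parent, so goodness of the root is
  inherited by the whole subtree with one uniform constant.\<close>

lemma back_le: "farey_desc s0 t0 s t \<Longrightarrow> back_quot s t \<le> back_quot s0 t0"
proof (induction rule: farey_desc.induct)
  case (left s t)
  then show ?case using back_split[OF farey_edge] back_pos[of "s + t" t] by fastforce
next
  case (right s t)
  then show ?case using back_split[OF farey_edge] back_pos[of s "s + t"] by fastforce
qed simp

lemma next_eq: "farey_desc s0 t0 s t \<Longrightarrow> x (s + t) = x s * x t * (1 - back_quot s t)"
proof -
  assume d: "farey_desc s0 t0 s t"
  have "x s * x t * back_quot s t = x (s - t)"
    using pos[of s] pos[of t] by (simp add: back_quot_def)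
  then show ?thesis using sum_rel[OF farey_edge[OF d]] by (simp add: right_diff_distrib)
qed

lemma next_ge: assumes "farey_desc s0 t0 s t" shows "x s * x t / 2 \<le> x (s + t)"
proof -
  have "x s * x t * (1/2) \<le> x s * x t * (1 - back_quot s t)"
    using back_le[OF assms] good pos[of s] pos[of t] by (intro mult_left_mono) auto
  then show ?thesis using next_eq[OF assms] by simp
qed

lemma next_ge': assumes "farey_desc s0 t0 s t" shows "x s \<le> x (s + t)" "x t \<le> x (s + t)"
proof -
  note g = gt_2[OF farey_edge[OF assms]]
  have "x s * 2 \<le> x s * x t" "2 * x t \<le> x s * x t" using g by (auto intro: mult_mono)
  then show "x s \<le> x (s + t)" "x t \<le> x (s + t)" using next_ge[OF assms] by linarith+
qed

text \<open>The coefficient that u (s - t) receives when the linearised sum relation is divided by x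
  (s + t). It equals q / (1 - q) for q = \<open>back_quot s t\<close>, which is increasing in q and
  below 1 for q < 1/2.\<close>

definition back_ratio :: "int \<times> int \<Rightarrow> int \<times> int \<Rightarrow> real" where
  "back_ratio s t = x (s - t) / x (s + t)"

definition ratio_bound :: real where
  "ratio_bound = back_quot s0 t0 / (1 - back_quot s0 t0)"

lemma ratio_bound: "0 < ratio_bound" "ratio_bound < 1"
  using good back_pos[of s0 t0] by (simp_all add: ratio_bound_def)

lemma back_ratio: assumes "farey_desc s0 t0 s t" shows "0 < back_ratio s t" "back_ratio s t \<le> ratio_bound"
proof -
  show "0 < back_ratio s t" by (simp add: back_ratio_def pos)
  have "back_ratio s t = back_quot s t / (1 - back_quot s t)"
    using pos[of s] pos[of t] unfolding back_ratio_def next_eq[OF assms] by (simp add: back_quot_def)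
  then show "back_ratio s t \<le> ratio_bound"
    using back_le[OF assms] good back_pos[of s t] by (simp add: ratio_bound_def frac_le)
qed

text \<open>The largest rate for which x v \<ge> 2 exp(rate * height v) holds at both ends of the
  root edge. The factor 2 makes the bound self-reproducing, because x (s + t) \<ge> x s x t /
  2.\<close>

definition rate :: real where
  "rate = min (ln (x s0 / 2) / height s0) (ln (x t0 / 2) / height t0)"

lemma rate_pos: "0 < rate"
  using gt_2[OF root] farey_edge_height[OF root] by (simp add: rate_def)

lemma growth_le:
  assumes "farey_desc s0 t0 s t"
  shows "2 * exp (rate * height s) \<le> x s" "2 * exp (rate * height t) \<le> x t"
proof -
  have step: "2 * exp (rate * height (s + t)) \<le> x (s + t)"
    if d: "farey_desc s0 t0 s t" and IH: "2 * exp (rate * height s) \<le> x s" "2 * exp (rate * height t) \<le> x t" for s t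
  proof -
    have "(2 * exp (rate * height s)) * (2 * exp (rate * height t)) \<le> x s * x t"
      using IH pos[of s] by (intro mult_mono) auto
    then show ?thesis using next_ge[OF d] by (simp add: distrib_left exp_add)
  qed
  have r: "2 * exp (rate * height v) \<le> x v"
    if "rate \<le> ln (x v / 2) / height v" "1 \<le> height v" for v
  proof -
    have "rate * height v \<le> ln (x v / 2)" using that by (simp add: field_simps)
    then have "exp (rate * height v) \<le> x v / 2" using pos[of v] by (simp add: ln_ge_iff)
    then show ?thesis by simp
  qed
  have "2 * exp (rate * height s) \<le> x s \<and> 2 * exp (rate * height t) \<le> x t"
    using assms
  proof (induction rule: farey_desc.induct)
    case base
    show ?case by (intro conjI r farey_edge_height[OF root]) (auto simp: rate_def)
  qed (use step in auto)
  then show "2 * exp (rate * height s) \<le> x s" "2 * exp (rate * height t) \<le> x t" by auto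
qed

text \<open>The defect u s + u t - u (s - t) from additivity satisfies a contracting
  recursion, so it is controlled separately from u itself.\<close>

lemma perturbation_bound:
  fixes u :: "int \<times> int \<Rightarrow> real" and j :: nat
  assumes ueven: "\<And>v. u (- v) = u v" and K1: "0 \<le> K1"
    and rec: "\<And>s t. farey_desc s0 t0 s t \<Longrightarrow>
      \<bar>u (s + t) + back_ratio s t * u (s - t) - (1 + back_ratio s t) * (u s + u t)\<bar> \<le> K1 * height (s + t) ^ j"
  obtains K n where "0 \<le> K"
    "\<And>s t. farey_desc s0 t0 s t \<Longrightarrow> \<bar>u s\<bar> \<le> K * height s ^ n \<and> \<bar>u t\<bar> \<le> K * height t ^ n"
proof -
  \<comment> \<open>\<open>C\<close> solves C = 3 + ratio_bound * C. The defect of a child edge is 2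
    u + q d + R: the first term costs 2, the last costs 1, and the old defect d comes with the
    contracting factor q.\<close>
  define C where "C = 3 / (1 - ratio_bound)"
  \<comment> \<open>Large enough for the factor n in \<open>pow_superadd\<close> to absorb
    ratio_bound * C + 1 copies of the mixed terms, and at least j so that the perturbation is
    dominated.\<close>
  define n where "n = nat \<lceil>C\<rceil> + 2 + j"
  define K where "K = K1 * 2 ^ j + \<bar>u s0\<bar> + \<bar>u t0\<bar> + \<bar>u s0 + u t0 - u (s0 - t0)\<bar>"
  \<comment> \<open>The mixed terms bound the defect. They have the degree of the bound for u, but
    are only linear in the smaller height when the other height dominates.\<close>
  define G where "G = (\<lambda>a b :: real. a * b ^ n + b * a ^ n)"
  have C3: "3 \<le> C" and Cq: "3 + ratio_bound * C = C"
    using ratio_bound by (simp_all add: C_def field_simps)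
  have Cn: "C + 1 \<le> n" unfolding n_def using real_nat_ceiling_ge[of C] by simp
  have n2: "2 \<le> n" "j \<le> n" by (simp_all add: n_def)
  have K0: "0 \<le> K" "K1 * 2 ^ j \<le> K" using K1 by (simp_all add: K_def)
  have KK: "K1 \<le> K"
    using K0 K1 mult_left_mono[of 1 "2 ^ j" K1] by simp
  let ?I = "\<lambda>s t. \<bar>u s\<bar> \<le> K * height s ^ Suc n \<and> \<bar>u t\<bar> \<le> K * height t ^ Suc n
    \<and> \<bar>u s + u t - u (s - t)\<bar> \<le> C * K * G (height s) (height t)"
  have G_sym: "G a b = G b a" for a b by (simp add: G_def)
  have weak: "G a b \<le> a * (a + b) ^ n" if "1 \<le> a" "1 \<le> b" for a b
    unfolding G_def using pow_superadd_weak[OF that n2(1)] .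
  \<comment> \<open>One step down the tree as a statement about reals, usable for both children: a
    and b are the heights of the ends, ua and ub the values of u there, d the defect and q the back
    ratio.\<close>
  have step: "\<bar>v\<bar> \<le> K * (a + b) ^ Suc n \<and> \<bar>2 * ua + q * d + R\<bar> \<le> C * K * G a (a + b)"
    if a: "1 \<le> a" "1 \<le> b" and q: "0 < q" "q \<le> ratio_bound"
      and ua: "\<bar>ua\<bar> \<le> K * a ^ Suc n" "\<bar>ub\<bar> \<le> K * b ^ Suc n" and d: "\<bar>d\<bar> \<le> C * K * G a b"
      and R: "\<bar>R\<bar> \<le> K1 * (a + b) ^ j" and v: "v = ua + ub + q * d + R"
    for a b ua ub q d R v :: real
  proof
    have G0: "0 \<le> G a b" using a by (simp add: G_def)
    have CK: "0 \<le> C * K * G a b" using C3 K0 G0 by simp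
    have qd: "\<bar>q * d\<bar> \<le> ratio_bound * (C * K * G a b)"
      using q d CK by (simp add: abs_mult mult_mono)
    have "max a b ^ n \<le> G a b"
    proof -
      have "1 * b ^ n \<le> a * b ^ n" "1 * a ^ n \<le> b * a ^ n" using a by (intro mult_right_mono; simp)+
      moreover have "0 \<le> a * b ^ n" "0 \<le> b * a ^ n" using a by simp_all
      ultimately show ?thesis unfolding G_def max_def by (simp split: if_split)
    qed
    have "(a + b) ^ j \<le> (2 * max a b) ^ j" using a by (intro power_mono) auto
    also have "\<dots> \<le> 2 ^ j * max a b ^ n"
      using a n2 by (simp add: power_mult_distrib power_increasing)
    also have "\<dots> \<le> 2 ^ j * G a b" using \<open>max a b ^ n \<le> G a b\<close> by simp
    finally have "K1 * (a + b) ^ j \<le> K1 * (2 ^ j * G a b)" using K1 by (rule mult_left_mono)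
    also have "\<dots> \<le> K * G a b"
      using mult_right_mono[OF K0(2) G0] by (simp add: mult.assoc)
    finally have R': "\<bar>R\<bar> \<le> K * G a b" using R by simp
    have "\<bar>v\<bar> \<le> K * a ^ Suc n + K * b ^ Suc n + ratio_bound * (C * K * G a b) + K * G a b"
      unfolding v using ua qd R' by linarith
    also have "\<dots> = K * (a ^ Suc n + b ^ Suc n + (ratio_bound * C + 1) * G a b)"
      by (simp add: algebra_simps)
    also have "\<dots> \<le> K * (a ^ Suc n + b ^ Suc n + real n * G a b)"
      using Cq Cn G0 K0 by (intro mult_left_mono add_left_mono mult_right_mono) auto
    also have "\<dots> \<le> K * (a + b) ^ Suc n"
      using pow_superadd[of a b n] a n2 K0 by (intro mult_left_mono) (auto simp: G_def)
    finally show "\<bar>v\<bar> \<le> K * (a + b) ^ Suc n" .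
    let ?h = "a * (a + b) ^ n"
    have h: "0 \<le> ?h" using a by simp
    have "a ^ n \<le> (a + b) ^ n" using a by (intro power_mono) auto
    then have "a ^ Suc n \<le> ?h" using a by simp
    then have 1: "\<bar>2 * ua\<bar> \<le> 2 * K * ?h"
      using ua(1) K0(1) mult_left_mono[of "a ^ Suc n" ?h K] by simp
    have "ratio_bound * (C * K * G a b) \<le> ratio_bound * (C * K * ?h)"
      using weak[OF a] ratio_bound C3 K0 by (intro mult_left_mono) auto
    then have 2: "\<bar>q * d\<bar> \<le> ratio_bound * C * K * ?h" using qd by (simp add: mult.assoc)
    have "(a + b) ^ j \<le> (a + b) ^ n" using a n2 by (intro power_increasing) auto
    also have "\<dots> \<le> ?h" using a mult_right_mono[of 1 a "(a + b) ^ n"] by simp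
    finally have "K1 * (a + b) ^ j \<le> K * ?h" using KK K1 K0 a by (intro mult_mono) auto
    then have "\<bar>2 * ua + q * d + R\<bar> \<le> 2 * K * ?h + ratio_bound * C * K * ?h + K * ?h"
      using 1 2 R by linarith
    also have "\<dots> = (3 + ratio_bound * C) * K * ?h" by (simp add: algebra_simps)
    also have "\<dots> = C * K * ?h" by (simp only: Cq)
    also have "\<dots> \<le> C * K * G a (a + b)"
      using C3 K0 a by (intro mult_left_mono) (auto simp: G_def)
    finally show "\<bar>2 * ua + q * d + R\<bar> \<le> C * K * G a (a + b)" .
  qed
  have inv: "?I s t" if "farey_desc s0 t0 s t" for s t
    using that
  proof (induction rule: farey_desc.induct)
    case base
    have "1 \<le> G (height s0) (height t0)"
    proof -
      have "1 * 1 \<le> height s0 * height t0 ^ n" "0 \<le> height t0 * height s0 ^ n"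
        using farey_edge_height[OF root] one_le_power[OF farey_edge_height(2)[OF root], of n]
        by (intro mult_mono mult_nonneg_nonneg; simp)+
      then show ?thesis by (simp add: G_def)
    qed
    then have "1 \<le> C * G (height s0) (height t0)"
      using C3 mult_mono[of 1 C 1 "G (height s0) (height t0)"] by simp
    then have "K \<le> C * K * G (height s0) (height t0)"
      using K0(1) mult_left_mono[of 1 "C * G (height s0) (height t0)" K] by (simp add: mult_ac)
    moreover have "\<bar>u v\<bar> \<le> K * height v ^ Suc n" if "\<bar>u v\<bar> \<le> K" "1 \<le> height v" for v
      using that K0(1) mult_left_mono[of 1 "height v ^ Suc n" K] one_le_power[OF that(2)] by fastforce
    moreover have "\<bar>u s0\<bar> \<le> K" "\<bar>u t0\<bar> \<le> K" "\<bar>u s0 + u t0 - u (s0 - t0)\<bar> \<le> K"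
      using K1 by (simp_all add: K_def)
    ultimately show ?case using farey_edge_height[OF root] by (meson order_trans)
  next
    case (left s t)
    let ?q = "back_ratio s t" and ?d = "u s + u t - u (s - t)"
    let ?R = "u (s + t) + ?q * u (s - t) - (1 + ?q) * (u s + u t)"
    note fh = farey_edge_height[OF farey_edge[OF left(1)]]
    have "\<bar>u (s + t)\<bar> \<le> K * (height s + height t) ^ Suc n \<and>
        \<bar>2 * u s + ?q * ?d + ?R\<bar> \<le> C * K * G (height s) (height s + height t)"
      by (rule step[OF fh back_ratio[OF left(1)], where ub = "u t"])
         (use left.IH rec[OF left(1)] in \<open>auto simp: algebra_simps\<close>)
    moreover have "2 * u s + ?q * ?d + ?R = u s + u (s + t) - u (s - (s + t))"
      unfolding back_simps ueven by (simp add: algebra_simps)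
    ultimately show ?case using left.IH by simp
  next
    case (right s t)
    let ?q = "back_ratio s t" and ?d = "u s + u t - u (s - t)"
    let ?R = "u (s + t) + ?q * u (s - t) - (1 + ?q) * (u s + u t)"
    note fh = farey_edge_height[OF farey_edge[OF right(1)]]
    have "\<bar>u (s + t)\<bar> \<le> K * (height t + height s) ^ Suc n \<and>
        \<bar>2 * u t + ?q * ?d + ?R\<bar> \<le> C * K * G (height t) (height t + height s)"
      by (rule step[OF fh(2,1) back_ratio[OF right(1)], where ub = "u s"])
         (use right.IH rec[OF right(1)] G_sym in \<open>auto simp: algebra_simps\<close>)
    moreover have "2 * u t + ?q * ?d + ?R = u (s + t) + u t - u (s + t - t)"
      unfolding back_simps by (simp add: algebra_simps)
    ultimately show ?case using right.IH G_sym by (simp add: add.commute)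
  qed
  show ?thesis by (rule that[of K "Suc n"]) (use inv K0 in auto)
qed

end

section \<open>Super Markov trees\<close>

text \<open>The terms that contain a coefficient at L itself are linear with the bodies as factors;
  the rest involves only proper nonempty subsets of L and is known in an induction over L.\<close>

lemma coef_mult_split:
  assumes "finite L" "L \<noteq> {}"
  shows "coef (x * y) L = body x * coef y L + coef x L * body y +
    (\<Sum>A\<in>Pow L - {{}, L}. gsgn A (L - A) * coef x A * coef y (L - A))"
proof -
  have "Pow L = insert {} (insert L (Pow L - {{}, L}))" by auto
  then have "coef (x * y) L =
      (\<Sum>A\<in>insert {} (insert L (Pow L - {{}, L})). gsgn A (L - A) * coef x A * coef y (L - A))"
    using assms(1) by (simp add: coef_mult)
  also have "\<dots> = body x * coef y L + coef x L * body y +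
      (\<Sum>A\<in>Pow L - {{}, L}. gsgn A (L - A) * coef x A * coef y (L - A))"
    using assms by (simp add: body_def)
  finally show ?thesis .
qed

lemma power_le_exp:
  fixes c :: real assumes "0 < c"
  obtains M where "0 \<le> M" "\<And>h. 0 \<le> h \<Longrightarrow> h ^ j \<le> M * exp (c * h)"
proof (rule that[of "fact j / c ^ j"])
  fix h :: real assume h: "0 \<le> h"
  have "(c * h) ^ j / fact j \<le> exp (c * h)"
  proof -
    have "(\<Sum>n\<in>{j}. (c * h) ^ n /\<^sub>R fact n) \<le> (\<Sum>n. (c * h) ^ n /\<^sub>R fact n)"
      using assms h by (intro sum_le_suminf summable_exp_generic) auto
    then show ?thesis by (simp add: exp_def divide_inverse mult.commute)
  qed
  then show "h ^ j \<le> fact j / c ^ j * exp (c * h)"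
    using assms by (simp add: field_simps power_mult_distrib)
qed (use assms in simp)

lemma body_numeral [simp]: "body (numeral n) = numeral n"
  by (metis body_simps(8) of_real_numeral)

lemma evg_inverse_scaleR:
  fixes x :: evg assumes "c \<noteq> 0" "body x \<noteq> 0"
  shows "inverse (c *\<^sub>R x) = (1 / c) *\<^sub>R inverse x"
  by (rule evg_inverse_unique) (use assms evg_right_inverse[of x] in simp)

lemma nilpart_scaleR: "nilpart (c *\<^sub>R x) = c *\<^sub>R nilpart x"
  by (simp add: nilpart_def scaleR_diff_right of_real_def)

text \<open>Here V stands for W. Its signs may vary from slope to slope, but all values are
  multiples of a single square-zero element v, so that all products of two of them vanish.\<close>

locale super_tree =
  fixes N :: nat and X V :: "int \<times> int \<Rightarrow> evg" and v :: evg
  assumes X_pos: "0 < body (X s)" and X_even: "X (- s) = X s"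
    and v_square: "v * v = 0" and v_body: "body v = 0" and V_cases: "V s = v \<or> V s = - v"
    and X_sum: "farey_edge s t \<Longrightarrow> X (s + t) + X (s - t) = X s * X t - V s * X t - V t * X s"
    and X_prod: "farey_edge s t \<Longrightarrow> X (s + t) * X (s - t) = X s * X s + X t * X t + X s * X t * V (s + t)"
begin

abbreviation x where "x s \<equiv> body (X s)"

lemma V_body [simp]: "body (V s) = 0"
  using V_cases[of s] v_body by auto

lemma V_mult [simp]: "V s * V t = 0"
  using V_cases[of s] V_cases[of t] v_square by auto

lemma coef_V: "\<bar>coef (V s) L\<bar> = \<bar>coef v L\<bar>"
  using V_cases[of s] by auto

sublocale markov_tree x
proof
  fix s t assume e: "farey_edge s t"
  show "x (s + t) + x (s - t) = x s * x t"
    using arg_cong[OF X_sum[OF e], of body] by simp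
  show "x (s + t) * x (s - t) = x s ^ 2 + x t ^ 2"
    using arg_cong[OF X_prod[OF e], of body] by (simp add: power2_eq_square)
qed (simp_all add: X_pos X_even)

lemma X_inverse [simp]: "X s * inverse (X s) = 1" "inverse (X s) * X s = 1"
  using evg_right_inverse[of "X s"] X_pos[of s] by (simp_all add: mult.commute)

definition Y :: "int \<times> int \<Rightarrow> evg" where "Y s = X s - V s"

text \<open>This is \<open>r_arc\<close>, the root of r^2 - Y s r + 1 with large body, that is, exp
  (length / 2).\<close>

definition R :: "int \<times> int \<Rightarrow> evg" where
  "R s = (1/2) *\<^sub>R (Y s + efun sqrt (Y s * Y s - of_real 4))"

definition rho :: "int \<times> int \<Rightarrow> evg" where "rho s = inverse (R s)"

lemma body_Y [simp]: "body (Y s) = x s"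
  by (simp add: Y_def)

lemma R_body: assumes "2 < x s" shows "x s / 2 \<le> body (R s)"
proof -
  have "0 \<le> x s * x s - 4" using mult_mono[of 2 "x s" 2 "x s"] assms by simp
  then show ?thesis by (simp add: R_def)
qed

lemma disc_pos: assumes "2 < x s" shows "0 < x s * x s - 4"
proof -
  have "2 * 2 < x s * x s" using assms by (intro mult_strict_mono) auto
  then show ?thesis by simp
qed

lemma R_rho: assumes "2 < x s" shows "R s * rho s = 1" "R s + rho s = Y s"
proof -
  have "body (R s) \<noteq> 0" using R_body[OF assms] assms by auto
  then show 1: "R s * rho s = 1" unfolding rho_def by (rule evg_right_inverse)
  define q where "q = efun sqrt (Y s * Y s - of_real 4)"
  have q: "q * q = Y s * Y s - of_real 4"
    unfolding q_def by (rule efun_sqrt_square) (use disc_pos[OF assms] in simp)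
  have "R s * ((1/2) *\<^sub>R (Y s - q)) = (1/4) *\<^sub>R (Y s * Y s - q * q)"
    unfolding R_def q_def[symmetric] by (simp add: algebra_simps)
  also have "\<dots> = 1" unfolding q by (simp add: of_real_def)
  finally have "rho s = (1/2) *\<^sub>R (Y s - q)" unfolding rho_def by (rule evg_inverse_unique)
  then show "R s + rho s = Y s"
    unfolding R_def q_def[symmetric] by (simp add: scaleR_add_right scaleR_diff_right flip: scaleR_add_left)
qed

text \<open>D s t is what the slopes strictly between s and t contribute to the identity;
  T is twice the summand of the theorem.\<close>

definition T :: "int \<times> int \<Rightarrow> evg" where
  "T s = (2 *\<^sub>R rho s + V s) * inverse (X s)"

definition D :: "int \<times> int \<Rightarrow> int \<times> int \<Rightarrow> evg" where
  "D s t = X (s - t) * inverse (X s) * inverse (X t) - rho s * inverse (X s) - rho t * inverse (X t)"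

text \<open>Divide \<open>X_prod\<close> by X s X t X (s + t). The two squares give the quotients of
  the children and the last term gives V (s + t) / X (s + t). The children also subtract rho (s + t)
  / X (s + t) twice, which accounts for the other part of T.\<close>

lemma D_split:
  assumes "farey_edge s t"
  shows "D s t = D s (s + t) + D (s + t) t + T (s + t)"
proof -
  let ?Z = "X (s + t)"
  have "X (s - t) * inverse (X s) * inverse (X t)
      = (?Z * X (s - t)) * (inverse (X s) * inverse (X t) * inverse ?Z)"
    using X_inverse(1)[of "s + t"] by (simp add: mult_ac)
  also have "\<dots> = (X s * inverse (X s)) * (X s * inverse ?Z * inverse (X t))
      + (X t * inverse (X t)) * (X t * inverse (X s) * inverse ?Z)
      + (X s * inverse (X s)) * ((X t * inverse (X t)) * (V (s + t) * inverse ?Z))"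
    unfolding X_prod[OF assms] by (simp only: algebra_simps)
  also have "\<dots> = X s * inverse ?Z * inverse (X t) + X t * inverse (X s) * inverse ?Z + V (s + t) * inverse ?Z"
    by simp
  finally show ?thesis
    unfolding D_def T_def back_simps X_even
    by (simp add: algebra_simps scaleR_2)
qed

text \<open>Dividing by the body removes the exponential growth; what remains grows polynomially in
  the height.\<close>

definition U :: "int \<times> int \<Rightarrow> evg" where "U s = (1 / x s) *\<^sub>R X s"

lemma X_nonzero [simp]: "x s \<noteq> 0"
  using X_pos[of s] by simp

lemma X_to_U:
  "coef (X s) L = x s * coef (U s) L"
  "coef (X s * X t) L = x s * x t * coef (U s * U t) L"
  "coef (V s * X t) L = x t * coef (V s * U t) L"
  by (simp_all add: U_def)

lemma body_U [simp]: "body (U s) = 1"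
  using X_pos[of s] by (simp add: U_def)

lemma inverse_X: "inverse (X s) = (1 / x s) *\<^sub>R inverse (U s)"
  by (simp add: U_def evg_inverse_scaleR)

lemma U_even: "U (- s) = U s"
  by (simp add: U_def X_even)

end

section \<open>Polynomial growth of the normalised coefficients\<close>

locale good_super_tree = super_tree +
  fixes s0 t0
  assumes root: "farey_edge s0 t0" and good: "back_quot s0 t0 < 1/2"
begin

sublocale good_tree x s0 t0
  by unfold_locales (use root good in auto)

definition pts :: "(int \<times> int) set" where
  "pts = {s. \<exists>t. farey_desc s0 t0 s t \<or> farey_desc s0 t0 t s}"

lemma pts_height: "s \<in> pts \<Longrightarrow> 1 \<le> height s"
  unfolding pts_def using farey_edge farey_edge_height by blast

lemma farey_desc_pts:
  assumes "farey_desc s0 t0 s t" shows "s \<in> pts" "t \<in> pts" "s + t \<in> pts"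
  using assms farey_desc.left[OF assms] unfolding pts_def by blast+

text \<open>The coefficient of \<open>X_sum\<close> at L, divided by x (s + t). As V has body zero,
  the right side involves U only at proper subsets of L, and the left side has the shape required by
  \<open>perturbation_bound\<close>.\<close>

lemma U_coef_rec:
  assumes d: "farey_desc s0 t0 s t" and L: "finite L" "L \<noteq> {}"
  defines "q \<equiv> back_ratio s t"
  shows "coef (U (s + t)) L + q * coef (U (s - t)) L - (1 + q) * (coef (U s) L + coef (U t) L) =
    (1 + q) * (\<Sum>A\<in>Pow L - {{}, L}. gsgn A (L - A) * coef (U s) A * coef (U t) (L - A))
    - x t / x (s + t) * coef (V s * U t) L - x s / x (s + t) * coef (V t * U s) L"
proof -
  let ?z = "x (s + t)" and ?S = "\<Sum>A\<in>Pow L - {{}, L}. gsgn A (L - A) * coef (U s) A * coef (U t) (L - A)"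
  note p = X_pos[of "s + t"] X_pos[of s] X_pos[of t]
  have "coef (X (s + t)) L + coef (X (s - t)) L =
      coef (X s * X t) L - coef (V s * X t) L - coef (V t * X s) L"
    using arg_cong[OF X_sum[OF farey_edge[OF d]], of "\<lambda>y. coef y L"] by simp
  then have e: "?z * coef (U (s + t)) L + x (s - t) * coef (U (s - t)) L =
      x s * x t * (coef (U t) L + coef (U s) L + ?S) - x t * coef (V s * U t) L - x s * coef (V t * U s) L"
    unfolding X_to_U using coef_mult_split[OF L, of "U s" "U t"] by simp
  have q: "x s * x t = ?z * (1 + q)" "x (s - t) = ?z * q"
    using sum_rel[OF farey_edge[OF d]] p by (simp_all add: q_def back_ratio_def field_simps)
  have "?z * (coef (U (s + t)) L + q * coef (U (s - t)) L - (1 + q) * (coef (U s) L + coef (U t) L)) =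
     ?z * ((1 + q) * ?S - x t / ?z * coef (V s * U t) L - x s / ?z * coef (V t * U s) L)"
    using e unfolding q using p by (simp add: algebra_simps)
  then show ?thesis using p by simp
qed

lemma uniform_bound:
  assumes "finite F" "\<And>A. A \<in> F \<Longrightarrow> \<exists>K n. 0 \<le> K \<and> (\<forall>s\<in>pts. \<bar>coef (U s) A\<bar> \<le> K * height s ^ n)"
  shows "\<exists>K n. 0 \<le> K \<and> (\<forall>A\<in>F. \<forall>s\<in>pts. \<bar>coef (U s) A\<bar> \<le> K * height s ^ n)"
  using assms
proof (induction F rule: finite_induct)
  case (insert B F)
  obtain K n where K: "0 \<le> K" "\<And>A s. A \<in> F \<Longrightarrow> s \<in> pts \<Longrightarrow> \<bar>coef (U s) A\<bar> \<le> K * height s ^ n"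
    using insert by blast
  obtain M m where M: "0 \<le> M" "\<And>s. s \<in> pts \<Longrightarrow> \<bar>coef (U s) B\<bar> \<le> M * height s ^ m"
    using insert.prems[of B] by blast
  have le: "C * height s ^ i \<le> (K + M) * height s ^ (n + m)"
    if "0 \<le> C" "C \<le> K + M" "i \<le> n + m" "s \<in> pts" for C i s
    using that K(1) M(1) pts_height[OF that(4)] by (intro mult_mono power_increasing) auto
  show ?case
  proof (intro exI[of _ "K + M"] exI[of _ "n + m"] conjI ballI)
    fix A s assume A: "A \<in> insert B F" and s: "s \<in> pts"
    show "\<bar>coef (U s) A\<bar> \<le> (K + M) * height s ^ (n + m)"
    proof (cases "A = B")
      case True
      then show ?thesis using M(2)[OF s] le[of M m s] s K(1) M(1) by simp
    next
      case False
      then have "A \<in> F" using A by simp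
      then show ?thesis using K(2)[of A s] le[of K n s] s K(1) M(1) by simp
    qed
  qed (use K M in simp)
qed auto

lemma U_coef_bound:
  assumes "finite L"
  shows "\<exists>K n. 0 \<le> K \<and> (\<forall>s\<in>pts. \<bar>coef (U s) L\<bar> \<le> K * height s ^ n)"
  using assms
proof (induction L rule: finite_psubset_induct)
  case (psubset L)
  show ?case
  proof (cases "L = {}")
    case True
    then show ?thesis
      using body_U unfolding body_def by (intro exI[of _ 1] exI[of _ 0]) auto
  next
    case False
    have "finite {A. A \<subset> L}" by (rule finite_subset[of _ "Pow L"]) (use psubset(1) in auto)
    then obtain K n where K: "0 \<le> K"
      "\<And>A s. A \<subset> L \<Longrightarrow> s \<in> pts \<Longrightarrow> \<bar>coef (U s) A\<bar> \<le> K * height s ^ n"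
      using uniform_bound[of "{A. A \<subset> L}"] psubset.IH by blast
    define m where "m = real (card (Pow L - {{}, L}))"
    define Kv where "Kv = (\<Sum>A\<in>Pow L. \<bar>coef v A\<bar>)"
    have Kv: "\<bar>coef (V s) A\<bar> \<le> Kv" if "A \<subseteq> L" for s A
      unfolding coef_V Kv_def by (rule member_le_sum) (use that psubset(1) in auto)
    have Kv0: "0 \<le> Kv" unfolding Kv_def by (simp add: sum_nonneg)
    \<comment> \<open>The first 2 bounds 1 + \<open>back_ratio\<close>, the second counts the two
      terms with V, and m is the number of proper nonempty subsets. Products of two bounds of degree
      n lead to the exponent \<open>2 * n\<close>.\<close>
    define K1 where "K1 = 2 * (m * (K * K)) + 2 * (Kv + m * (Kv * K))"
    have m0: "0 \<le> m" by (simp add: m_def)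
    have rec: "\<bar>coef (U (s + t)) L + back_ratio s t * coef (U (s - t)) L
        - (1 + back_ratio s t) * (coef (U s) L + coef (U t) L)\<bar> \<le> K1 * height (s + t) ^ (2 * n)"
      if d: "farey_desc s0 t0 s t" for s t
    proof -
      let ?h = "height (s + t)"
      note pt = farey_desc_pts[OF d]
      have h1: "1 \<le> ?h" "height s \<le> ?h" "height t \<le> ?h"
        using pts_height[OF pt(1)] pts_height[OF pt(2)] by simp_all
      have b: "\<bar>coef (U c) A\<bar> \<le> K * ?h ^ n" if "A \<subset> L" "c = s \<or> c = t" for A c
      proof -
        have "K * height c ^ n \<le> K * ?h ^ n"
          using that h1(2,3) pts_height[OF pt(1)] pts_height[OF pt(2)] K(1) by (intro mult_left_mono power_mono) auto
        then show ?thesis using K(2)[OF that(1), of c] that(2) pt by fastforce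
      qed
      have hn: "1 \<le> ?h ^ (2 * n)" "?h ^ n \<le> ?h ^ (2 * n)" "?h ^ n * ?h ^ n = ?h ^ (2 * n)"
        using h1 by (simp_all add: one_le_power power_increasing power_add[symmetric] mult_2)
      have "\<bar>\<Sum>A\<in>Pow L - {{}, L}. gsgn A (L - A) * coef (U s) A * coef (U t) (L - A)\<bar>
          \<le> (\<Sum>A\<in>Pow L - {{}, L}. (K * ?h ^ n) * (K * ?h ^ n))"
      proof (rule order_trans[OF sum_abs sum_mono])
        fix A assume "A \<in> Pow L - {{}, L}"
        then have "A \<subset> L" "L - A \<subset> L" by auto
        then show "\<bar>gsgn A (L - A) * coef (U s) A * coef (U t) (L - A)\<bar> \<le> (K * ?h ^ n) * (K * ?h ^ n)"
          unfolding abs_mult abs_gsgn using b K(1) h1 by (simp only: mult_1_left) (intro mult_mono; simp)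
      qed
      also have "\<dots> = m * (K * K) * ?h ^ (2 * n)"
        unfolding hn(3)[symmetric] by (simp add: m_def mult_ac)
      finally have S: "\<bar>\<Sum>A\<in>Pow L - {{}, L}. gsgn A (L - A) * coef (U s) A * coef (U t) (L - A)\<bar>
          \<le> m * (K * K) * ?h ^ (2 * n)" .
      have VU: "\<bar>coef (V a * U c) L\<bar> \<le> (Kv + m * (Kv * K)) * ?h ^ (2 * n)" if c: "c = s \<or> c = t" for a c
      proof -
        have "\<bar>\<Sum>A\<in>Pow L - {{}, L}. gsgn A (L - A) * coef (V a) A * coef (U c) (L - A)\<bar>
          \<le> (\<Sum>A\<in>Pow L - {{}, L}. Kv * (K * ?h ^ (2 * n)))"
        proof (rule order_trans[OF sum_abs sum_mono])
          fix A assume "A \<in> Pow L - {{}, L}"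
          then have A: "A \<subseteq> L" "L - A \<subset> L" by auto
          have "\<bar>coef (U c) (L - A)\<bar> \<le> K * ?h ^ (2 * n)"
            using b[OF A(2) c] mult_left_mono[OF hn(2) K(1)] by linarith
          then show "\<bar>gsgn A (L - A) * coef (V a) A * coef (U c) (L - A)\<bar> \<le> Kv * (K * ?h ^ (2 * n))"
            unfolding abs_mult abs_gsgn using Kv[OF A(1)] Kv0 by (simp only: mult_1_left) (intro mult_mono; simp)
        qed
        also have "\<dots> = m * (Kv * K) * ?h ^ (2 * n)" by (simp add: m_def)
        finally have "\<bar>coef (V a * U c) L\<bar> \<le> \<bar>coef (V a) L\<bar> + m * (Kv * K) * ?h ^ (2 * n)"
          using coef_mult_split[OF psubset(1) False, of "V a" "U c"] by simp
        moreover have "\<bar>coef (V a) L\<bar> \<le> Kv * ?h ^ (2 * n)"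
          using Kv[of L a] mult_left_mono[OF hn(1) Kv0] by simp
        ultimately show ?thesis by (simp add: distrib_right)
      qed
      have frac: "\<bar>x s / x (s + t)\<bar> \<le> 1" "\<bar>x t / x (s + t)\<bar> \<le> 1"
        using next_ge'[OF d] X_pos[of "s + t"] X_pos[of s] X_pos[of t] by simp_all
      have q: "0 \<le> 1 + back_ratio s t" "1 + back_ratio s t \<le> 2"
        using back_ratio[OF d] ratio_bound by linarith+
      have "\<bar>(1 + back_ratio s t) * (\<Sum>A\<in>Pow L - {{}, L}. gsgn A (L - A) * coef (U s) A * coef (U t) (L - A))\<bar>
          \<le> 2 * (m * (K * K) * ?h ^ (2 * n))"
        unfolding abs_mult using S q by (intro mult_mono) auto
      moreover have "\<bar>x t / x (s + t) * coef (V s * U t) L\<bar> \<le> 1 * ((Kv + m * (Kv * K)) * ?h ^ (2 * n))"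
        "\<bar>x s / x (s + t) * coef (V t * U s) L\<bar> \<le> 1 * ((Kv + m * (Kv * K)) * ?h ^ (2 * n))"
        unfolding abs_mult by (rule mult_mono[OF frac(2) VU] mult_mono[OF frac(1) VU]; simp)+
      moreover have "K1 * ?h ^ (2 * n) = 2 * (m * (K * K) * ?h ^ (2 * n)) + 2 * ((Kv + m * (Kv * K)) * ?h ^ (2 * n))"
        unfolding K1_def by (simp only: distrib_right mult.assoc)
      ultimately show ?thesis
        unfolding U_coef_rec[OF d psubset(1) False] by linarith
    qed
    have "0 \<le> K1" unfolding K1_def using m0 K(1) Kv0 by simp
    then obtain K2 n2 where "0 \<le> K2"
      "\<And>s t. farey_desc s0 t0 s t \<Longrightarrow> \<bar>coef (U s) L\<bar> \<le> K2 * height s ^ n2 \<and> \<bar>coef (U t) L\<bar> \<le> K2 * height t ^ n2"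
      using perturbation_bound[of "\<lambda>s. coef (U s) L" K1 "2 * n"] rec U_even by metis
    then show ?thesis unfolding pts_def by blast
  qed
qed

end

section \<open>Exponential decay of the summands and of the edge quantity\<close>

context good_super_tree
begin

definition edges :: "((int \<times> int) \<times> (int \<times> int)) set" where
  "edges = {(s, t). farey_desc s0 t0 s t}"

definition edge_height :: "(int \<times> int) \<times> (int \<times> int) \<Rightarrow> real" where
  "edge_height e = height (fst e + snd e)"

sublocale P: growth N pts height
  by standard (rule pts_height)

sublocale E: growth N edges edge_height
  by standard (auto simp: edges_def edge_height_def simp del: height_add intro!: pts_height farey_desc_pts(3))

text \<open>The height of an edge is that of its new vertex, which dominates the heights of both
  ends; so bounds at vertices become bounds at edges.\<close>

lemma E_tame_pullback:
  assumes "P.tame F" "\<And>e. e \<in> edges \<Longrightarrow> a e = fst e \<or> a e = snd e \<or> a e = fst e + snd e"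
  shows "E.tame (\<lambda>e. F (a e))"
proof -
  obtain K j where K: "0 \<le> K" "\<And>s. s \<in> pts \<Longrightarrow> nrm N (F s) \<le> K * height s ^ j"
    using assms(1) unfolding P.tame_def by blast
  show ?thesis
  proof (rule E.tameI[OF K(1)])
    fix e assume e: "e \<in> edges"
    obtain s t where st: "e = (s, t)" by (cases e)
    note pt = farey_desc_pts[of s t]
    have d: "farey_desc s0 t0 s t" using e st by (simp add: edges_def)
    have h: "1 \<le> height s" "1 \<le> height t" using pts_height pt d by auto
    have a: "a e \<in> pts" "height (a e) \<le> edge_height e" "0 \<le> height (a e)"
      using assms(2)[OF e] pt[OF d] h st by (auto simp: edge_height_def)
    show "nrm N (F (a e)) \<le> K * edge_height e ^ j"
      using K(2)[OF a(1)] mult_left_mono[OF power_mono[OF a(2,3)] K(1), of j] by linarith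
  qed
qed

text \<open>A lower bound for x strictly above 2, uniform on the subtree. It keeps the normalised
  discriminant 1 - 4 / x^2 away from 0.\<close>

definition x_min :: real where "x_min = 2 * exp rate"

lemma x_min: "2 < x_min" "s \<in> pts \<Longrightarrow> x_min \<le> x s"
proof -
  show "2 < x_min" using rate_pos by (simp add: x_min_def)
  assume s: "s \<in> pts"
  have "rate * 1 \<le> rate * height s"
    using rate_pos pts_height[OF s] by (intro mult_left_mono) auto
  then have "exp rate \<le> exp (rate * height s)" by simp
  moreover have "2 * exp (rate * height s) \<le> x s"
    using s growth_le unfolding pts_def by blast
  ultimately show "x_min \<le> x s" unfolding x_min_def by linarith
qed

lemma pts_gt_2: "s \<in> pts \<Longrightarrow> 2 < x s"
  using x_min by fastforce

lemma tame_U: "P.tame U"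
proof -
  obtain K n where K: "0 \<le> K" "\<And>L s. L \<in> Pow {1..N} \<Longrightarrow> s \<in> pts \<Longrightarrow> \<bar>coef (U s) L\<bar> \<le> K * height s ^ n"
    using uniform_bound[of "Pow {1..N}"] U_coef_bound by (metis finite_Pow_iff finite_atLeastAtMost finite_subset PowD)
  show ?thesis
  proof (rule P.tameI)
    fix s assume "s \<in> pts"
    then have "nrm N (U s) \<le> (\<Sum>L\<in>Pow {1..N}. K * height s ^ n)"
      unfolding nrm_def using K(2) by (intro sum_mono)
    then show "nrm N (U s) \<le> real (card (Pow {1..N})) * K * height s ^ n" by simp
  qed (use K in simp)
qed

lemma tame_inverse_U: "P.tame (\<lambda>s. inverse (U s))"
  by (rule P.tame_inverse[OF tame_U, of 1]) auto

lemma tame_V: "P.tame V"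
  by (rule P.tame_bounded[of _ "nrm N v"]) (metis V_cases nrm_minus order_refl)

lemma inverse_x_le: "s \<in> pts \<Longrightarrow> \<bar>1 / x s\<bar> \<le> 1"
  using pts_gt_2[of s] by simp

definition Yn :: "int \<times> int \<Rightarrow> evg" where "Yn s = U s - (1 / x s) *\<^sub>R V s"

lemma Y_eq: "Y s = x s *\<^sub>R Yn s"
  by (simp add: Y_def Yn_def U_def scaleR_diff_right)

lemma tame_Yn: "P.tame Yn"
  unfolding Yn_def
  by (intro P.tame_diff[OF tame_U] P.tame_scale[OF tame_V]) (rule inverse_x_le)

text \<open>The square root is homogeneous. Divided by x^2, the radicand becomes a tame family with
  body bounded below, and its nilpotent part relative to its body is unchanged by this
  scaling.\<close>

lemma tame_sqrt: "P.tame (\<lambda>s. (1 / x s) *\<^sub>R efun sqrt (Y s * Y s - of_real 4))"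
proof -
  define F where "F = (\<lambda>s. Yn s * Yn s - (4 / (x s * x s)) *\<^sub>R 1)"
  have FY: "F s = (1 / (x s * x s)) *\<^sub>R (Y s * Y s - of_real 4)" for s
    by (simp add: F_def Y_eq of_real_def scaleR_diff_right)
  define c where "c = 1 - 4 / (x_min * x_min)"
  have "2 * 2 < x_min * x_min" using x_min(1) by (intro mult_strict_mono) auto
  then have c: "0 < c" by (simp add: c_def)
  have bF: "body (F s) = 1 - 4 / (x s * x s)" for s by (simp add: F_def Yn_def)
  have tF: "P.tame F"
    unfolding F_def
  proof (intro P.tame_diff P.tame_mult tame_Yn P.tame_scale[OF P.tame_const, where C = 1])
    fix s assume "s \<in> pts"
    then have "2 * 2 < x s * x s" using pts_gt_2[of s] by (intro mult_strict_mono) auto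
    then show "\<bar>4 / (x s * x s)\<bar> \<le> 1" by simp
  qed
  have "P.tame (\<lambda>s. fps_eval ((1 / body (F s)) *\<^sub>R nilpart (F s)) (fps_binomial (1/2)))"
  proof (rule P.tame_rescaled_fps_eval[OF tF c])
    fix s assume "s \<in> pts"
    then have "x_min * x_min \<le> x s * x s" using x_min(1) x_min(2)[of s] by (intro mult_mono) auto
    then show "c \<le> body (F s)"
      unfolding bF c_def using x_min(1) pts_gt_2[OF \<open>s \<in> pts\<close>]
      by (intro diff_left_mono divide_left_mono mult_pos_pos) auto
  qed
  then show ?thesis
  proof (rule P.tame_mono[where C = 1])
    fix s assume s: "s \<in> pts"
    let ?A = "Y s * Y s - of_real 4"
    have b: "0 < body ?A" using disc_pos[OF pts_gt_2[OF s]] by simp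
    have "(1 / body (F s)) *\<^sub>R nilpart (F s) = (1 / body ?A) *\<^sub>R nilpart ?A"
      unfolding FY nilpart_scaleR by simp
    moreover have "\<bar>(1 / x s) * sqrt (body ?A)\<bar> \<le> 1"
    proof -
      have "sqrt (body ?A) \<le> sqrt (x s * x s)" by (rule real_sqrt_le_mono) simp
      also have "\<dots> = x s" using pts_gt_2[OF s] by simp
      finally have "sqrt (body ?A) \<le> x s" .
      moreover have "0 \<le> sqrt (body ?A)" using b by simp
      ultimately show ?thesis using pts_gt_2[OF s] by (simp only: abs_mult abs_of_nonneg) simp
    qed
    ultimately show "nrm N ((1 / x s) *\<^sub>R efun sqrt ?A)
        \<le> 1 * nrm N (fps_eval ((1 / body (F s)) *\<^sub>R nilpart (F s)) (fps_binomial (1/2)))"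
      unfolding efun_sqrt_eq[OF b] scaleR_scaleR nrm_scaleR by (metis mult_right_mono nrm_nonneg)
  qed simp
qed

definition rhon :: "int \<times> int \<Rightarrow> evg" where "rhon s = x s *\<^sub>R rho s"

lemma rho_eq: "rho s = (1 / x s) *\<^sub>R rhon s"
  by (simp add: rhon_def)

text \<open>\<open>rhon s\<close> is the inverse of R s / x s, a tame family whose body is at least
  1/2; thus rho itself is of size 1 / x up to polynomial factors.\<close>

lemma tame_rhon: "P.tame rhon"
proof -
  define G where "G = (\<lambda>s. (1/2) *\<^sub>R (Yn s + (1 / x s) *\<^sub>R efun sqrt (Y s * Y s - of_real 4)))"
  have G: "G s = (1 / x s) *\<^sub>R R s" for s
    by (simp add: G_def R_def Y_eq[of s, symmetric] scaleR_add_right) (simp add: Y_eq)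
  have bG: "1/2 \<le> body (G s)" if "s \<in> pts" for s
    using R_body[OF pts_gt_2[OF that]] X_pos[of s] unfolding G by (simp add: field_simps)
  have tG: "P.tame G"
    unfolding G_def by (intro P.tame_scale[where C = "1/2"] P.tame_add tame_Yn tame_sqrt) simp
  have "P.tame (\<lambda>s. inverse (G s))" by (rule P.tame_inverse[OF tG, of "1/2"]) (use bG in auto)
  then show ?thesis
  proof (rule P.tame_cong)
    fix s assume s: "s \<in> pts"
    have "body (R s) \<noteq> 0" using R_body[OF pts_gt_2[OF s]] pts_gt_2[OF s] by auto
    then show "rhon s = inverse (G s)" unfolding G rhon_def rho_def by (simp add: evg_inverse_scaleR)
  qed
qed

lemma tame_rho: "P.tame rho"
  unfolding rho_eq[abs_def] by (rule P.tame_scale[OF tame_rhon]) (rule inverse_x_le)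

lemma tame_T: "P.tame (\<lambda>s. x s *\<^sub>R T s)"
proof (rule P.tame_cong)
  show "P.tame (\<lambda>s. (2 *\<^sub>R rho s + V s) * inverse (U s))"
    by (intro P.tame_mult P.tame_add P.tame_scale[OF tame_rho, where C = 2] tame_V tame_inverse_U) simp
qed (simp add: T_def inverse_X)

text \<open>Both X (s - t) / X t and rho s are nearly roots of the quadratic r^2 - Y s r + 1.\<close>

lemma D_estimate:
  assumes ab: "\<And>e. e \<in> edges \<Longrightarrow> (a e, b e) = e \<or> (b e, a e) = e"
  shows "E.tame (\<lambda>e. x (b e) *\<^sub>R D (a e) (b e))"
proof -
  define c where "c = (\<lambda>e. a e + b e)"
  have pa: "E.tame (\<lambda>e. F (a e))" "E.tame (\<lambda>e. F (b e))" "E.tame (\<lambda>e. F (c e))" if "P.tame F" for F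
  proof -
    have "a e = fst e \<or> a e = snd e \<or> a e = fst e + snd e"
      "b e = fst e \<or> b e = snd e \<or> b e = fst e + snd e"
      "c e = fst e \<or> c e = snd e \<or> c e = fst e + snd e" if "e \<in> edges" for e
    proof -
      obtain s t where "e = (s, t)" by (cases e)
      then show "a e = fst e \<or> a e = snd e \<or> a e = fst e + snd e"
        "b e = fst e \<or> b e = snd e \<or> b e = fst e + snd e"
        "c e = fst e \<or> c e = snd e \<or> c e = fst e + snd e"
        using ab[OF that] by (auto simp: c_def add.commute)
    qed
    then show "E.tame (\<lambda>e. F (a e))" "E.tame (\<lambda>e. F (b e))" "E.tame (\<lambda>e. F (c e))"
      using E_tame_pullback[OF that] by blast+
  qed
  have edge: "a e \<in> pts" "b e \<in> pts" "c e \<in> pts"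
    "X (c e) + X (a e - b e) = X (a e) * X (b e) - V (a e) * X (b e) - V (b e) * X (a e)"
    "X (c e) * X (a e - b e) = X (a e) * X (a e) + X (b e) * X (b e) + X (a e) * X (b e) * V (c e)"
    "back_quot (a e) (b e) \<le> back_quot s0 t0" if e: "e \<in> edges" for e
  proof -
    obtain s t where st: "e = (s, t)" "farey_desc s0 t0 s t" using e unfolding edges_def by blast
    have sym: "X (t - s) = X (s - t)" using X_even[of "s - t"] by simp
    then have sym': "back_quot t s = back_quot s t" by (simp add: back_quot_def mult.commute)
    note r = X_sum[OF farey_edge[OF st(2)]] X_prod[OF farey_edge[OF st(2)]] back_le[OF st(2)]
    show "a e \<in> pts" "b e \<in> pts" "c e \<in> pts"
      using ab[OF e] farey_desc_pts[OF st(2)] st(1) by (auto simp: c_def add.commute)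
    show "X (c e) + X (a e - b e) = X (a e) * X (b e) - V (a e) * X (b e) - V (b e) * X (a e)"
      "X (c e) * X (a e - b e) = X (a e) * X (a e) + X (b e) * X (b e) + X (a e) * X (b e) * V (c e)"
      "back_quot (a e) (b e) \<le> back_quot s0 t0"
      using ab[OF e] r st(1) by (auto simp: c_def sym sym' ac_simps)
  qed
  define xi where "xi = (\<lambda>e. X (a e - b e) * inverse (X (b e)))"
  \<comment> \<open>X (a - b) divided by the bodies at the two ends. The vertex a - b may lie
    outside \<open>pts\<close>, so its size is obtained from the sum relation.\<close>
  define w where "w = (\<lambda>e. U (a e) * U (b e) - (1 / x (a e)) *\<^sub>R (V (a e) * U (b e))
      - (1 / x (b e)) *\<^sub>R (V (b e) * U (a e)) - (x (c e) / (x (a e) * x (b e))) *\<^sub>R U (c e))"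
  have w: "X (a e - b e) = (x (a e) * x (b e)) *\<^sub>R w e" if "e \<in> edges" for e
  proof -
    have "X (a e - b e) = X (a e) * X (b e) - V (a e) * X (b e) - V (b e) * X (a e) - X (c e)"
      using edge(4)[OF that] by (simp add: algebra_simps)
    then show ?thesis unfolding w_def by (simp add: scaleR_diff_right U_def)
  qed
  have cratio: "\<bar>x (c e) / (x (a e) * x (b e))\<bar> \<le> 1" if "e \<in> edges" for e
  proof -
    have "x (c e) + x (a e - b e) = x (a e) * x (b e)"
      using arg_cong[OF edge(4)[OF that], of body] by simp
    then have "x (c e) \<le> x (a e) * x (b e)" using X_pos[of "a e - b e"] by linarith
    then show ?thesis using X_pos[of "c e"] X_pos[of "a e"] X_pos[of "b e"] by simp
  qed
  have tw: "E.tame w"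
    unfolding w_def
    by (intro E.tame_diff E.tame_mult E.tame_scale[where C = 1] pa tame_U tame_V)
       (use inverse_x_le edge cratio in auto)
  have xi: "xi e = x (a e) *\<^sub>R (w e * inverse (U (b e)))" if "e \<in> edges" for e
    unfolding xi_def w[OF that] inverse_X by simp
  have txi: "E.tame (\<lambda>e. w e * inverse (U (b e)))"
    by (intro E.tame_mult tw pa tame_inverse_U)
  \<comment> \<open>The value of Y r - r^2 - 1 at r = xi, rescaled by x b / (x a)^2.\<close>
  define delta where "delta = (\<lambda>e. (1 / x (b e)) *\<^sub>R (U (a e) * U (a e) * (inverse (U (b e)) * inverse (U (b e))))
      + (1 / x (a e)) *\<^sub>R (U (a e) * V (c e) * inverse (U (b e)))
      + V (b e) * U (a e) * inverse (U (b e)) * (w e * inverse (U (b e))))"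
  have tdelta: "E.tame delta"
    unfolding delta_def
    by (intro E.tame_add E.tame_mult E.tame_scale[where C = 1] pa tame_U tame_V tw tame_inverse_U)
       (use inverse_x_le edge in auto)
  \<comment> \<open>Y - xi - rho divided by x a, where Y - rho = R: the normalised distance of xi
    from the large root.\<close>
  define Q where "Q = (\<lambda>e. Yn (a e) - w e * inverse (U (b e)) - (1 / (x (a e) * x (a e))) *\<^sub>R rhon (a e))"
  have tQ: "E.tame Q"
    unfolding Q_def
  proof (intro E.tame_diff E.tame_scale[where C = 1] pa tame_Yn txi tame_rhon)
    fix e assume "e \<in> edges"
    then have "2 < x (a e)" by (intro pts_gt_2 edge(1))
    then have "1 * 1 \<le> x (a e) * x (a e)" by (intro mult_mono) auto
    then show "\<bar>1 / (x (a e) * x (a e))\<bar> \<le> 1" by simp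
  qed
  \<comment> \<open>From the leading 1, xi removes at most the back quotient of the root and rho at
    most 2 / x^2 \<le> 1/2. Goodness of the root makes the difference positive.\<close>
  have bQ: "1/2 - back_quot s0 t0 \<le> body (Q e)" if e: "e \<in> edges" for e
  proof -
    let ?a = "x (a e)"
    note g = pts_gt_2[OF edge(1)[OF e]]
    have bw: "body (w e) = back_quot (a e) (b e)"
      using arg_cong[OF w[OF e], of body] by (simp add: back_quot_def)
    have "body (rhon (a e)) = ?a * inverse (body (R (a e)))" by (simp add: rhon_def rho_def)
    also have "\<dots> \<le> ?a * inverse (?a / 2)"
      using R_body[OF g] g by (intro mult_left_mono le_imp_inverse_le) auto
    also have "\<dots> = 2" using g by simp
    finally have "body (rhon (a e)) \<le> 2" .
    then have "1 / (?a * ?a) * body (rhon (a e)) \<le> 1 / (?a * ?a) * 2"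
      using g by (intro mult_left_mono) auto
    also have "\<dots> \<le> 1 / 2" using mult_mono[of 2 ?a 2 ?a] g by (simp add: field_simps)
    finally show ?thesis using edge(6)[OF e] bw by (simp add: Q_def Yn_def)
  qed
  have DQ: "x (b e) *\<^sub>R D (a e) (b e) =
      inverse (U (a e)) * delta e * inverse (Q e) - (1 / x (b e)) *\<^sub>R (rhon (b e) * inverse (U (b e)))"
    if e: "e \<in> edges" for e
  proof -
    let ?A = "X (a e)" and ?B = "X (b e)" and ?i = "inverse (X (b e))" and ?W = "X (a e - b e)"
    let ?Q = "Y (a e) - xi e - rho (a e)"
    let ?d = "?A * ?A * (?i * ?i) + ?A * V (c e) * ?i + V (b e) * ?A * ?i * xi e"
    note g = pts_gt_2[OF edge(1)[OF e]]
    have nz: "body (Q e) \<noteq> 0" using bQ[OF e] good by linarith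
    have Q: "?Q = x (a e) *\<^sub>R Q e"
      by (simp add: Q_def xi[OF e] Y_eq rho_eq scaleR_diff_right)
    have "X (c e) = Y (a e) * ?B - V (b e) * ?A - ?W"
      using edge(4)[OF e] by (simp add: Y_def algebra_simps)
    then have "(Y (a e) * ?B - V (b e) * ?A - ?W) * ?W * (?i * ?i) =
        (?A * ?A + ?B * ?B + ?A * ?B * V (c e)) * (?i * ?i)"
      using edge(5)[OF e] by simp
    then have "Y (a e) * xi e * (?B * ?i) - V (b e) * ?A * ?i * xi e - xi e * xi e =
        ?A * ?A * (?i * ?i) + (?B * ?i) * (?B * ?i) + ?A * V (c e) * ?i * (?B * ?i)"
      unfolding xi_def by (simp only: algebra_simps)
    then have q1: "Y (a e) * xi e - xi e * xi e - 1 = ?d" by (simp add: algebra_simps)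
    have "(Y (a e) - rho (a e)) * rho (a e) = 1"
      using R_rho[OF g] by (metis add_diff_cancel_right')
    \<comment> \<open>Because rho is an exact root, the residue at xi is a difference of two values
      of the quadratic and factors.\<close>
    then have "(xi e - rho (a e)) * ?Q = ?d"
      unfolding q1[symmetric] by (simp add: algebra_simps)
    moreover have "?Q * inverse ?Q = 1"
      by (rule evg_right_inverse) (use Q nz in simp)
    ultimately have "xi e - rho (a e) = ?d * inverse ?Q"
      by (metis mult.assoc mult_1_right)
    moreover have "D (a e) (b e) = inverse ?A * (xi e - rho (a e)) - rho (b e) * ?i"
      by (simp add: D_def xi_def algebra_simps)
    ultimately have "D (a e) (b e) = inverse ?A * (?d * inverse ?Q) - rho (b e) * ?i" by simp
    also have "inverse ?Q = (1 / x (a e)) *\<^sub>R inverse (Q e)"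
      unfolding Q using nz by (simp add: evg_inverse_scaleR)
    also have "?d = (x (a e) * x (a e) / x (b e)) *\<^sub>R delta e"
      unfolding delta_def xi[OF e] inverse_X by (simp add: U_def scaleR_add_right)
    finally show ?thesis
      by (simp add: inverse_X rho_eq scaleR_diff_right mult.assoc)
  qed
  have "E.tame (\<lambda>e. inverse (U (a e)) * delta e * inverse (Q e)
      - (1 / x (b e)) *\<^sub>R (rhon (b e) * inverse (U (b e))))"
    by (intro E.tame_diff E.tame_mult E.tame_scale[where C = 1] pa tame_inverse_U tame_rhon tdelta
        E.tame_inverse[OF tQ, of "1/2 - back_quot s0 t0"])
       (use inverse_x_le edge bQ good in auto)
  then show ?thesis by (rule E.tame_cong) (rule DQ)
qed

lemma D_sym: "D s t = D t s"
  using X_even[of "s - t"] by (simp add: D_def mult_ac)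

lemma has_sum_good:
  assumes L: "L \<subseteq> {1..N}"
  shows "((\<lambda>c. coef (T c) L) has_sum coef (D s0 t0) L) (farey_cone s0 t0)"
proof -
  obtain K1 j1 where K1: "0 \<le> K1" "\<And>s. s \<in> pts \<Longrightarrow> nrm N (x s *\<^sub>R T s) \<le> K1 * height s ^ j1"
    using tame_T unfolding P.tame_def by blast
  have "E.tame (\<lambda>e. x (snd e) *\<^sub>R D (fst e) (snd e))" by (rule D_estimate) simp
  then obtain K2 j2 where K2: "0 \<le> K2"
    "\<And>e. e \<in> edges \<Longrightarrow> nrm N (x (snd e) *\<^sub>R D (fst e) (snd e)) \<le> K2 * edge_height e ^ j2"
    unfolding E.tame_def by blast
  have "E.tame (\<lambda>e. x (fst e) *\<^sub>R D (snd e) (fst e))" by (rule D_estimate) simp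
  then obtain K3 j3 where K3: "0 \<le> K3"
    "\<And>e. e \<in> edges \<Longrightarrow> nrm N (x (fst e) *\<^sub>R D (snd e) (fst e)) \<le> K3 * edge_height e ^ j3"
    unfolding E.tame_def by blast
  \<comment> \<open>The higher end of an edge has at least half the height h of the new vertex, so x
    there is at least exp(rate * h / 2) = exp(2 k h). One factor exp(k h) pays for the polynomial,
    the other is the decay.\<close>
  define k where "k = rate / 4"
  have k: "0 < k" using rate_pos by (simp add: k_def)
  define K where "K = K1 + K2 + K3"
  define j where "j = j1 + j2 + j3"
  obtain M where M: "0 \<le> M" "\<And>h. 0 \<le> h \<Longrightarrow> h ^ j \<le> M * exp (k * h)"
    using power_le_exp[OF k, of j] by blast
  have decay: "\<bar>coef Z L\<bar> \<le> K * M * exp (- k * h)"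
    if c: "nrm N (c *\<^sub>R Z) \<le> K' * h ^ j'" "exp (2 * k * h) \<le> c"
      and "0 \<le> K'" "K' \<le> K" "j' \<le> j" "1 \<le> h" for Z c K' j' h
  proof -
    have c0: "0 < c" using c(2) exp_gt_zero[of "2 * k * h"] by linarith
    have "exp (2 * k * h) * \<bar>coef Z L\<bar> \<le> c * nrm N Z"
      using c(2) abs_coef_le_nrm[OF L] c0 by (intro mult_mono) auto
    also have "\<dots> \<le> K' * h ^ j'" using c(1) c0 by simp
    also have "\<dots> \<le> K * h ^ j" using that by (intro mult_mono power_increasing) auto
    also have "\<dots> \<le> K * (M * exp (k * h))" using M(2)[of h] that by (intro mult_left_mono) auto
    finally have "exp (2 * k * h) * \<bar>coef Z L\<bar> \<le> K * M * exp (k * h)" by simp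
    also have "\<dots> = exp (2 * k * h) * (K * M * exp (- k * h))"
      by (simp add: mult.left_commute flip: exp_add)
    finally show ?thesis by simp
  qed
  have K0: "0 \<le> K" "K1 \<le> K" "K2 \<le> K" "K3 \<le> K" and jj: "j1 \<le> j" "j2 \<le> j" "j3 \<le> j"
    using K1(1) K2(1) K3(1) by (simp_all add: K_def j_def)
  have grow: "exp (2 * k * h) \<le> x s" if "s \<in> pts" "h \<le> 2 * height s" for s h
  proof -
    have "rate * (h / 2) \<le> rate * height s" using that(2) rate_pos by (intro mult_left_mono) auto
    then have "exp (2 * k * h) \<le> exp (rate * height s)" by (simp add: k_def)
    moreover have "2 * exp (rate * height s) \<le> x s"
      using that(1) growth_le unfolding pts_def by blast
    ultimately show ?thesis using exp_gt_zero[of "rate * height s"] by linarith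
  qed
  show ?thesis
  proof (rule tree_has_sum[OF root k, of "K * M"])
    fix s t assume d: "farey_desc s0 t0 s t"
    note pt = farey_desc_pts[OF d]
    show "coef (D s t) L = coef (D s (s + t)) L + coef (D (s + t) t) L + coef (T (s + t)) L"
      using D_split[OF farey_edge[OF d]] by simp
    show "\<bar>coef (T (s + t)) L\<bar> \<le> K * M * exp (- k * height (s + t))"
      by (rule decay[OF K1(2)[OF pt(3)] grow[OF pt(3)] K1(1) K0(2) jj(1) pts_height[OF pt(3)]])
         (use pts_height[OF pt(3)] in linarith)
    have e: "(s, t) \<in> edges" using d by (simp add: edges_def)
    have h1: "1 \<le> height (s + t)" by (rule pts_height[OF pt(3)])
    show "\<bar>coef (D s t) L\<bar> \<le> K * M * exp (- k * height (s + t))"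
    \<comment> \<open>The decay comes from the value at the higher end; hence
      \<open>D_estimate\<close> is used in both orders.\<close>
    proof (cases "height s \<le> height t")
      case True
      then show ?thesis
        using K2(2)[OF e] by (intro decay[OF _ grow[OF pt(2)] K2(1) K0(3) jj(2) h1]) (auto simp: edge_height_def)
    next
      case False
      then show ?thesis
        using K3(2)[OF e] by (intro decay[OF _ grow[OF pt(1)] K3(1) K0(4) jj(3) h1]) (auto simp: edge_height_def D_sym)
    qed
  qed (use K0 M in simp)
qed

end

context super_tree
begin

text \<open>By \<open>D_split\<close> the identity for an edge follows from those of its two
  children. \<open>edge_induct\<close> therefore reduces it to good edges, each taken as the root of
  its own subtree.\<close>

lemma has_sum_cone:
  assumes "farey_edge s t" and L: "L \<subseteq> {1..N}"
  shows "((\<lambda>c. coef (T c) L) has_sum coef (D s t) L) (farey_cone s t)"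
  using assms(1)
proof (induction rule: edge_induct)
  case (good s t)
  interpret good_super_tree N X V v s t
    by unfold_locales (use good in auto)
  show ?case by (rule has_sum_good[OF L])
next
  case (split s t)
  note dj = farey_cone_disjoint[OF farey_edge_coords(1)[OF split(1)]]
  have "((\<lambda>c. coef (T c) L) has_sum (coef (D s (s + t)) L + coef (D (s + t) t) L))
      (farey_cone s (s + t) \<union> farey_cone (s + t) t)"
    by (rule has_sum_Un_disjoint[OF split(2,3) dj(2)])
  then have "((\<lambda>c. coef (T c) L) has_sum (coef (T (s + t)) L + (coef (D s (s + t)) L + coef (D (s + t) t) L)))
      (farey_cone s t)"
    unfolding farey_cone_split[of s t] by (rule has_sum_insert[OF dj(1)])
  then show ?case by (simp add: D_split[OF split(1)] algebra_simps)
qed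

end

section \<open>Transfer to the coefficient representation\<close>

definition supported :: "nat \<Rightarrow> evg \<Rightarrow> bool" where
  "supported N x \<longleftrightarrow> (\<forall>L. coef x L \<noteq> 0 \<longrightarrow> L \<subseteq> {1..N})"

lemma supported_add: "supported N x \<Longrightarrow> supported N y \<Longrightarrow> supported N (x + y)"
  and supported_diff: "supported N x \<Longrightarrow> supported N y \<Longrightarrow> supported N (x - y)"
  unfolding supported_def coef_simps by (metis add_0 diff_0_right)+

lemma supported_scaleR: "supported N x \<Longrightarrow> supported N (c *\<^sub>R x)"
  unfolding supported_def coef_simps by (metis mult_zero_right)

lemma supported_of_real: "supported N (of_real c)"
  by (simp add: supported_def coef_of_real)

lemma supported_1: "supported N 1"
  by (simp add: supported_def coef_one)

lemma supported_mult:
  assumes "supported N x" "supported N y" shows "supported N (x * y)"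
  unfolding supported_def
proof (intro allI impI)
  fix L assume "coef (x * y) L \<noteq> 0"
  then obtain A where "A \<subseteq> L" "coef x A \<noteq> 0" "coef y (L - A) \<noteq> 0"
    unfolding times_evg.rep_eq by (rule gmul_nonzeroE)
  then have "A \<subseteq> {1..N}" "L - A \<subseteq> {1..N}" using assms unfolding supported_def by auto
  then show "L \<subseteq> {1..N}" by blast
qed

lemma supported_power: "supported N x \<Longrightarrow> supported N (x ^ k)"
  by (induction k) (auto intro: supported_1 supported_mult)

lemma supported_nilpart: "supported N x \<Longrightarrow> supported N (nilpart x)"
  unfolding nilpart_def by (intro supported_diff supported_of_real)

lemma supported_fps_eval:
  assumes "supported N x" shows "supported N (fps_eval x F)"
  unfolding supported_def
proof (intro allI impI)
  fix L assume L: "coef (fps_eval x F) L \<noteq> 0"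
  then have "finite L" using coef_infinite by blast
  then obtain k where "coef (x ^ k) L \<noteq> 0"
    using L by (auto simp: coef_fps_eval elim!: sum.not_neutral_contains_not_neutral)
  then show "L \<subseteq> {1..N}" using supported_power[OF assms] unfolding supported_def by blast
qed

lemma supported_efun: "supported N x \<Longrightarrow> supported N (efun f x)"
  unfolding efun_def by (intro supported_fps_eval supported_nilpart)

lemma supported_inverse: "supported N (x :: evg) \<Longrightarrow> supported N (inverse x)"
  unfolding inverse_evg_def by (rule supported_efun)

lemmas supported_intros = supported_add supported_diff supported_scaleR supported_of_real supported_1 supported_mult supported_power
  supported_efun supported_inverse

lemma gconst_coef: "gconst c = coef (of_real c)"
  by (rule ext) (simp add: gconst_def coef_of_real)

lemmas grass_ops_coef = plus_evg.rep_eq[symmetric] minus_evg.rep_eq[symmetric]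
  times_evg.rep_eq[symmetric] scaleR_evg.rep_eq[symmetric] gconst_coef

lemma gpow_coef: "gpow (coef x) k = coef (x ^ k)"
  by (induction k) (simp_all add: grass_ops_coef)

text \<open>The truncation at N and the one at \<open>card L\<close> agree: a relevant L lies in
  {1..N}, and powers of a nilpotent element beyond \<open>card L\<close> contribute nothing at
  L.\<close>

lemma gfun_coef:
  assumes "supported N x"
  shows "gfun N f (coef x) = coef (efun f x)"
proof (rule ext)
  fix L
  have b: "gbody (coef x) = body x" by (simp add: gbody_def body_def)
  have n: "gsub (coef x) (gconst (body x)) = coef (nilpart x)"
    by (simp add: grass_ops_coef nilpart_def)
  show "gfun N f (coef x) L = coef (efun f x) L"
  proof (cases "L \<subseteq> {1..N}")
    case True
    then have "finite L" "card L \<le> N" using finite_subset card_mono[of "{1..N}" L] by auto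
    then show ?thesis
      unfolding gfun_def b n gpow_coef efun_def by (subst coef_fps_eval_bound[where n = N]) auto
  next
    case False
    then have "coef (efun f x) L = 0" "coef (nilpart x ^ k) L = 0" for k
      using supported_efun[OF assms] supported_power[OF supported_nilpart[OF assms]] unfolding supported_def by blast+
    then show ?thesis unfolding gfun_def b n gpow_coef by simp
  qed
qed

lemma evg_inverse_mult:
  fixes x y :: evg assumes "body x \<noteq> 0" "body y \<noteq> 0"
  shows "inverse (x * y) = inverse x * inverse y"
proof (rule evg_inverse_unique)
  have "x * y * (inverse x * inverse y) = (x * inverse x) * (y * inverse y)" by (simp add: mult_ac)
  then show "x * y * (inverse x * inverse y) = 1" using assms by (simp add: evg_right_inverse)
qed

definition mterm :: "evg \<Rightarrow> evg \<Rightarrow> evg" where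
  "mterm x w = (let X = x - w; r = (1/2) *\<^sub>R (X + efun sqrt (X * X - of_real 4)); l = 2 *\<^sub>R efun ln r
     in inverse (efun exp l + 1) +
        ((1/4) *\<^sub>R w) * (efun sinh ((1/2) *\<^sub>R l) * inverse ((efun cosh ((1/2) *\<^sub>R l)) ^ 2)))"

text \<open>With r rho = 1 and r + rho = Y the summand is rho / Y + W (r - rho) / (2 Y^2). On the
  other side W^2 = 0 gives 1 / X = 1 / Y - W / Y^2, and W / Y = W (r + rho) / Y^2.\<close>

lemma (in super_tree) mterm_eq_T:
  assumes s: "2 < x s"
  shows "mterm (X s) (V s) = (1/2) *\<^sub>R T s"
proof -
  let ?r = "R s" and ?p = "rho s" and ?Y = "Y s" and ?w = "V s"
  have r0: "0 < body ?r" using R_body[OF s] s by linarith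
  note rr = R_rho[OF s]
  define iY where "iY = inverse ?Y"
  have iY: "?Y * iY = 1" unfolding iY_def by (rule evg_right_inverse) (use s in simp)
  have ip: "inverse ?r = ?p" by (simp add: rho_def)
  have "inverse (?r * ?r + 1) = ?p * iY"
  proof (rule evg_inverse_unique)
    have "?r * ?r + 1 = ?r * ?Y" using rr by (simp add: algebra_simps flip: rr(2))
    then have "(?r * ?r + 1) * (?p * iY) = (?r * ?p) * (?Y * iY)" by (simp add: mult_ac)
    then show "(?r * ?r + 1) * (?p * iY) = 1" using rr iY by simp
  qed
  moreover have "inverse (((1/2) *\<^sub>R (?r + ?p)) ^ 2) = 4 *\<^sub>R (iY * iY)"
  proof (rule evg_inverse_unique)
    have "?Y * ?Y * (iY * iY) = (?Y * iY) * (?Y * iY)" by (simp add: mult_ac)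
    then show "((1/2) *\<^sub>R (?r + ?p)) ^ 2 * (4 *\<^sub>R (iY * iY)) = 1"
      using rr iY by (simp add: power2_eq_square)
  qed
  ultimately have m: "mterm (X s) ?w = ?p * iY + (1/2) *\<^sub>R (?w * ((?r - ?p) * (iY * iY)))"
    using evg_exp_log[OF r0]
    unfolding mterm_def Let_def Y_def[symmetric] R_def[symmetric]
    by (simp add: ip)
  have w2: "?w * ?w = 0" by simp
  have "X s = ?Y + ?w" by (simp add: Y_def)
  then have "X s * (iY - ?w * iY * iY) = ?Y * iY + ?w * iY - ?w * iY * (?Y * iY) - (?w * ?w) * iY * iY"
    by (simp add: algebra_simps)
  then have "X s * (iY - ?w * iY * iY) = 1" using iY w2 by simp
  then have iX: "inverse (X s) = iY - ?w * iY * iY" by (rule evg_inverse_unique)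
  have "?w * iY = ?w * iY * (?Y * iY)" using iY by simp
  also have "\<dots> = ?w * (?r + ?p) * (iY * iY)" using rr(2) by (simp add: mult_ac)
  finally have wi: "?w * iY = ?w * (?r + ?p) * (iY * iY)" .
  have "T s = 2 *\<^sub>R (?p * iY) - 2 *\<^sub>R (?p * ?w * (iY * iY)) + ?w * iY - (?w * ?w) * (iY * iY)"
    unfolding T_def iX by (simp add: algebra_simps)
  also have "\<dots> = 2 *\<^sub>R (?p * iY) - 2 *\<^sub>R (?p * ?w * (iY * iY)) + ?w * (?r + ?p) * (iY * iY)"
    unfolding w2 wi by simp
  also have "\<dots> = 2 *\<^sub>R (?p * iY) + ?w * ((?r - ?p) * (iY * iY))"
    by (simp add: algebra_simps scaleR_2)
  finally show ?thesis unfolding m by (simp add: scaleR_add_right)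
qed

section \<open>From slopes to integer vectors\<close>

definition slope :: "int \<times> int \<Rightarrow> int \<times> int" where
  "slope s = (if s \<in> slopes then s else - s)"

lemma slope_minus_notin: "s \<in> slopes \<Longrightarrow> - s \<notin> slopes"
  by (auto simp: slopes_def)

lemma det2_simps [simp]: "det2 (- a) b = - det2 a b" "det2 a (- b) = - det2 a b"
  "det2 (a + b) c = det2 a c + det2 b c" "det2 c (a + b) = det2 c a + det2 c b"
  "det2 (a - b) c = det2 a c - det2 b c" "det2 c (a - b) = det2 c a - det2 c b" "det2 a a = 0"
  by (simp_all add: det2_def algebra_simps)

lemma det2_swap: "\<bar>det2 b a\<bar> = \<bar>det2 a b\<bar>"
  unfolding det2_def by (simp add: abs_minus_commute mult.commute)

lemma abs_det2_slope [simp]: "\<bar>det2 (slope a) b\<bar> = \<bar>det2 a b\<bar>" "\<bar>det2 a (slope b)\<bar> = \<bar>det2 a b\<bar>"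
  by (simp_all add: slope_def)

lemma slope_in_slopes:
  assumes "\<bar>det2 a b\<bar> = 1" shows "slope a \<in> slopes"
proof -
  have "coprime (fst a) (snd a)"
  proof (rule coprimeI)
    fix c assume "c dvd fst a" "c dvd snd a"
    then have "c dvd det2 a b" unfolding det2_def by simp
    then show "is_unit c" using assms by (metis dvd_abs_iff)
  qed
  moreover from this have "snd a = 0 \<Longrightarrow> fst a = 1 \<or> fst a = - 1" by (auto simp: abs_if split: if_splits)
  ultimately show ?thesis
    by (cases a) (auto simp: slope_def slopes_def split: if_splits)
qed

section \<open>The tree attached to a point of the super Teichmueller space\<close>

locale super_teich =
  fixes N lam W
  assumes sT: "sTeich N lam W"
begin

definition v :: evg where
  "v = (SOME v. supported N v \<and> v * v = 0 \<and> body v = 0 \<and>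
    (\<forall>e\<in>slopes. W e = coef v \<or> W e = coef (- v)))"

text \<open>The witness is \<theta> \<sigma>. An odd element anticommutes with itself, so \<theta>
  \<theta> = 0, and moving \<sigma> past \<theta> turns the square of \<theta> \<sigma> into -
  \<theta> \<theta> \<sigma> \<sigma> = 0.\<close>

lemma v_props: "supported N v" "v * v = 0" "body v = 0" "e \<in> slopes \<Longrightarrow> W e = coef v \<or> W e = coef (- v)"
proof -
  have "\<exists>\<theta> \<sigma>. odd_el N \<theta> \<and> odd_el N \<sigma> \<and>
      (\<forall>e\<in>slopes. W e = gmul \<theta> \<sigma> \<or> W e = gscale (-1) (gmul \<theta> \<sigma>))"
    using sT unfolding sTeich_def ideal_arcs_def by (elim conjE)
  then obtain \<theta> \<sigma> where odd: "odd_el N \<theta>" "odd_el N \<sigma>"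
    and W: "\<forall>e\<in>slopes. W e = gmul \<theta> \<sigma> \<or> W e = gscale (-1) (gmul \<theta> \<sigma>)"
    by (elim exE conjE)
  have oc: "odd (card L) \<and> L \<subseteq> {1..N}" if "y L \<noteq> 0" "odd_el N y" for y L
    using that unfolding odd_el_def gr_carrier_def by blast
  have anti: "gmul y z = gscale (-1) (gmul z y)" if "odd_el N y" "odd_el N z" for y z
  proof (rule gmul_swap)
    fix A B assume "z A \<noteq> 0" "y B \<noteq> 0"
    then have "odd (card A * card B)" using oc that by auto
    then show "(- 1) ^ (card A * card B) = (- 1 :: real)" by simp
  qed
  have sq: "gmul \<theta> \<theta> = gconst 0"
  proof (rule ext)
    fix L show "gmul \<theta> \<theta> L = gconst 0 L"
      using fun_cong[OF anti[OF odd(1) odd(1)], of L] by (simp add: gscale_def gconst_def)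
  qed
  have "gmul (gmul \<theta> \<sigma>) (gmul \<theta> \<sigma>) = gmul \<theta> (gmul (gmul \<sigma> \<theta>) \<sigma>)"
    by (simp only: gmul_assoc)
  also have "\<dots> = gscale (-1) (gmul (gmul \<theta> \<theta>) (gmul \<sigma> \<sigma>))"
    unfolding anti[OF odd(2,1)] gmul_gscale by (simp only: gmul_assoc)
  also have "\<dots> = gconst 0" unfolding sq by (rule ext) (simp add: gmul_def gscale_def gconst_def)
  finally have sq': "gmul (gmul \<theta> \<sigma>) (gmul \<theta> \<sigma>) = gconst 0" .
  have prod_even: "finite L \<and> even (card L) \<and> L \<subseteq> {1..N} \<and> L \<noteq> {}" if L: "gmul \<theta> \<sigma> L \<noteq> 0" for L
  proof -
    obtain A where f: "finite L" and A: "A \<subseteq> L" "\<theta> A \<noteq> 0" "\<sigma> (L - A) \<noteq> 0"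
      using gmul_nonzeroE[OF L] .
    then have o: "odd (card A) \<and> A \<subseteq> {1..N}" "odd (card (L - A)) \<and> L - A \<subseteq> {1..N}"
      using oc odd by auto
    moreover have "card L = card A + card (L - A)"
      using A f by (metis card_Diff_subset card_mono finite_subset le_add_diff_inverse)
    ultimately show ?thesis using f A(1) by fastforce
  qed
  define u where "u = Evg (gmul \<theta> \<sigma>)"
  have u: "coef u = gmul \<theta> \<sigma>" unfolding u_def by (rule Evg_inverse) (use prod_even in auto)
  have "supported N u \<and> u * u = 0 \<and> body u = 0 \<and> (\<forall>e\<in>slopes. W e = coef u \<or> W e = coef (- u))"
  proof (intro conjI)
    show "supported N u" using prod_even by (auto simp: supported_def u)
    show "u * u = 0" using sq' by (metis coef_inject times_evg.rep_eq u zero_evg.rep_eq)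
    show "body u = 0" using prod_even by (auto simp: body_def u)
    show "\<forall>e\<in>slopes. W e = coef u \<or> W e = coef (- u)"
      unfolding u uminus_evg.rep_eq using W by blast
  qed
  then have "supported N v \<and> v * v = 0 \<and> body v = 0 \<and> (\<forall>e\<in>slopes. W e = coef v \<or> W e = coef (- v))"
    unfolding v_def by (rule someI)
  then show "supported N v" "v * v = 0" "body v = 0" "e \<in> slopes \<Longrightarrow> W e = coef v \<or> W e = coef (- v)"
    by blast+
qed

text \<open>All data are extended evenly from slopes to integer vectors, with harmless values at
  non-primitive vectors.\<close>

definition lam_ext :: "int \<times> int \<Rightarrow> evg" where
  "lam_ext s = (if slope s \<in> slopes then Evg (lam (slope s)) else 1)"

definition W_ext :: "int \<times> int \<Rightarrow> evg" where
  "W_ext s = (if slope s \<in> slopes then Evg (W (slope s)) else v)"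

lemma slope_eq: "s \<in> slopes \<Longrightarrow> slope s = s"
  by (simp add: slope_def)

lemma coef_lam_ext: "slope s \<in> slopes \<Longrightarrow> coef (lam_ext s) = lam (slope s)"
proof -
  assume s: "slope s \<in> slopes"
  then have "even_el N (lam (slope s))" using sT by (auto simp: sTeich_def ideal_arcs_def)
  then have "\<forall>L. lam (slope s) L \<noteq> 0 \<longrightarrow> finite L \<and> even (card L)"
    unfolding even_el_def gr_carrier_def by (meson finite_atLeastAtMost finite_subset)
  then show ?thesis using s by (simp add: lam_ext_def Evg_inverse)
qed

lemma W_ext_cases: "W_ext s = v \<or> W_ext s = - v"
  using v_props(4)[of "slope s"] by (auto simp: W_ext_def coef_inverse)

lemma coef_W_ext: "slope s \<in> slopes \<Longrightarrow> coef (W_ext s) = W (slope s)"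
  using v_props(4)[of "slope s"] by (auto simp: W_ext_def coef_inverse)

lemma lam_ext_pos: "0 < body (lam_ext s)"
proof (cases "slope s \<in> slopes")
  case True
  then have "0 < gbody (lam (slope s))" using sT by (auto simp: sTeich_def ideal_arcs_def)
  then show ?thesis using coef_lam_ext[OF True] by (simp add: body_def gbody_def)
qed (simp add: lam_ext_def)

lemma supported_lam_ext: "supported N (lam_ext s)"
proof (cases "slope s \<in> slopes")
  case True
  then have "even_el N (lam (slope s))" using sT by (auto simp: sTeich_def ideal_arcs_def)
  then show ?thesis using coef_lam_ext[OF True] by (auto simp: supported_def even_el_def gr_carrier_def)
qed (simp add: lam_ext_def supported_1)

lemma supported_W_ext: "supported N (W_ext s)"
  using W_ext_cases[of s] v_props(1) by (auto simp: supported_def)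

lemma even_ext: "lam_ext (- s) = lam_ext s" "W_ext (- s) = W_ext s"
proof -
  have "slope (- s) = slope s \<or> slope (- s) \<notin> slopes \<and> slope s \<notin> slopes"
    using slope_minus_notin[of s] by (auto simp: slope_def)
  then show "lam_ext (- s) = lam_ext s" "W_ext (- s) = W_ext s" by (auto simp: lam_ext_def W_ext_def)
qed

text \<open>The arcs a + b and a - b are the two diagonals that complete a, b to a triangulation;
  they are exchanged by a flip.\<close>

lemma ptolemy:
  assumes "\<bar>det2 a b\<bar> = 1"
  shows "lam_ext (a + b) * lam_ext (a - b) = lam_ext a * lam_ext a + lam_ext b * lam_ext b + lam_ext a * lam_ext b * W_ext (a + b)"
    and "W_ext (a - b) = W_ext (a + b)"
proof -
  have d: "\<bar>det2 b a\<bar> = 1" "\<bar>det2 (a + b) a\<bar> = 1" "\<bar>det2 (a - b) a\<bar> = 1"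
    using assms det2_swap[of b a] by simp_all
  have dd: "\<bar>det2 b (a + b)\<bar> = 1" "\<bar>det2 a (a + b)\<bar> = 1" "\<bar>det2 b (a - b)\<bar> = 1" "\<bar>det2 a (a - b)\<bar> = 1"
    using assms d(1) by simp_all
  note s = slope_in_slopes[OF assms] slope_in_slopes[OF d(1)] slope_in_slopes[OF d(2)] slope_in_slopes[OF d(3)]
  have "is_triang (slope a) (slope b) (slope (a + b))" "is_triang (slope a) (slope b) (slope (a - b))"
    using s assms dd by (simp_all only: is_triang_def ideal_arcs_def abs_det2_slope)
  moreover have "slope (a + b) \<noteq> slope (a - b)"
  proof
    assume "slope (a + b) = slope (a - b)"
    then have "a + b = a - b \<or> a + b = - (a - b)" by (auto simp: slope_def split: if_splits)
    then have "b = 0 \<or> a = 0" by (auto simp: prod_eq_iff)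
    then show False using assms by (auto simp: det2_def)
  qed
  ultimately have p: "gmul (lam (slope (a + b))) (lam (slope (a - b))) =
      gadd (gadd (gmul (lam (slope a)) (lam (slope a))) (gmul (lam (slope b)) (lam (slope b))))
        (gmul (gmul (lam (slope a)) (lam (slope b))) (W (slope (a + b))))"
    "W (slope (a - b)) = W (slope (a + b))"
    using sT unfolding sTeich_def by blast+
  show "lam_ext (a + b) * lam_ext (a - b) = lam_ext a * lam_ext a + lam_ext b * lam_ext b + lam_ext a * lam_ext b * W_ext (a + b)"
    using p(1) unfolding coef_lam_ext[OF s(1), symmetric] coef_lam_ext[OF s(2), symmetric] coef_lam_ext[OF s(3), symmetric]
      coef_lam_ext[OF s(4), symmetric] coef_W_ext[OF s(3), symmetric] grass_ops_coef coef_inject .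
  show "W_ext (a - b) = W_ext (a + b)"
    using p(2) s by (simp add: W_ext_def)
qed

lemma lam_ext_inverse [simp]: "lam_ext s * inverse (lam_ext s) = 1"
  using evg_right_inverse[of "lam_ext s"] lam_ext_pos[of s] by simp

definition tri :: "int \<times> int \<Rightarrow> int \<times> int \<Rightarrow> int \<times> int \<Rightarrow> evg" where
  "tri a b c = lam_ext a * inverse (lam_ext b) * inverse (lam_ext c) + lam_ext b * inverse (lam_ext a) * inverse (lam_ext c)
     + lam_ext c * inverse (lam_ext a) * inverse (lam_ext b)
     + W_ext a * inverse (lam_ext a) + W_ext b * inverse (lam_ext b) + W_ext c * inverse (lam_ext c)"

text \<open>The semi-perimeter in terms of an edge: for c = a + b the Ptolemy relation turns a / (b
  c) + b / (a c) + W c / c into \<lambda> (a - b) / (a b). Clearing denominators yields the sum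
  relation for X.\<close>

definition edge_h :: "int \<times> int \<Rightarrow> int \<times> int \<Rightarrow> evg" where
  "edge_h a b = (lam_ext (a + b) + lam_ext (a - b)) * inverse (lam_ext a) * inverse (lam_ext b) + W_ext a * inverse (lam_ext a) + W_ext b * inverse (lam_ext b)"

lemma edge_h_even: "edge_h a (- b) = edge_h a b" "edge_h (- a) b = edge_h a b"
proof -
  have "lam_ext (- a + b) = lam_ext (a - b)" "lam_ext (- a - b) = lam_ext (a + b)"
    using even_ext(1)[of "a - b"] even_ext(1)[of "a + b"] by simp_all
  then show "edge_h (- a) b = edge_h a b" by (simp add: edge_h_def even_ext add.commute)
qed (simp add: edge_h_def even_ext add.commute)

lemma edge_h_tri:
  assumes "\<bar>det2 a b\<bar> = 1"
  shows "edge_h a b = tri a b (a + b)"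
proof -
  let ?A = "lam_ext a" and ?B = "lam_ext b" and ?C = "lam_ext (a + b)" and ?E = "lam_ext (a - b)" and ?w = "W_ext (a + b)"
  let ?a = "inverse ?A" and ?b = "inverse ?B" and ?c = "inverse ?C"
  have "?E * ?a * ?b = (?C * ?E) * (?a * ?b * ?c)"
    using lam_ext_inverse[of "a + b"] by (simp add: mult_ac)
  also have "\<dots> = (?A * ?a) * (?A * ?b * ?c) + (?B * ?b) * (?B * ?a * ?c) + (?A * ?a) * ((?B * ?b) * (?w * ?c))"
    unfolding ptolemy(1)[OF assms] by (simp only: algebra_simps)
  finally show ?thesis by (simp add: edge_h_def tri_def algebra_simps)
qed

text \<open>Up to signs the edges (a, b), (a, a + b) and (a + b, b) belong to the same triangle, and
  \<open>tri\<close> is symmetric and insensitive to signs.\<close>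

lemma edge_h_step:
  assumes "\<bar>det2 a b\<bar> = 1"
  shows "edge_h a (a + b) = edge_h a b" "edge_h (a + b) b = edge_h a b"
proof -
  have e: "a + - (a + b) = - b" "a + b + - b = a" by simp_all
  have d: "\<bar>det2 a (- (a + b))\<bar> = 1" "\<bar>det2 (a + b) (- b)\<bar> = 1"
    using assms by simp_all
  have "edge_h a (a + b) = tri a (- (a + b)) (- b)"
    using edge_h_tri[OF d(1)] edge_h_even(1)[of a "a + b"] e by simp
  also have "\<dots> = tri a b (a + b)" using even_ext[of "a + b"] by (simp add: tri_def even_ext mult_ac add_ac)
  finally show "edge_h a (a + b) = edge_h a b" by (simp add: edge_h_tri[OF assms])
  have "edge_h (a + b) b = tri (a + b) (- b) a"
    using edge_h_tri[OF d(2)] edge_h_even(1)[of "a + b" b] e by simp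
  also have "\<dots> = tri a b (a + b)" by (simp add: tri_def even_ext mult_ac add_ac)
  finally show "edge_h (a + b) b = edge_h a b" by (simp add: edge_h_tri[OF assms])
qed

definition h :: evg where "h = tri (1, 0) (0, 1) (1, 1)"

lemma supported_h: "supported N h"
  unfolding h_def tri_def by (intro supported_intros supported_lam_ext supported_W_ext)

lemma super_h_coef: "super_h N lam W = coef h"
proof -
  have s: "(1, 0) \<in> slopes" "(0, 1) \<in> slopes" "(1, 1) \<in> slopes" by (simp_all add: slopes_def)
  have lc: "lam e = coef (lam_ext e)" "W e = coef (W_ext e)" if "e \<in> slopes" for e
    using that coef_lam_ext[of e] coef_W_ext[of e] by (simp_all add: slope_eq)
  have i: "inverse (lam_ext a * lam_ext b) = inverse (lam_ext a) * inverse (lam_ext b)" for a b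
    using lam_ext_pos[of a] lam_ext_pos[of b] by (intro evg_inverse_mult) auto
  show ?thesis
    unfolding super_h_def Let_def lc(1)[OF s(1)] lc(1)[OF s(2)] lc(1)[OF s(3)]
      lc(2)[OF s(1)] lc(2)[OF s(2)] lc(2)[OF s(3)] ginv_def grass_ops_coef
    by (simp add: gfun_coef supported_intros supported_lam_ext grass_ops_coef inverse_evg_def[symmetric] i h_def tri_def
        add.assoc mult.assoc)
qed

lemma mcshane_term_coef:
  assumes c: "c \<in> slopes"
  shows "mcshane_term N lam W c = coef (mterm (lam_ext c * h) (W_ext c))"
proof -
  have lc: "lam c = coef (lam_ext c)" "W c = coef (W_ext c)"
    using c coef_lam_ext[of c] coef_W_ext[of c] by (simp_all add: slope_eq)
  note ci = supported_intros supported_lam_ext supported_W_ext supported_h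
  have r: "r_arc N lam W c = coef ((1/2) *\<^sub>R (lam_ext c * h - W_ext c
      + efun sqrt ((lam_ext c * h - W_ext c) * (lam_ext c * h - W_ext c) - of_real 4)))"
    unfolding r_arc_def Let_def lc super_h_coef gsqrt_def grass_ops_coef
    by (subst gfun_coef) (intro ci, simp add: grass_ops_coef)
  have sl: "super_length N lam W c = coef (2 *\<^sub>R efun ln ((1/2) *\<^sub>R (lam_ext c * h - W_ext c
      + efun sqrt ((lam_ext c * h - W_ext c) * (lam_ext c * h - W_ext c) - of_real 4))))"
    unfolding super_length_def disjoint_arc_def r glog_def
    by (subst gfun_coef) (intro ci, simp add: grass_ops_coef)
  show ?thesis
    unfolding mcshane_term_def Let_def sl W_curve_def disjoint_arc_def lc ginv_def gexp_def gsinh_def gcosh_def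
      grass_ops_coef mterm_def inverse_evg_def
    by (simp add: gfun_coef ci gpow_coef grass_ops_coef del: of_real_numeral)
qed

end

section \<open>The identity\<close>

text \<open>Slopes of negative sign form a second tree; reflecting the data lets one tree of
  positive vectors serve for both. Determinants change at most their sign.\<close>

definition mirror :: "bool \<Rightarrow> int \<times> int \<Rightarrow> int \<times> int" where
  "mirror b s = (if b then s else (- fst s, snd s))"

lemma mirror_add: "mirror b (s + t) = mirror b s + mirror b t"
  and mirror_diff: "mirror b (s - t) = mirror b s - mirror b t"
  and mirror_minus: "mirror b (- s) = - mirror b s"
  and mirror_det: "\<bar>det2 (mirror b s) (mirror b t)\<bar> = \<bar>det2 s t\<bar>"
  by (auto simp: mirror_def det2_def prod_eq_iff abs_if)

lemma farey_cone_axes: "farey_cone (1, 0) (0, 1) = pospairs"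
  by (simp add: farey_cone_def comb_def)

lemma slopes_decomp:
  "slopes = insert (1, 0) (insert (0, 1) (pospairs \<union> mirror False ` pospairs))"
proof
  show "slopes \<subseteq> insert (1, 0) (insert (0, 1) (pospairs \<union> mirror False ` pospairs))"
  proof
    fix s assume s: "s \<in> slopes"
    obtain p q where pq: "s = (p, q)" by (cases s)
    have "q = 0 \<or> 0 < q" using s pq by (auto simp: slopes_def)
    then consider "q = 0" | "p = 0" "0 < q" | "0 < p" "0 < q" | "p < 0" "0 < q"
      by linarith
    then show "s \<in> insert (1, 0) (insert (0, 1) (pospairs \<union> mirror False ` pospairs))"
    proof cases
      case 4
      then have "(- p, q) \<in> pospairs" using s pq by (auto simp: slopes_def pospairs_def)
      then have "s \<in> mirror False ` pospairs" by (rule rev_image_eqI) (simp add: mirror_def pq)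
      then show ?thesis by blast
    qed (use s pq in \<open>auto simp: slopes_def pospairs_def\<close>)
  qed
  show "insert (1, 0) (insert (0, 1) (pospairs \<union> mirror False ` pospairs)) \<subseteq> slopes"
    by (auto simp: slopes_def pospairs_def mirror_def)
qed

text \<open>The norm is a finite sum of absolute coefficients, so unconditional convergence of each
  coefficient suffices.\<close>

lemma gsums_to_of_has_sum:
  assumes "\<And>L. L \<subseteq> {1..N} \<Longrightarrow> ((\<lambda>c. t c L) has_sum s L) S"
  shows "gsums_to N t S s"
  unfolding gsums_to_def
proof (intro allI impI)
  fix e :: real assume e: "0 < e"
  let ?P = "Pow {1..N}"
  have lim: "((\<lambda>G. \<Sum>L\<in>?P. \<bar>(\<Sum>c\<in>G. t c L) - s L\<bar>) \<longlongrightarrow> (\<Sum>L\<in>?P. \<bar>s L - s L\<bar>)) (finite_subsets_at_top S)"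
    using assms by (intro tendsto_intros) (auto simp: has_sum_def)
  have "\<forall>\<^sub>F G in finite_subsets_at_top S. (\<Sum>L\<in>?P. \<bar>(\<Sum>c\<in>G. t c L) - s L\<bar>) < e"
    using order_tendstoD(2)[OF lim] e by simp
  then show "\<exists>F. finite F \<and> F \<subseteq> S \<and> (\<forall>G. finite G \<and> F \<subseteq> G \<and> G \<subseteq> S \<longrightarrow> gnorm N (gsub (gsum G t) s) < e)"
    unfolding eventually_finite_subsets_at_top by (simp add: gnorm_def gsub_def gsum_def)
qed

context super_teich
begin

lemma edge_h_mirror: "farey_edge s t \<Longrightarrow> edge_h (mirror b s) (mirror b t) = h"
proof (induction rule: farey_desc.induct)
  case base
  have "edge_h (mirror b (1, 0)) (mirror b (0, 1)) = edge_h (1, 0) (0, 1)"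
    using edge_h_even(2)[of "(1, 0)" "(0, 1)"] by (simp add: mirror_def)
  also have "\<dots> = h" unfolding h_def by (subst edge_h_tri) (simp_all add: det2_def)
  finally show ?case .
next
  case (left s t)
  then show ?case
    using edge_h_step(1)[of "mirror b s" "mirror b t"] farey_edge_coords(1)[of s t] mirror_det[of b s t] by (simp add: mirror_add)
next
  case (right s t)
  then show ?case
    using edge_h_step(2)[of "mirror b s" "mirror b t"] farey_edge_coords(1)[of s t] mirror_det[of b s t] by (simp add: mirror_add)
qed

lemma h_pos: "0 < body h"
proof -
  have [simp]: "body (W_ext s) = 0" for s using W_ext_cases[of s] v_props(3) by auto
  show ?thesis
    unfolding h_def tri_def by (simp add: lam_ext_pos add_pos_pos)
qed

text \<open>The sum relation is the equation \<open>edge_h\<close> = h with denominators cleared,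
  multiplied by h. The product relation is the Ptolemy relation multiplied by h^2.\<close>

lemma super_tree_mirror: "super_tree (\<lambda>s. lam_ext (mirror b s) * h) (\<lambda>s. W_ext (mirror b s)) v"
proof
  fix s t
  show "0 < body (lam_ext (mirror b s) * h)" using lam_ext_pos h_pos by simp
  show "lam_ext (mirror b (- s)) * h = lam_ext (mirror b s) * h" by (simp add: mirror_minus even_ext)
  show "v * v = 0" "body v = 0" by (rule v_props)+
  show "W_ext (mirror b s) = v \<or> W_ext (mirror b s) = - v" by (rule W_ext_cases)
  assume e: "farey_edge s t"
  let ?a = "mirror b s" and ?b = "mirror b t"
  have d: "\<bar>det2 ?a ?b\<bar> = 1" using farey_edge_coords(1)[OF e] mirror_det by simp
  note pt = ptolemy[OF d]
  have "h * (lam_ext ?a * lam_ext ?b) = edge_h ?a ?b * (lam_ext ?a * lam_ext ?b)" by (simp only: edge_h_mirror[OF e])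
  also have "\<dots> = (lam_ext (?a + ?b) + lam_ext (?a - ?b)) * (lam_ext ?a * inverse (lam_ext ?a)) * (lam_ext ?b * inverse (lam_ext ?b))
      + W_ext ?a * lam_ext ?b * (lam_ext ?a * inverse (lam_ext ?a)) + W_ext ?b * lam_ext ?a * (lam_ext ?b * inverse (lam_ext ?b))"
    unfolding edge_h_def by (simp only: algebra_simps)
  finally have H: "lam_ext (?a + ?b) + lam_ext (?a - ?b) = h * (lam_ext ?a * lam_ext ?b) - W_ext ?a * lam_ext ?b - W_ext ?b * lam_ext ?a"
    by (simp add: algebra_simps)
  have "lam_ext (mirror b (s + t)) * h + lam_ext (mirror b (s - t)) * h = (lam_ext (?a + ?b) + lam_ext (?a - ?b)) * h"
    by (simp add: mirror_add mirror_diff distrib_right)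
  then show "lam_ext (mirror b (s + t)) * h + lam_ext (mirror b (s - t)) * h =
      lam_ext ?a * h * (lam_ext ?b * h) - W_ext ?a * (lam_ext ?b * h) - W_ext ?b * (lam_ext ?a * h)"
    unfolding H by (simp add: algebra_simps)
  have "lam_ext (mirror b (s + t)) * h * (lam_ext (mirror b (s - t)) * h) = (lam_ext (?a + ?b) * lam_ext (?a - ?b)) * (h * h)"
    by (simp add: mirror_add mirror_diff mult_ac)
  then show "lam_ext (mirror b (s + t)) * h * (lam_ext (mirror b (s - t)) * h) =
      lam_ext ?a * h * (lam_ext ?a * h) + lam_ext ?b * h * (lam_ext ?b * h) + lam_ext ?a * h * (lam_ext ?b * h) * W_ext (mirror b (s + t))"
    unfolding pt(1) mirror_add by (simp add: algebra_simps)
qed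

theorem mcshane_identity: "gsums_to N (mcshane_term N lam W) slopes (gconst (1/2))"
proof (rule gsums_to_of_has_sum)
  fix L assume L: "L \<subseteq> {1..N}"
  interpret A: super_tree N "\<lambda>s. lam_ext (mirror True s) * h" "\<lambda>s. W_ext (mirror True s)" v by (rule super_tree_mirror)
  interpret B: super_tree N "\<lambda>s. lam_ext (mirror False s) * h" "\<lambda>s. W_ext (mirror False s)" v by (rule super_tree_mirror)
  define t where "t = (\<lambda>c. coef (mterm (lam_ext c * h) (W_ext c)) L)"
  have root: "farey_edge (1, 0) (0, 1)" by (rule farey_desc.base)
  have gt: "2 < A.x c \<and> 2 < B.x c" if c: "c \<in> pospairs" for c
  proof -
    obtain s t where "farey_edge s t" "c = s + t"
      using farey_cone_farey_desc[of c "(1, 0)" "(0, 1)"] c unfolding farey_cone_axes by blast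
    then show ?thesis using A.gt_2(3) B.gt_2(3) by blast
  qed
  have "((\<lambda>c. (1/2) * coef (A.T c) L) has_sum (1/2) * coef (A.D (1, 0) (0, 1)) L) pospairs"
    using A.has_sum_cone[OF root L] unfolding farey_cone_axes by (rule has_sum_cmult_right)
  then have sA: "(t has_sum (1/2) * coef (A.D (1, 0) (0, 1)) L) pospairs"
    by (rule has_sum_cong[THEN iffD1, rotated]) (use A.mterm_eq_T gt in \<open>simp add: t_def mirror_def\<close>)
  have "((\<lambda>c. (1/2) * coef (B.T c) L) has_sum (1/2) * coef (B.D (1, 0) (0, 1)) L) pospairs"
    using B.has_sum_cone[OF root L] unfolding farey_cone_axes by (rule has_sum_cmult_right)
  then have "((t \<circ> mirror False) has_sum (1/2) * coef (B.D (1, 0) (0, 1)) L) pospairs"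
    by (rule has_sum_cong[THEN iffD1, rotated]) (use B.mterm_eq_T gt in \<open>simp add: t_def\<close>)
  moreover have inj: "inj_on (mirror False) pospairs" by (auto simp: inj_on_def mirror_def prod_eq_iff)
  ultimately have sB: "(t has_sum (1/2) * coef (B.D (1, 0) (0, 1)) L) (mirror False ` pospairs)"
    by (simp add: has_sum_reindex)
  have "(t has_sum ((1/2) * coef (A.D (1, 0) (0, 1)) L + (1/2) * coef (B.D (1, 0) (0, 1)) L))
      (pospairs \<union> mirror False ` pospairs)"
    using sA sB by (rule has_sum_Un_disjoint) (auto simp: pospairs_def mirror_def)
  then have sum: "(t has_sum (t (1, 0) + (t (0, 1) +
      ((1/2) * coef (A.D (1, 0) (0, 1)) L + (1/2) * coef (B.D (1, 0) (0, 1)) L)))) slopes"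
    unfolding slopes_decomp by (intro has_sum_insert) (auto simp: pospairs_def mirror_def)
  have t: "t (1, 0) = (1/2) * coef (A.T (1, 0)) L" "t (0, 1) = (1/2) * coef (A.T (0, 1)) L"
    using A.mterm_eq_T[OF A.gt_2(1)[OF root]] A.mterm_eq_T[OF A.gt_2(2)[OF root]] by (simp_all add: t_def mirror_def)
  \<comment> \<open>The two trees lie on either side of the edge (1, 0), (0, 1). Their leading terms
    have numerators X (1, -1) and X (1, 1), so the sum relation adds them up to 1 - W / X - W / X,
    with one W / X for each end of the edge. Together with the rho terms this leaves exactly the
    contributions of the two end slopes.\<close>
  have "A.D (1, 0) (0, 1) + B.D (1, 0) (0, 1) = 1 - A.T (1, 0) - A.T (0, 1)"
  proof -
    let ?a = "(1, 0) :: int \<times> int" and ?b = "(0, 1) :: int \<times> int"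
    let ?A = "lam_ext ?a * h" and ?B = "lam_ext ?b * h"
    have Bx: "lam_ext (mirror False (?a - ?b)) = lam_ext (?a + ?b)" "lam_ext (mirror False ?a) = lam_ext ?a" "lam_ext (mirror False ?b) = lam_ext ?b"
      "W_ext (mirror False ?a) = W_ext ?a" "W_ext (mirror False ?b) = W_ext ?b"
      using even_ext[of "(1, 1)"] even_ext[of "(1, 0)"] by (simp_all add: mirror_def)
    have rho: "B.rho ?a = A.rho ?a" "B.rho ?b = A.rho ?b"
      by (simp_all only: A.rho_def B.rho_def A.R_def B.R_def A.Y_def B.Y_def Bx) (simp_all add: mirror_def)
    have i: "?A * inverse ?A = 1" "?B * inverse ?B = 1"
      using A.X_inverse(1)[of ?a] A.X_inverse(1)[of ?b] by (simp_all add: mirror_def)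
    have "lam_ext (?a + ?b) * h + lam_ext (?a - ?b) * h = ?A * ?B - W_ext ?a * ?B - W_ext ?b * ?A"
      using A.X_sum[OF root] by (simp add: mirror_def)
    then have "(lam_ext (?a - ?b) * h + lam_ext (?a + ?b) * h) * (inverse ?A * inverse ?B) =
        (?A * ?B - W_ext ?a * ?B - W_ext ?b * ?A) * (inverse ?A * inverse ?B)" by (simp add: add.commute)
    also have "\<dots> = (?A * inverse ?A) * (?B * inverse ?B) - W_ext ?a * inverse ?A * (?B * inverse ?B)
        - W_ext ?b * inverse ?B * (?A * inverse ?A)" by (simp only: algebra_simps)
    finally have s: "(lam_ext (?a - ?b) * h + lam_ext (?a + ?b) * h) * (inverse ?A * inverse ?B) =
        1 - W_ext ?a * inverse ?A - W_ext ?b * inverse ?B" unfolding i by simp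
    have "A.D ?a ?b + B.D ?a ?b = (lam_ext (?a - ?b) * h + lam_ext (?a + ?b) * h) * (inverse ?A * inverse ?B)
        - 2 *\<^sub>R (A.rho ?a * inverse ?A) - 2 *\<^sub>R (A.rho ?b * inverse ?B)"
      unfolding A.D_def B.D_def rho Bx by (simp only: mirror_def if_True) (simp only: algebra_simps scaleR_2)
    then show ?thesis unfolding s A.T_def by (simp add: mirror_def algebra_simps)
  qed
  then have D: "coef (A.D (1, 0) (0, 1)) L + coef (B.D (1, 0) (0, 1)) L =
      coef 1 L - coef (A.T (1, 0)) L - coef (A.T (0, 1)) L"
    by (metis coef_simps(1,2))
  have "t (1, 0) + (t (0, 1) + ((1/2) * coef (A.D (1, 0) (0, 1)) L + (1/2) * coef (B.D (1, 0) (0, 1)) L))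
      = (1/2) * coef 1 L"
    using t D by linarith
  also have "\<dots> = gconst (1/2) L" by (simp add: gconst_def coef_one)
  finally have "(t has_sum gconst (1/2) L) slopes" using sum by (simp only:)
  then show "((\<lambda>c. mcshane_term N lam W c L) has_sum gconst (1/2) L) slopes"
    by (rule has_sum_cong[THEN iffD1, rotated]) (simp add: t_def mcshane_term_coef)
qed

end

theorem theorem6p1:
  fixes N :: nat and lam W :: "int \<times> int \<Rightarrow> nat set \<Rightarrow> real"
  assumes "sTeich N lam W"
  shows "gsums_to N (mcshane_term N lam W) scc (gconst (1/2))"
  using super_teich.mcshane_identity[OF super_teich.intro[OF assms]] by (simp add: scc_def)

end
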